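(* Let $M$ be a $C^\infty$ Riemannian manifold of dimension $n\ge2$. Given $a>0$, let $\Sigma\subset M\times\mathbb{R}$ be the $a$-pitched twisting of a hypersurface $\Sigma_0\subset M$ determined by a one-parameter group $\{\Gamma_s\,;\,s\in I\}\subset\mathrm{Isom}(M)$. Then $\nabla\xi$ never vanishes on $\Sigma$. Furthermore, $\nabla\xi$ defines an asymptotic direction on $\Sigma$ if and only if the gradient $\nabla\nu$ of the $\nu$-function of $\Sigma$ is a horizontal field. If so, $\Sigma$ is a minimal vertical helicoid in $M\times\mathbb{R}$, provided $\Sigma_0$ is minimal in $M$ and $\nu$ is nonconstant on $\Sigma$. Under these conditions, the open set $$\Sigma'=\{(\alpha_p(s),as)\in\Sigma\,;\,|\nu(\alpha_p(s),as)|>a\}\subset\Sigma,$$ if nonempty, is spacelike and, then, zero mean isocurved in $M\times\mathbb{R}$.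
   Context: $M\times\mathbb{R}$ carries the product metric $\langle\,,\rangle=\langle\,,\rangle_M+dt^2$ with Levi-Civita connection $\overline\nabla$; $\partial_t$ is the unit vertical field. For an orientable hypersurface $\Sigma\subset M\times\mathbb{R}$ with unit normal $N$: the shape operator is $AX=-\overline\nabla_XN$; the mean curvature is $H=\mathrm{trace}\,A$ (not normalized); $\xi$ is the restriction to $\Sigma$ of the projection onto $\mathbb{R}$, with gradient $\nabla\xi$ on $\Sigma$; $\Theta=\langle N,\partial_t\rangle$ is the angle function. A horizontal point is a point where $\Theta^2=1$ (a critical point of $\xi$). A horizontal section of $\Sigma$ is $\Sigma_t=\Sigma\cap(M\times\{t\})$ when the intersection is transversal. A field $X$ is horizontal if it is tangent to the factor $M$, i.e. $\langle X,\partial_t\rangle=0$. $\nabla\xi$ is an asymptotic direction if $\langle A\nabla\xi,\nabla\xi\rangle=0$ on $\Sigma$. Twisting: $I\ni0$ is an open interval and $\Gamma_s:M\to M$, $s\in I$, is a one-parameter group of isometries with $\Gamma_0=\mathrm{id}$. For a hypersurface $\Sigma_0^{n-1}\subset M^n$ with unit normal field $\eta$, put $\Sigma_s=\Gamma_s(\Sigma_0)$ with unit normal $\eta_s=\Gamma_{s*}\eta$, and $\alpha_p(s)=\Gamma_s(p)$ for $p\in\Sigma_0$. The $a$-pitched twisting of $\Sigma_0$ determined by $\{\Gamma_s\}$ is $\Sigma=\{(\Gamma_s(p),as)\in M\times\mathbb{R}\,;\,p\in\Sigma_0,\ s\in I\}$. Its $\nu$-function is $\nu(\alpha_p(s),as)=\langle\alpha_p'(s),\eta_s(\alpha_p(s))\rangle$;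 $\nabla\nu$ is its gradient on $\Sigma$. Vertical helicoid: a hypersurface with no horizontal points and nonconstant angle function whose horizontal sections $\Sigma_t$ are minimal hypersurfaces of $M\times\{t\}$ and such that $\langle A\nabla\xi,\nabla\xi\rangle=0$ on $\Sigma$. Lorentzian notions: $\langle\,,\rangle_L=\langle\,,\rangle_M-dt^2$. $\Sigma$ is spacelike if $\langle\,,\rangle_L$ is positive definite on $\Sigma$ (equivalently $2\Theta^2>1$). For spacelike $\Sigma$, put $N_L=\mu\,(N-2\Theta\partial_t)$ with $\mu=-1/\sqrt{2\Theta^2-1}$ (so $\langle N_L,N_L\rangle_L=-1$), $A_LX=-\overline\nabla_XN_L$, $H_L=-\mathrm{trace}\,A_L$. A spacelike $\Sigma$ is zero mean isocurved if $H=H_L=0$. *)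

theory Defs
  imports "HOL-Analysis.Analysis"
begin

section \<open>Smooth maps between open subsets of Euclidean spaces\<close>

primrec times_differentiable_on ::
    "'a::real_normed_vector set \<Rightarrow> nat \<Rightarrow> ('a \<Rightarrow> 'b::real_normed_vector) \<Rightarrow> bool" where
  "times_differentiable_on U 0 f \<longleftrightarrow> continuous_on U f"
| "times_differentiable_on U (Suc k) f \<longleftrightarrow>
     (\<forall>x\<in>U. f differentiable (at x)) \<and>
     (\<forall>v. times_differentiable_on U k (\<lambda>x. frechet_derivative f (at x) v))"

text \<open>Only used for open sets \<open>U\<close>.\<close>

definition smooth_on :: "'a::real_normed_vector set \<Rightarrow> ('a \<Rightarrow> 'b::real_normed_vector) \<Rightarrow> bool" where
  "smooth_on U f \<longleftrightarrow> (\<forall>k. times_differentiable_on U k f)"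


section \<open>Smooth manifolds\<close>

text \<open>
  The underlying set of a manifold is a (Hausdorff, second countable) type \<open>'m\<close>, and the model
  space is a Euclidean space \<open>'e\<close>, so the dimension is \<open>DIM('e)\<close>. A chart is a pair consisting of
  its domain and its coordinate map. The smooth structure is given by an atlas \<open>A\<close> indexed by the
  points: \<open>A p\<close> is a chart around \<open>p\<close>. Every smooth structure is generated by such an atlas.
  The chart \<open>A p\<close> is used to identify the tangent space at \<open>p\<close> with \<open>'e\<close>: a tangent vector at \<open>p\<close>
  is represented by its components in the chart \<open>A p\<close>.
\<close>

type_synonym ('m, 'e) chart = "'m set \<times> ('m \<Rightarrow> 'e)"
type_synonym ('m, 'e) atlas = "'m \<Rightarrow> ('m, 'e) chart"

abbreviation cdom :: "('m, 'e) chart \<Rightarrow> 'm set" where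
  "cdom C \<equiv> fst C"

abbreviation coord :: "('m, 'e) chart \<Rightarrow> 'm \<Rightarrow> 'e" where
  "coord C \<equiv> snd C"

abbreviation param :: "('m, 'e) chart \<Rightarrow> 'e \<Rightarrow> 'm" where
  "param C \<equiv> inv_into (cdom C) (coord C)"

definition is_chart :: "('m::topological_space, 'e::euclidean_space) chart \<Rightarrow> bool" where
  "is_chart C \<longleftrightarrow> open (cdom C) \<and> inj_on (coord C) (cdom C) \<and> open (coord C ` cdom C) \<and>
     homeomorphism (cdom C) (coord C ` cdom C) (coord C) (param C)"

definition compatible :: "('m, 'e::euclidean_space) chart \<Rightarrow> ('m, 'e) chart \<Rightarrow> bool" where
  "compatible C D \<longleftrightarrow>
     smooth_on (coord C ` (cdom C \<inter> cdom D)) (coord D \<circ> param C) \<and>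
     smooth_on (coord D ` (cdom C \<inter> cdom D)) (coord C \<circ> param D)"

definition smooth_atlas ::
    "('m::{t2_space, second_countable_topology}, 'e::euclidean_space) atlas \<Rightarrow> bool" where
  "smooth_atlas A \<longleftrightarrow>
     (\<forall>p. p \<in> cdom (A p) \<and> is_chart (A p) \<and> (\<forall>q. compatible (A p) (A q)))"

text \<open>The charts of the maximal atlas generated by \<open>A\<close>.\<close>

definition admissible_chart ::
    "('m::topological_space, 'e::euclidean_space) atlas \<Rightarrow> ('m, 'e) chart \<Rightarrow> bool" where
  "admissible_chart A C \<longleftrightarrow> is_chart C \<and> (\<forall>p. compatible C (A p))"

definition smooth_map_on ::
    "('m::topological_space, 'e::euclidean_space) atlas \<Rightarrow>
     ('n::topological_space, 'f::euclidean_space) atlas \<Rightarrow> 'm set \<Rightarrow> ('m \<Rightarrow> 'n) \<Rightarrow> bool" where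
  "smooth_map_on A B W f \<longleftrightarrow> open W \<and> continuous_on W f \<and>
     (\<forall>p q. smooth_on (coord (A p) ` (cdom (A p) \<inter> W \<inter> f -` cdom (B q)))
              (coord (B q) \<circ> f \<circ> param (A p)))"

definition tangent_map ::
    "('m, 'e::euclidean_space) atlas \<Rightarrow> ('n, 'f::euclidean_space) atlas \<Rightarrow>
     ('m \<Rightarrow> 'n) \<Rightarrow> 'm \<Rightarrow> 'e \<Rightarrow> 'f" where
  "tangent_map A B f p =
     frechet_derivative (coord (B (f p)) \<circ> f \<circ> param (A p)) (at (coord (A p) p))"

text \<open>
  \<open>to_chart A C q\<close> sends a tangent vector at \<open>q\<close> to its components in the chart \<open>C\<close>;
  \<open>from_chart A C q\<close> is its inverse.
\<close>

definition to_chart ::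
    "('m, 'e::euclidean_space) atlas \<Rightarrow> ('m, 'e) chart \<Rightarrow> 'm \<Rightarrow> 'e \<Rightarrow> 'e" where
  "to_chart A C q = frechet_derivative (coord C \<circ> param (A q)) (at (coord (A q) q))"

definition from_chart ::
    "('m, 'e::euclidean_space) atlas \<Rightarrow> ('m, 'e) chart \<Rightarrow> 'm \<Rightarrow> 'e \<Rightarrow> 'e" where
  "from_chart A C q = frechet_derivative (coord (A q) \<circ> param C) (at (coord C q))"

definition smooth_vector_field_on ::
    "('m::topological_space, 'e::euclidean_space) atlas \<Rightarrow> 'm set \<Rightarrow> ('m \<Rightarrow> 'e) \<Rightarrow> bool" where
  "smooth_vector_field_on A W X \<longleftrightarrow> open W \<and>
     (\<forall>p. smooth_on (coord (A p) ` (cdom (A p) \<inter> W))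
            (\<lambda>x. to_chart A (A p) (param (A p) x) (X (param (A p) x))))"

definition velocity ::
    "('m, 'e::euclidean_space) atlas \<Rightarrow> (real \<Rightarrow> 'm) \<Rightarrow> real \<Rightarrow> 'e" where
  "velocity A c t = vector_derivative (coord (A (c t)) \<circ> c) (at t)"


section \<open>Hypersurfaces\<close>

text \<open>Embedded hypersurfaces, described by slice charts.\<close>

definition hypersurface ::
    "('m::topological_space, 'e::euclidean_space) atlas \<Rightarrow> 'm set \<Rightarrow> bool" where
  "hypersurface A S \<longleftrightarrow>
     (\<forall>p\<in>S. \<exists>C b. admissible_chart A C \<and> p \<in> cdom C \<and> b \<noteq> 0 \<and>
        coord C ` (cdom C \<inter> S) = coord C ` cdom C \<inter> {x. x \<bullet> b = 0})"

text \<open>\<open>c\<close> is a curve in \<open>S\<close> with \<open>c 0 = p\<close> which is differentiable at \<open>0\<close> with velocity \<open>v\<close>.\<close>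

definition curve_through ::
    "('m::topological_space, 'e::euclidean_space) atlas \<Rightarrow> 'm set \<Rightarrow> 'm \<Rightarrow> 'e \<Rightarrow> (real \<Rightarrow> 'm) \<Rightarrow> bool"
  where
  "curve_through A S p v c \<longleftrightarrow> range c \<subseteq> S \<and> c 0 = p \<and> isCont c 0 \<and>
     ((coord (A p) \<circ> c) has_vector_derivative v) (at 0)"

definition tangent_space ::
    "('m::topological_space, 'e::euclidean_space) atlas \<Rightarrow> 'm set \<Rightarrow> 'm \<Rightarrow> 'e set" where
  "tangent_space A S p = {v. \<exists>c. curve_through A S p v c}"

definition smooth_field_along ::
    "('m::topological_space, 'e::euclidean_space) atlas \<Rightarrow> 'm set \<Rightarrow> ('m \<Rightarrow> 'e) \<Rightarrow> bool" where
  "smooth_field_along A S N \<longleftrightarrow>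
     (\<forall>p\<in>S. \<exists>W X. p \<in> W \<and> smooth_vector_field_on A W X \<and> (\<forall>q\<in>S \<inter> W. N q = X q))"


section \<open>Riemannian metrics and the Levi-Civita connection\<close>

type_synonym ('m, 'e) metric = "'m \<Rightarrow> 'e \<Rightarrow> 'e \<Rightarrow> real"

definition metric_in_chart ::
    "('m, 'e::euclidean_space) atlas \<Rightarrow> ('m, 'e) metric \<Rightarrow> ('m, 'e) chart \<Rightarrow> 'e \<Rightarrow> 'e \<Rightarrow> 'e \<Rightarrow> real" where
  "metric_in_chart A g C x v w =
     g (param C x) (from_chart A C (param C x) v) (from_chart A C (param C x) w)"

definition riemannian_metric ::
    "('m::topological_space, 'e::euclidean_space) atlas \<Rightarrow> ('m, 'e) metric \<Rightarrow> bool" where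
  "riemannian_metric A g \<longleftrightarrow>
     (\<forall>p. bilinear (g p) \<and> (\<forall>v w. g p v w = g p w v) \<and> (\<forall>v. v \<noteq> 0 \<longrightarrow> g p v v > 0)) \<and>
     (\<forall>p v w. smooth_on (coord (A p) ` cdom (A p)) (\<lambda>x. metric_in_chart A g (A p) x v w))"

text \<open>
  For constant \<open>u\<close> and \<open>v\<close> (coordinate fields of the chart \<open>C\<close>), \<open>christoffel A g C x u v\<close> are the
  components of the Levi-Civita derivative of \<open>v\<close> along \<open>u\<close> at the point with coordinates \<open>x\<close>.
  The equation is the Koszul formula for coordinate fields, whose brackets vanish.
\<close>

definition christoffel ::
    "('m, 'e::euclidean_space) atlas \<Rightarrow> ('m, 'e) metric \<Rightarrow> ('m, 'e) chart \<Rightarrow> 'e \<Rightarrow> 'e \<Rightarrow> 'e \<Rightarrow> 'e" where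
  "christoffel A g C x u v = (THE z. \<forall>w. 2 * metric_in_chart A g C x z w =
       frechet_derivative (\<lambda>y. metric_in_chart A g C y v w) (at x) u
     + frechet_derivative (\<lambda>y. metric_in_chart A g C y u w) (at x) v
     - frechet_derivative (\<lambda>y. metric_in_chart A g C y u v) (at x) w)"

text \<open>
  Levi-Civita covariant derivative at \<open>t = 0\<close> of a vector field \<open>V\<close> along the curve \<open>c\<close>, where
  \<open>V t\<close> is a tangent vector at \<open>c t\<close>, computed in the chart at \<open>c 0\<close>.
\<close>

definition has_covariant_derivative ::
    "('m, 'e::euclidean_space) atlas \<Rightarrow> ('m, 'e) metric \<Rightarrow> (real \<Rightarrow> 'm) \<Rightarrow> (real \<Rightarrow> 'e) \<Rightarrow> 'e \<Rightarrow> bool"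
  where
  "has_covariant_derivative A g c V Z \<longleftrightarrow>
     (\<exists>V'. ((\<lambda>t. to_chart A (A (c 0)) (c t) (V t)) has_vector_derivative V') (at 0) \<and>
       Z = V' + christoffel A g (A (c 0)) (coord (A (c 0)) (c 0)) (velocity A c 0) (V 0))"

definition isometry :: "('m::topological_space, 'e::euclidean_space) atlas \<Rightarrow> ('m, 'e) metric \<Rightarrow>
    ('m \<Rightarrow> 'm) \<Rightarrow> bool" where
  "isometry A g f \<longleftrightarrow> bij f \<and> smooth_map_on A A UNIV f \<and> smooth_map_on A A UNIV (inv f) \<and>
     (\<forall>p v w. g (f p) (tangent_map A A f p v) (tangent_map A A f p w) = g p v w)"


section \<open>Extrinsic geometry of hypersurfaces\<close>

definition unit_normal_field ::
    "('m::topological_space, 'e::euclidean_space) atlas \<Rightarrow> ('m, 'e) metric \<Rightarrow> 'm set \<Rightarrow>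
     ('m \<Rightarrow> 'e) \<Rightarrow> bool" where
  "unit_normal_field A g S N \<longleftrightarrow> smooth_field_along A S N \<and>
     (\<forall>p\<in>S. g p (N p) (N p) = 1 \<and> (\<forall>v\<in>tangent_space A S p. g p (N p) v = 0))"

text \<open>Gradient of a function on a hypersurface; it is tangent to the hypersurface.\<close>

definition grad ::
    "('m::topological_space, 'e::euclidean_space) atlas \<Rightarrow> ('m, 'e) metric \<Rightarrow> 'm set \<Rightarrow>
     ('m \<Rightarrow> real) \<Rightarrow> 'm \<Rightarrow> 'e" where
  "grad A g S f p = (THE v. v \<in> tangent_space A S p \<and>
     (\<forall>w c. curve_through A S p w c \<longrightarrow> ((f \<circ> c) has_real_derivative g p v w) (at 0)))"

text \<open>
  The map that sends \<open>v\<close> to minus the covariant derivative of the field \<open>N\<close> in direction \<open>v\<close>.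
  It will be applied to \<open>N\<close> as well as to the Lorentzian normal field, always with the
  Levi-Civita connection of the Riemannian metric.
\<close>

definition shape_operator ::
    "('m::topological_space, 'e::euclidean_space) atlas \<Rightarrow> ('m, 'e) metric \<Rightarrow> 'm set \<Rightarrow>
     ('m \<Rightarrow> 'e) \<Rightarrow> 'm \<Rightarrow> 'e \<Rightarrow> 'e" where
  "shape_operator A g S N p v =
     - (THE Z. \<forall>c. curve_through A S p v c \<longrightarrow> has_covariant_derivative A g c (N \<circ> c) Z)"

text \<open>Trace of an endomorphism \<open>L\<close> of a subspace \<open>T\<close>, computed in some basis of \<open>T\<close>.\<close>

definition trace_on :: "'e::euclidean_space set \<Rightarrow> ('e \<Rightarrow> 'e) \<Rightarrow> real" where
  "trace_on T L = (let B = (SOME B. independent B \<and> span B = T)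
     in \<Sum>b\<in>B. representation B (L b) b)"

definition mean_curvature ::
    "('m::topological_space, 'e::euclidean_space) atlas \<Rightarrow> ('m, 'e) metric \<Rightarrow> 'm set \<Rightarrow>
     ('m \<Rightarrow> 'e) \<Rightarrow> 'm \<Rightarrow> real" where
  "mean_curvature A g S N p = trace_on (tangent_space A S p) (shape_operator A g S N p)"

definition minimal_hypersurface ::
    "('m::topological_space, 'e::euclidean_space) atlas \<Rightarrow> ('m, 'e) metric \<Rightarrow> 'm set \<Rightarrow>
     ('m \<Rightarrow> 'e) \<Rightarrow> bool" where
  "minimal_hypersurface A g S N \<longleftrightarrow>
     hypersurface A S \<and> unit_normal_field A g S N \<and> (\<forall>p\<in>S. mean_curvature A g S N p = 0)"


section \<open>The product with the real line\<close>

text \<open>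
  The chart of the product at \<open>(p, t)\<close> is the product of \<open>A p\<close> with the identity of the real line,
  so a tangent vector at \<open>(p, t)\<close> is a pair of a tangent vector at \<open>p\<close> and a real number.
\<close>

definition product_atlas :: "('m, 'e) atlas \<Rightarrow> ('m \<times> real, 'e \<times> real) atlas" where
  "product_atlas A z =
     (cdom (A (fst z)) \<times> UNIV, \<lambda>y. (coord (A (fst z)) (fst y), snd y))"

definition product_metric :: "('m, 'e) metric \<Rightarrow> ('m \<times> real, 'e \<times> real) metric" where
  "product_metric g z u v = g (fst z) (fst u) (fst v) + snd u * snd v"

definition lorentz_metric :: "('m, 'e) metric \<Rightarrow> ('m \<times> real, 'e \<times> real) metric" where
  "lorentz_metric g z u v = g (fst z) (fst u) (fst v) - snd u * snd v"

definition vertical :: "'e::zero \<times> real" where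
  "vertical = (0, 1)"

definition grad_height ::
    "('m::topological_space, 'e::euclidean_space) atlas \<Rightarrow> ('m, 'e) metric \<Rightarrow> ('m \<times> real) set \<Rightarrow>
     'm \<times> real \<Rightarrow> 'e \<times> real" where
  "grad_height A g S = grad (product_atlas A) (product_metric g) S snd"

definition angle ::
    "('m, 'e::zero) metric \<Rightarrow> ('m \<times> real \<Rightarrow> 'e \<times> real) \<Rightarrow> 'm \<times> real \<Rightarrow> real" where
  "angle g N z = product_metric g z (N z) vertical"

definition horizontal_on ::
    "('m, 'e::zero) metric \<Rightarrow> ('m \<times> real) set \<Rightarrow> ('m \<times> real \<Rightarrow> 'e \<times> real) \<Rightarrow> bool" where
  "horizontal_on g S X \<longleftrightarrow> (\<forall>z\<in>S. product_metric g z (X z) vertical = 0)"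

definition asymptotic_height ::
    "('m::topological_space, 'e::euclidean_space) atlas \<Rightarrow> ('m, 'e) metric \<Rightarrow> ('m \<times> real) set \<Rightarrow>
     ('m \<times> real \<Rightarrow> 'e \<times> real) \<Rightarrow> bool" where
  "asymptotic_height A g S N \<longleftrightarrow>
     (\<forall>z\<in>S. product_metric g z
        (shape_operator (product_atlas A) (product_metric g) S N z (grad_height A g S z))
        (grad_height A g S z) = 0)"

text \<open>
  Horizontal section at height \<open>t\<close>, as a subset of the slice at height \<open>t\<close>, which is identified
  with the isometric first factor.
\<close>

definition horizontal_section :: "('m \<times> real) set \<Rightarrow> real \<Rightarrow> 'm set" where
  "horizontal_section S t = {x. (x, t) \<in> S}"

text \<open>
  As there are no horizontal points, \<open>S\<close> is transversal to every slice, so the third condition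
  concerns all heights.
\<close>

definition vertical_helicoid ::
    "('m::topological_space, 'e::euclidean_space) atlas \<Rightarrow> ('m, 'e) metric \<Rightarrow> ('m \<times> real) set \<Rightarrow>
     ('m \<times> real \<Rightarrow> 'e \<times> real) \<Rightarrow> bool" where
  "vertical_helicoid A g S N \<longleftrightarrow>
     hypersurface (product_atlas A) S \<and>
     unit_normal_field (product_atlas A) (product_metric g) S N \<and>
     (\<forall>z\<in>S. (angle g N z)\<^sup>2 \<noteq> 1) \<and>
     \<not> (angle g N) constant_on S \<and>
     (\<forall>t. \<exists>\<eta>. minimal_hypersurface A g (horizontal_section S t) \<eta>) \<and>
     asymptotic_height A g S N"

definition spacelike ::
    "('m::topological_space, 'e::euclidean_space) atlas \<Rightarrow> ('m, 'e) metric \<Rightarrow> ('m \<times> real) set \<Rightarrow> bool"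
  where
  "spacelike A g S \<longleftrightarrow>
     (\<forall>z\<in>S. \<forall>v\<in>tangent_space (product_atlas A) S z. v \<noteq> 0 \<longrightarrow> lorentz_metric g z v v > 0)"

definition lorentz_normal ::
    "('m, 'e::real_vector) metric \<Rightarrow> ('m \<times> real \<Rightarrow> 'e \<times> real) \<Rightarrow> 'm \<times> real \<Rightarrow> 'e \<times> real" where
  "lorentz_normal g N z =
     (- 1 / sqrt (2 * (angle g N z)\<^sup>2 - 1)) *\<^sub>R (N z - (2 * angle g N z) *\<^sub>R vertical)"

definition lorentz_mean_curvature ::
    "('m::topological_space, 'e::euclidean_space) atlas \<Rightarrow> ('m, 'e) metric \<Rightarrow> ('m \<times> real) set \<Rightarrow>
     ('m \<times> real \<Rightarrow> 'e \<times> real) \<Rightarrow> 'm \<times> real \<Rightarrow> real" where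
  "lorentz_mean_curvature A g S N z =
     - trace_on (tangent_space (product_atlas A) S z)
         (shape_operator (product_atlas A) (product_metric g) S (lorentz_normal g N) z)"

definition zero_mean_isocurved ::
    "('m::topological_space, 'e::euclidean_space) atlas \<Rightarrow> ('m, 'e) metric \<Rightarrow> ('m \<times> real) set \<Rightarrow>
     ('m \<times> real \<Rightarrow> 'e \<times> real) \<Rightarrow> bool" where
  "zero_mean_isocurved A g S N \<longleftrightarrow>
     hypersurface (product_atlas A) S \<and>
     unit_normal_field (product_atlas A) (product_metric g) S N \<and>
     spacelike A g S \<and>
     (\<forall>z\<in>S. mean_curvature (product_atlas A) (product_metric g) S N z = 0 \<and>
             lorentz_mean_curvature A g S N z = 0)"


section \<open>Twistings\<close>

definition one_parameter_isometry_group ::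
    "('m::topological_space, 'e::euclidean_space) atlas \<Rightarrow> ('m, 'e) metric \<Rightarrow> real set \<Rightarrow>
     (real \<Rightarrow> 'm \<Rightarrow> 'm) \<Rightarrow> bool" where
  "one_parameter_isometry_group A g I \<Gamma> \<longleftrightarrow>
     open I \<and> is_interval I \<and> 0 \<in> I \<and>
     (\<forall>s\<in>I. isometry A g (\<Gamma> s)) \<and>
     \<Gamma> 0 = id \<and>
     (\<forall>s\<in>I. \<forall>t\<in>I. s + t \<in> I \<longrightarrow> \<Gamma> (s + t) = \<Gamma> s \<circ> \<Gamma> t) \<and>
     smooth_map_on (product_atlas A) A (UNIV \<times> I) (\<lambda>(p, s). \<Gamma> s p)"

definition twisting ::
    "real \<Rightarrow> real set \<Rightarrow> (real \<Rightarrow> 'm \<Rightarrow> 'm) \<Rightarrow> 'm set \<Rightarrow> ('m \<times> real) set" where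
  "twisting a I \<Gamma> S0 = {(\<Gamma> s p, a * s) | p s. p \<in> S0 \<and> s \<in> I}"

text \<open>The field \<open>\<Gamma>\<^sub>s\<^sub>* \<eta>\<close>, evaluated at \<open>x\<close>.\<close>

definition pushed_normal ::
    "('m, 'e::euclidean_space) atlas \<Rightarrow> (real \<Rightarrow> 'm \<Rightarrow> 'm) \<Rightarrow> ('m \<Rightarrow> 'e) \<Rightarrow> real \<Rightarrow> 'm \<Rightarrow> 'e" where
  "pushed_normal A \<Gamma> \<eta> s x = (let p = inv (\<Gamma> s) x in tangent_map A A (\<Gamma> s) p (\<eta> p))"

text \<open>
  A point \<open>(x, t)\<close> of the twisting equals \<open>(\<Gamma> s p, a * s)\<close> for exactly one \<open>s\<close> and \<open>p\<close>,
  namely \<open>s = t / a\<close> and \<open>p = inv (\<Gamma> s) x\<close>; the lemma below restates the definition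
  in terms of \<open>s\<close> and \<open>p\<close>.
\<close>

definition twisting_nu ::
    "('m, 'e::euclidean_space) atlas \<Rightarrow> ('m, 'e) metric \<Rightarrow> real \<Rightarrow> (real \<Rightarrow> 'm \<Rightarrow> 'm) \<Rightarrow>
     ('m \<Rightarrow> 'e) \<Rightarrow> 'm \<times> real \<Rightarrow> real" where
  "twisting_nu A g a \<Gamma> \<eta> z =
     (let x = fst z; s = snd z / a; p = inv (\<Gamma> s) x
      in g x (velocity A (\<lambda>\<sigma>. \<Gamma> \<sigma> p) s) (pushed_normal A \<Gamma> \<eta> s x))"

lemma twisting_nu_eq:
  assumes "one_parameter_isometry_group A g I \<Gamma>" "s \<in> I" "a > 0"
  shows "twisting_nu A g a \<Gamma> \<eta> (\<Gamma> s p, a * s) =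
    g (\<Gamma> s p) (velocity A (\<lambda>\<sigma>. \<Gamma> \<sigma> p) s) (tangent_map A A (\<Gamma> s) p (\<eta> p))"
proof -
  have "inj (\<Gamma> s)"
    using assms by (auto simp: one_parameter_isometry_group_def isometry_def bij_def)
  then show ?thesis
    using assms(3) by (simp add: twisting_nu_def pushed_normal_def)
qed

text \<open>The normal \<open>N\<close> of the twisting points to the side determined by the normal \<open>\<eta>\<close> of \<open>\<Sigma>\<^sub>0\<close>.\<close>

definition induced_orientation ::
    "('m, 'e::euclidean_space) atlas \<Rightarrow> ('m, 'e) metric \<Rightarrow> real \<Rightarrow> (real \<Rightarrow> 'm \<Rightarrow> 'm) \<Rightarrow>
     ('m \<Rightarrow> 'e) \<Rightarrow> ('m \<times> real) set \<Rightarrow> ('m \<times> real \<Rightarrow> 'e \<times> real) \<Rightarrow> bool" where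
  "induced_orientation A g a \<Gamma> \<eta> S N \<longleftrightarrow>
     (\<forall>z\<in>S. product_metric g z (N z) (pushed_normal A \<Gamma> \<eta> (snd z / a) (fst z), 0) > 0)"

end

theory Submission
  imports Defs
begin

text \<open>
  Let \<open>e\<close> be the unit normal of the section \<open>\<Gamma>\<^sub>s(\<Sigma>\<^sub>0)\<close> and \<open>c = \<langle>N, e\<rangle>\<close>. As \<open>N\<close> is orthogonal to the section
  and to the velocity \<open>(\<alpha>', a)\<close> of the orbits, \<open>N = c (e, - \<nu>/a)\<close>; hence \<open>c\<^sup>2 (a\<^sup>2 + \<nu>\<^sup>2) = a\<^sup>2\<close>, and the
  angle \<open>\<Theta> = - c \<nu>/a\<close> satisfies \<open>d\<Theta> = - (c\<^sup>3/a) d\<nu>\<close>. Since \<open>\<partial>\<^sub>t\<close> is parallel,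
  \<open>\<langle>A\<nabla>\<xi>, \<nabla>\<xi>\<rangle> = - d\<Theta>(\<nabla>\<xi>) = (c\<^sup>3/a) \<langle>\<nabla>\<nu>, \<partial>\<^sub>t\<rangle>\<close>. On horizontal vectors the shape operator is, up to a
  multiple of \<open>\<nabla>\<xi>\<close>, \<open>c\<close> times that of the section, which is isometric to \<open>\<Sigma>\<^sub>0\<close>; so if \<open>\<nabla>\<xi>\<close> is
  asymptotic and \<open>\<Sigma>\<^sub>0\<close> is minimal, the trace vanishes. The Lorentzian normal is a combination of \<open>N\<close> and
  \<open>\<partial>\<^sub>t\<close> with coefficients depending only on \<open>\<Theta>\<close>, so the same computation applies to it.
\<close>

section \<open>Pointwise smoothness in Euclidean spaces\<close>

text \<open>A tangent vector is stored by its components in the chart attached to its own base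
  point, and these charts need not vary continuously; so fields are differentiated only after
  transport to one fixed chart. The twisting is treated as an image under a diffeomorphism between
  open subsets of the product, which carries slice charts, normals and tangent spaces over. The unit
  normal \<open>N\<close> is arbitrary, so \<open>c\<close> is known only through its square.
  Differentiating \<open>c\<^sup>2 (a\<^sup>2 + \<nu>\<^sup>2) = a\<^sup>2\<close> avoids choosing a
  root. The sign matters once: if \<open>c\<close> changed sign between components, \<Theta> could
  be constant with \<nu> nonconstant, whence the alternative of a connected \<open>S0\<close> or an
  induced orientation. Minimality of all sections rests on the invariance of the Levi-Civita
  connection under isometries, proved from the Koszul formula and the symmetry of second
  derivatives. An asymptotic \<nabla>\<xi> gives a zero diagonal entry in a basis of horizontal
  vectors and a multiple of \<nabla>\<xi>, so only the trace on the section is left.\<close>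

abbreviation fd :: "('a::real_normed_vector \<Rightarrow> 'b::real_normed_vector) \<Rightarrow> 'a \<Rightarrow> 'a \<Rightarrow> 'b" where
  "fd f x \<equiv> frechet_derivative f (at x)"

lemma fd_works: "f differentiable (at x) \<Longrightarrow> (f has_derivative fd f x) (at x)"
  by (simp add: frechet_derivative_works)

lemma fd_eq: "(f has_derivative f') (at x) \<Longrightarrow> fd f x = f'"
  by (simp add: frechet_derivative_at[symmetric])

lemma has_derivative_cong_nhds:
  assumes "\<forall>\<^sub>F y in nhds x. f y = g y"
  shows "(f has_derivative h) (at x) \<longleftrightarrow> (g has_derivative h) (at x)"
proof -
  have 1: "(k has_derivative h) (at x)"
    if "(j has_derivative h) (at x)" "\<forall>\<^sub>F y in nhds x. j y = k y" for j k
    using that eventually_nhds_x_imp_x[OF that(2)]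
    by (intro has_derivative_transform_eventually[of j h x UNIV k])
      (auto simp: eventually_at_filter elim: eventually_mono)
  then show ?thesis using assms by (auto simp: eq_commute)
qed

lemma fd_cong: "\<forall>\<^sub>F y in nhds x. f y = g y \<Longrightarrow> fd f x = fd g x"
  using has_derivative_cong_nhds[of f g x] by (simp add: frechet_derivative_def)

section \<open>Closure properties of k-fold differentiability on open sets\<close>

lemma times_differentiable_on_cong:
  assumes "open U" "\<And>x. x \<in> U \<Longrightarrow> f x = g x"
  shows "times_differentiable_on U k f \<longleftrightarrow> times_differentiable_on U k g"
  using assms
proof (induction k arbitrary: f g)
  case 0
  then show ?case by (simp cong: continuous_on_cong)
next
  case (Suc k)
  have ev: "\<forall>\<^sub>F y in nhds x. f y = g y" if "x \<in> U" for x
    using Suc.prems that by (auto simp: eventually_nhds)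
  have fd: "fd f x = fd g x" if "x \<in> U" for x
    using fd_cong[OF ev[OF that]] .
  have "(f has_derivative h) (at x) \<longleftrightarrow> (g has_derivative h) (at x)" if "x \<in> U" for h x
    using has_derivative_cong_nhds[OF ev[OF that]] .
  then have "f differentiable (at x) \<longleftrightarrow> g differentiable (at x)" if "x \<in> U" for x
    using that by (simp add: differentiable_def)
  moreover have "times_differentiable_on U k (\<lambda>x. fd f x v) \<longleftrightarrow>
      times_differentiable_on U k (\<lambda>x. fd g x v)" for v
    using fd by (intro Suc.IH Suc.prems(1)) simp
  ultimately show ?case by simp
qed

lemma times_differentiable_on_subset:
  "times_differentiable_on U k f \<Longrightarrow> V \<subseteq> U \<Longrightarrow> times_differentiable_on V k f"
  by (induction k arbitrary: f) (auto intro: continuous_on_subset)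

lemma times_differentiable_on_Suc_imp:
  "times_differentiable_on U (Suc k) f \<Longrightarrow> times_differentiable_on U k f"
proof (induction k arbitrary: f)
  case 0
  then show ?case
    by (auto intro!: continuous_at_imp_continuous_on differentiable_imp_continuous_within)
qed auto

lemma times_differentiable_on_const: "times_differentiable_on U k (\<lambda>x. c)"
  by (induction k arbitrary: c) auto

lemma times_differentiable_on_bounded_linear:
  assumes "bounded_linear L" "open U" "times_differentiable_on U k f"
  shows "times_differentiable_on U k (\<lambda>x. L (f x))"
  using assms(3)
proof (induction k arbitrary: f)
  case 0
  then show ?case using assms(1) by (auto intro: bounded_linear.continuous_on)
next
  case (Suc k)
  have d: "((\<lambda>x. L (f x)) has_derivative (\<lambda>v. L (fd f x v))) (at x)" if "x \<in> U" for x
    using Suc.prems that by (auto intro!: bounded_linear.has_derivative[OF assms(1)] fd_works)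
  have "times_differentiable_on U k (\<lambda>x. fd (\<lambda>x. L (f x)) x v)" for v
  proof -
    have "times_differentiable_on U k (\<lambda>x. L (fd f x v))" using Suc by simp
    then show ?thesis
      using times_differentiable_on_cong[OF assms(2), of "\<lambda>x. fd (\<lambda>x. L (f x)) x v"
        "\<lambda>x. L (fd f x v)"] fd_eq[OF d] by simp
  qed
  then show ?case using d by (auto simp: differentiable_def)
qed

lemma times_differentiable_on_add:
  assumes "open U" "times_differentiable_on U k f" "times_differentiable_on U k g"
  shows "times_differentiable_on U k (\<lambda>x. f x + g x)"
  using assms(2,3)
proof (induction k arbitrary: f g)
  case 0
  then show ?case by (auto intro: continuous_on_add)
next
  case (Suc k)
  have d: "((\<lambda>x. f x + g x) has_derivative (\<lambda>v. fd f x v + fd g x v)) (at x)" if "x \<in> U" for x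
    using Suc.prems that by (auto intro!: has_derivative_add fd_works)
  have "times_differentiable_on U k (\<lambda>x. fd (\<lambda>x. f x + g x) x v)" for v
  proof -
    have "times_differentiable_on U k (\<lambda>x. fd f x v + fd g x v)" using Suc by simp
    then show ?thesis
      using times_differentiable_on_cong[OF assms(1), of "\<lambda>x. fd (\<lambda>x. f x + g x) x v"
        "\<lambda>x. fd f x v + fd g x v"] fd_eq[OF d] by simp
  qed
  then show ?case using d by (auto simp: differentiable_def)
qed

lemma times_differentiable_on_sum:
  assumes "open U" "\<And>i. i \<in> I \<Longrightarrow> times_differentiable_on U k (f i)"
  shows "times_differentiable_on U k (\<lambda>x. \<Sum>i\<in>I. f i x)"
  using assms(2)
  by (induction I rule: infinite_finite_induct)
    (auto intro: times_differentiable_on_const times_differentiable_on_add[OF assms(1)])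

lemma times_differentiable_on_bilinear:
  assumes "bounded_bilinear P" "open U" "times_differentiable_on U k f" "times_differentiable_on U k g"
  shows "times_differentiable_on U k (\<lambda>x. P (f x) (g x))"
  using assms(3,4)
proof (induction k arbitrary: f g)
  case 0
  then show ?case using assms(1) by (auto intro: bounded_bilinear.continuous_on)
next
  case (Suc k)
  have d: "((\<lambda>x. P (f x) (g x)) has_derivative (\<lambda>v. P (f x) (fd g x v) + P (fd f x v) (g x))) (at x)"
    if "x \<in> U" for x
    using Suc.prems that by (auto intro!: bounded_bilinear.FDERIV[OF assms(1)] fd_works)
  have "times_differentiable_on U k (\<lambda>x. fd (\<lambda>x. P (f x) (g x)) x v)" for v
  proof -
    \<comment> \<open>Each Leibniz term pairs one factor with a derivative of the other. That
      derivative has order \<open>k\<close> only, so the undifferentiated factor is lowered from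
      order \<open>Suc k\<close> to \<open>k\<close> before the induction hypothesis
      applies.\<close>
    have "times_differentiable_on U k (\<lambda>x. P (f x) (fd g x v) + P (fd f x v) (g x))"
      using Suc.prems times_differentiable_on_Suc_imp[OF Suc.prems(1)]
        times_differentiable_on_Suc_imp[OF Suc.prems(2)]
      by (intro times_differentiable_on_add assms(2) Suc.IH) auto
    then show ?thesis
      using times_differentiable_on_cong[OF assms(2), of "\<lambda>x. fd (\<lambda>x. P (f x) (g x)) x v"
        "\<lambda>x. P (f x) (fd g x v) + P (fd f x v) (g x)"] fd_eq[OF d] by simp
  qed
  then show ?case using d by (auto simp: differentiable_def)
qed

lemma linear_basis_expansion:
  fixes L :: "'a::euclidean_space \<Rightarrow> 'b::real_vector"
  assumes "linear L"
  shows "L v = (\<Sum>b\<in>Basis. (v \<bullet> b) *\<^sub>R L b)"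
proof -
  have "L v = L (\<Sum>b\<in>Basis. (v \<bullet> b) *\<^sub>R b)" by (simp add: euclidean_representation)
  also have "\<dots> = (\<Sum>b\<in>Basis. (v \<bullet> b) *\<^sub>R L b)"
    using assms by (simp add: linear_sum linear_scale)
  finally show ?thesis .
qed

lemma linear_fd: "f differentiable (at x) \<Longrightarrow> linear (fd f x)"
  using fd_works has_derivative_linear by blast

lemma times_differentiable_on_compose:
  fixes f :: "'a::real_normed_vector \<Rightarrow> 'b::euclidean_space" and h :: "'b \<Rightarrow> 'c::real_normed_vector"
  assumes "open U" "open V" "f ` U \<subseteq> V"
    and "times_differentiable_on U k f" "times_differentiable_on V k h"
  shows "times_differentiable_on U k (\<lambda>x. h (f x))"
  using assms(4,5)
proof (induction k arbitrary: h)
  case 0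
  then show ?case using assms(3) by (auto intro: continuous_on_compose2)
next
  case (Suc k)
  have d: "((\<lambda>x. h (f x)) has_derivative (\<lambda>v. fd h (f x) (fd f x v))) (at x)" if "x \<in> U" for x
  proof -
    have "(f has_derivative fd f x) (at x)" "(h has_derivative fd h (f x)) (at (f x))"
      using Suc.prems that assms(3) by (auto intro!: fd_works)
    from diff_chain_at[OF this] show ?thesis by (simp add: o_def)
  qed
  have f: "times_differentiable_on U k f"
    using times_differentiable_on_Suc_imp[OF Suc.prems(1)] .
  have "times_differentiable_on U k (\<lambda>x. fd (\<lambda>x. h (f x)) x v)" for v
  proof -
    \<comment> \<open>The chain rule term depends on \<open>x\<close> through base point and
      direction at once. Expanding the direction in \<open>Basis\<close> leaves scalars times
      partial derivatives of \<open>h\<close> composed with \<open>f\<close>, and the induction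
      hypothesis, general in \<open>h\<close>, covers the latter.\<close>
    have "times_differentiable_on U k (\<lambda>x. \<Sum>b\<in>Basis. (fd f x v \<bullet> b) *\<^sub>R fd h (f x) b)"
      using Suc.prems f
      by (intro times_differentiable_on_sum times_differentiable_on_bilinear[OF bounded_bilinear_scaleR]
          times_differentiable_on_bounded_linear[OF bounded_linear_inner_left] assms(1)
          Suc.IH[of "\<lambda>y. fd h y b" for b]) auto
    moreover have "fd (\<lambda>x. h (f x)) x v = (\<Sum>b\<in>Basis. (fd f x v \<bullet> b) *\<^sub>R fd h (f x) b)"
      if "x \<in> U" for x
      using fd_eq[OF d[OF that]] Suc.prems that assms(3)
        linear_basis_expansion[OF linear_fd[of h "f x"], of "fd f x v"] by auto
    ultimately show ?thesis
      using times_differentiable_on_cong[OF assms(1), of "\<lambda>x. fd (\<lambda>x. h (f x)) x v"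
        "\<lambda>x. \<Sum>b\<in>Basis. (fd f x v \<bullet> b) *\<^sub>R fd h (f x) b" k] by blast
  qed
  then show ?case using d by (auto simp: differentiable_def)
qed

text \<open>Germ version of \<open>smooth_on\<close>. Changing charts shrinks domains at every step;
  with germs this becomes a filter argument instead of repeated intersections of open sets.\<close>

definition smooth_at :: "'a::real_normed_vector \<Rightarrow> ('a \<Rightarrow> 'b::real_normed_vector) \<Rightarrow> bool" where
  "smooth_at x f \<longleftrightarrow> (\<exists>U. open U \<and> x \<in> U \<and> smooth_on U f)"

lemma smooth_on_subset: "smooth_on U f \<Longrightarrow> V \<subseteq> U \<Longrightarrow> smooth_on V f"
  unfolding smooth_on_def using times_differentiable_on_subset by blast

lemma smooth_on_cong:
  "open U \<Longrightarrow> (\<And>x. x \<in> U \<Longrightarrow> f x = g x) \<Longrightarrow> smooth_on U f \<longleftrightarrow> smooth_on U g"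
  unfolding smooth_on_def using times_differentiable_on_cong by blast

lemma smooth_atI: "open U \<Longrightarrow> smooth_on U f \<Longrightarrow> x \<in> U \<Longrightarrow> smooth_at x f"
  unfolding smooth_at_def by blast

lemma smooth_at_imp_differentiable: "smooth_at x f \<Longrightarrow> f differentiable (at x)"
  unfolding smooth_at_def smooth_on_def
  by (metis times_differentiable_on.simps(2))

lemma smooth_at_has_derivative: "smooth_at x f \<Longrightarrow> (f has_derivative fd f x) (at x)"
  by (simp add: fd_works smooth_at_imp_differentiable)

lemma smooth_at_linear_fd: "smooth_at x f \<Longrightarrow> linear (fd f x)"
  by (simp add: linear_fd smooth_at_imp_differentiable)

lemma smooth_at_isCont: "smooth_at x f \<Longrightarrow> isCont f x"
  by (simp add: differentiable_imp_continuous_within smooth_at_imp_differentiable)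

lemma smooth_at_eventually: "smooth_at x f \<Longrightarrow> \<forall>\<^sub>F y in nhds x. smooth_at y f"
  unfolding smooth_at_def eventually_nhds by blast

lemma times_differentiable_on_local:
  assumes "\<And>x. x \<in> U \<Longrightarrow> \<exists>V. open V \<and> x \<in> V \<and> times_differentiable_on V k f"
  shows "times_differentiable_on U k f"
  using assms
proof (induction k arbitrary: f)
  case 0
  have "isCont f x" if x: "x \<in> U" for x
  proof -
    obtain V where "open V" "x \<in> V" "continuous_on V f" using 0 x by auto
    then show ?thesis by (simp add: continuous_on_eq_continuous_at)
  qed
  then show ?case by (auto intro: continuous_at_imp_continuous_on)
next
  case (Suc k)
  have "times_differentiable_on U k (\<lambda>x. fd f x v)" for v
    using Suc.prems by (intro Suc.IH) (metis times_differentiable_on.simps(2))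
  moreover have "f differentiable (at x)" if "x \<in> U" for x
    using Suc.prems[OF that] by auto
  ultimately show ?case by simp
qed

lemma smooth_onI: "(\<And>x. x \<in> U \<Longrightarrow> smooth_at x f) \<Longrightarrow> smooth_on U f"
  unfolding smooth_on_def smooth_at_def by (meson times_differentiable_on_local)

lemma smooth_at_cong:
  assumes "smooth_at x f" "\<forall>\<^sub>F y in nhds x. f y = g y"
  shows "smooth_at x g"
proof -
  obtain U where U: "open U" "x \<in> U" "smooth_on U f" using assms(1) by (auto simp: smooth_at_def)
  obtain V where V: "open V" "x \<in> V" "\<And>y. y \<in> V \<Longrightarrow> f y = g y"
    using assms(2) by (auto simp: eventually_nhds)
  have "smooth_on (U \<inter> V) f" using U(3) smooth_on_subset by blast
  then have "smooth_on (U \<inter> V) g"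
    using smooth_on_cong[of "U \<inter> V" f g] U V by auto
  then show ?thesis using U V by (auto simp: smooth_at_def intro!: exI[of _ "U \<inter> V"])
qed

lemma smooth_at_const [simp]: "smooth_at x (\<lambda>x. c)"
  unfolding smooth_at_def smooth_on_def
  using times_differentiable_on_const by blast

lemma smooth_at_ident [simp]: "smooth_at x (\<lambda>x. x)"
proof -
  have "times_differentiable_on UNIV k (\<lambda>x::'a. x)" for k
    by (cases k) (auto simp: continuous_on_id frechet_derivative_ident
        intro: times_differentiable_on_const)
  then show ?thesis unfolding smooth_at_def smooth_on_def by blast
qed

lemma smooth_at_common:
  assumes "smooth_at x f" "smooth_at x g"
  obtains U where "open U" "x \<in> U" "smooth_on U f" "smooth_on U g"
proof -
  obtain U V where "open U" "x \<in> U" "smooth_on U f" "open V" "x \<in> V" "smooth_on V g"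
    using assms by (auto simp: smooth_at_def)
  then show thesis
    using that[of "U \<inter> V"] smooth_on_subset by (metis IntI inf_le1 inf_le2 open_Int)
qed

lemma smooth_at_bounded_linear:
  "bounded_linear L \<Longrightarrow> smooth_at x f \<Longrightarrow> smooth_at x (\<lambda>x. L (f x))"
  unfolding smooth_at_def smooth_on_def using times_differentiable_on_bounded_linear by blast

lemma smooth_at_add: "smooth_at x f \<Longrightarrow> smooth_at x g \<Longrightarrow> smooth_at x (\<lambda>x. f x + g x)"
  by (rule smooth_at_common[of x f g])
    (auto simp: smooth_at_def smooth_on_def intro: times_differentiable_on_add)

lemma smooth_at_sum:
  "(\<And>i. i \<in> I \<Longrightarrow> smooth_at x (f i)) \<Longrightarrow> smooth_at x (\<lambda>x. \<Sum>i\<in>I. f i x)"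
  by (induction I rule: infinite_finite_induct) (auto intro: smooth_at_add)

lemma smooth_at_bilinear:
  assumes "bounded_bilinear P" "smooth_at x f" "smooth_at x g"
  shows "smooth_at x (\<lambda>x. P (f x) (g x))"
proof -
  obtain U where "open U" "x \<in> U" "smooth_on U f" "smooth_on U g"
    by (rule smooth_at_common[OF assms(2,3)])
  then have "smooth_on U (\<lambda>x. P (f x) (g x))"
    unfolding smooth_on_def using times_differentiable_on_bilinear[OF assms(1)] by blast
  with \<open>open U\<close> \<open>x \<in> U\<close> show ?thesis by (auto simp: smooth_at_def)
qed

lemmas smooth_at_scaleR = smooth_at_bilinear[OF bounded_bilinear_scaleR]
lemmas smooth_at_mult = smooth_at_bilinear[OF bounded_bilinear_mult]
lemmas smooth_at_inner = smooth_at_bilinear[OF bounded_bilinear_inner]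
lemmas smooth_at_fst = smooth_at_bounded_linear[OF bounded_linear_fst]
lemmas smooth_at_snd = smooth_at_bounded_linear[OF bounded_linear_snd]

lemma smooth_at_compose:
  fixes f :: "'a::real_normed_vector \<Rightarrow> 'b::euclidean_space"
  assumes "smooth_at x f" "smooth_at (f x) h"
  shows "smooth_at x (\<lambda>x. h (f x))"
proof -
  obtain U where U: "open U" "x \<in> U" "smooth_on U f" using assms by (auto simp: smooth_at_def)
  obtain V where V: "open V" "f x \<in> V" "smooth_on V h" using assms by (auto simp: smooth_at_def)
  have "continuous_on U f"
    using U(3) unfolding smooth_on_def by (metis times_differentiable_on.simps(1))
  then have op: "open (U \<inter> f -` V)" using U V continuous_open_preimage by blast
  have "smooth_on (U \<inter> f -` V) f" using U(3) smooth_on_subset by blast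
  then have "smooth_on (U \<inter> f -` V) (\<lambda>x. h (f x))"
    using times_differentiable_on_compose[OF op V(1)] V(3) unfolding smooth_on_def by blast
  then show ?thesis using op U V by (auto intro: smooth_atI)
qed

lemma smooth_at_Pair: "smooth_at x f \<Longrightarrow> smooth_at x g \<Longrightarrow> smooth_at x (\<lambda>x. (f x, g x))"
proof -
  assume f: "smooth_at x f" and g: "smooth_at x g"
  have "bounded_linear (\<lambda>y::'b. (y, 0::'c))" "bounded_linear (\<lambda>y::'c. (0::'b, y))"
    by (auto intro!: bounded_linear_Pair bounded_linear_zero bounded_linear_ident)
  from smooth_at_add[OF smooth_at_bounded_linear[OF this(1) f] smooth_at_bounded_linear[OF this(2) g]]
  show ?thesis by simp
qed

lemma smooth_at_fd: "smooth_at x f \<Longrightarrow> smooth_at x (\<lambda>y. fd f y v)"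
  unfolding smooth_at_def smooth_on_def by (metis times_differentiable_on.simps(2))

text \<open>Base point and direction vary together, as they do for a vector field pushed through a
  change of coordinates. Smoothness of \<open>F\<close> at \<open>f x\<close> spreads to nearby
  points, where the basis expansion is valid.\<close>

lemma smooth_at_fd_apply:
  fixes f :: "'a::real_normed_vector \<Rightarrow> 'b::euclidean_space" and F :: "'b \<Rightarrow> 'c::real_normed_vector"
  assumes F: "smooth_at (f x) F" and f: "smooth_at x f" and h: "smooth_at x h"
  shows "smooth_at x (\<lambda>y. fd F (f y) (h y))"
proof -
  have "smooth_at x (\<lambda>y. \<Sum>b\<in>Basis. (h y \<bullet> b) *\<^sub>R fd F (f y) b)"
    by (intro smooth_at_sum smooth_at_scaleR smooth_at_inner h smooth_at_const
        smooth_at_compose[OF f] smooth_at_fd F)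
  moreover have "\<forall>\<^sub>F y in nhds x. smooth_at (f y) F"
    by (rule eventually_compose_filterlim[OF smooth_at_eventually[OF F]])
      (use smooth_at_isCont[OF f] in \<open>simp add: isCont_def tendsto_at_iff_tendsto_nhds\<close>)
  then have "\<forall>\<^sub>F y in nhds x. (\<Sum>b\<in>Basis. (h y \<bullet> b) *\<^sub>R fd F (f y) b) = fd F (f y) (h y)"
    by eventually_elim (simp add: linear_basis_expansion[symmetric] smooth_at_linear_fd)
  ultimately show ?thesis by (rule smooth_at_cong)
qed

lemma fd_compose:
  assumes "smooth_at x f" "smooth_at (f x) h"
  shows "fd (\<lambda>x. h (f x)) x v = fd h (f x) (fd f x v)"
proof -
  have "((\<lambda>x. h (f x)) has_derivative (\<lambda>v. fd h (f x) (fd f x v))) (at x)"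
    using diff_chain_at[OF smooth_at_has_derivative[OF assms(1)] smooth_at_has_derivative[OF assms(2)]]
    by (simp add: o_def)
  then show ?thesis by (simp add: fd_eq)
qed

text \<open>The derivative of \<open>h r = 1 / sqrt (1 + r\<^sup>2)\<close> is
  \<open>- r * h r ^ 3\<close>, again a product of \<open>r\<close> and copies of \<open>h\<close>,
  so the induction on the order closes. With \<open>r\<close> equal to
  \<open>- (\<nu> z / a)\<close> this is the factor that normalizes the normal of the
  twisting.\<close>

lemma smooth_at_inverse_sqrt: "smooth_at x (\<lambda>r::real. 1 / sqrt (1 + r\<^sup>2))"
proof -
  let ?h = "\<lambda>r::real. 1 / sqrt (1 + r\<^sup>2)"
  have pos: "1 + r\<^sup>2 > 0" for r :: real by (simp add: add_pos_nonneg)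
  have d: "(?h has_derivative (\<lambda>v. v * (- r * (?h r * (?h r * ?h r))))) (at r)" for r
  proof -
    have alg: "- ((inverse q / 2) * (2 * r)) / (q * q) = - r * (1 / q * (1 / q * (1 / q)))" for q :: real
      by (cases "q = 0") (simp_all add: field_simps)
    have "(?h has_real_derivative
        - ((inverse (sqrt (1 + r\<^sup>2)) / 2) * (2 * r)) / (sqrt (1 + r\<^sup>2) * sqrt (1 + r\<^sup>2))) (at r)"
      using pos[of r] by (auto intro!: derivative_eq_intros simp: power2_eq_square)
    then have "(?h has_real_derivative (- r * (?h r * (?h r * ?h r)))) (at r)"
      by (rule DERIV_cong) (rule alg)
    then show ?thesis unfolding has_field_derivative_def
      by (rule has_derivative_eq_rhs) (simp add: fun_eq_iff)
  qed
  have "times_differentiable_on UNIV k ?h" for k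
  proof (induction k)
    case 0
    have "isCont ?h r" for r using has_derivative_continuous[OF d] .
    then show ?case by (simp add: continuous_at_imp_continuous_on)
  next
    case (Suc k)
    have id: "times_differentiable_on UNIV k (\<lambda>x::real. x)"
      by (cases k) (auto simp: continuous_on_id frechet_derivative_ident
        intro: times_differentiable_on_const)
    have neg: "bounded_linear (\<lambda>x::real. - x)"
      by (simp add: bounded_linear_minus bounded_linear_ident)
    have "times_differentiable_on UNIV k (\<lambda>r. v * (- r * (?h r * (?h r * ?h r))))" for v
      using Suc.IH id times_differentiable_on_bounded_linear[OF neg open_UNIV id]
      by (intro times_differentiable_on_bilinear[OF bounded_bilinear_mult]
          times_differentiable_on_const) auto
    then show ?case using d fd_eq[OF d] by (auto simp: differentiable_def)
  qed
  then show ?thesis unfolding smooth_at_def smooth_on_def by blast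
qed

section \<open>Symmetry of second derivatives\<close>

lemma DERIV_along_line:
  fixes h :: "'a::real_normed_vector \<Rightarrow> real"
  assumes "smooth_at (a + s *\<^sub>R u) h"
  shows "((\<lambda>s. h (a + s *\<^sub>R u)) has_real_derivative fd h (a + s *\<^sub>R u) u) (at s)"
proof -
  have "((\<lambda>s. a + s *\<^sub>R u) has_derivative (\<lambda>r. r *\<^sub>R u)) (at s)"
    by (auto intro!: derivative_eq_intros)
  from diff_chain_at[OF this smooth_at_has_derivative[OF assms]]
  have "((\<lambda>s. h (a + s *\<^sub>R u)) has_derivative (\<lambda>r. fd h (a + s *\<^sub>R u) (r *\<^sub>R u))) (at s)"
    by (simp add: o_def)
  then show ?thesis
    unfolding has_field_derivative_def using smooth_at_linear_fd[OF assms]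
    by (auto elim!: has_derivative_eq_rhs simp: fun_eq_iff linear_scale)
qed

text \<open>Two applications of the mean value theorem, one per direction. The second difference is
  symmetric in \<open>u\<close> and \<open>v\<close>, while the right side is a mixed derivative at
  some nearby point; the symmetry theorem exploits this contrast.\<close>

lemma second_difference:
  fixes h :: "'a::real_normed_vector \<Rightarrow> real"
  assumes smooth: "\<And>y. dist y x < e \<Longrightarrow> smooth_at y h" and t: "0 < t" "t * (norm u + norm v) < e"
  shows "\<exists>y. norm (y - x) \<le> t * (norm u + norm v) \<and>
    h (x + t *\<^sub>R u + t *\<^sub>R v) - h (x + t *\<^sub>R u) - h (x + t *\<^sub>R v) + h x
      = t * (t * fd (\<lambda>y. fd h y u) y v)"
proof -
  have bound: "norm (s *\<^sub>R u + r *\<^sub>R v) \<le> t * (norm u + norm v)"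
    if "0 \<le> s" "s \<le> t" "0 \<le> r" "r \<le> t" for s r
  proof -
    have "norm (s *\<^sub>R u + r *\<^sub>R v) \<le> s * norm u + r * norm v"
      using that norm_triangle_ineq[of "s *\<^sub>R u" "r *\<^sub>R v"] by simp
    also have "\<dots> \<le> t * norm u + t * norm v"
      using that by (intro add_mono mult_right_mono) auto
    finally show ?thesis by (simp add: distrib_left)
  qed
  have sm: "smooth_at (x + s *\<^sub>R u + r *\<^sub>R v) h"
    if "0 \<le> s" "s \<le> t" "0 \<le> r" "r \<le> t" for s r
    using smooth bound[OF that] t by (simp add: dist_norm add.assoc)
  \<comment> \<open>The mean value theorem is first applied in direction \<open>u\<close>, to the
    increment of \<open>h\<close> by \<open>t *\<^sub>R v\<close>; the second application moves in
    direction \<open>v\<close>.\<close>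
  have "\<exists>s. 0 < s \<and> s < t \<and>
      (h (x + t *\<^sub>R u + t *\<^sub>R v) - h (x + t *\<^sub>R u)) - (h (x + 0 *\<^sub>R u + t *\<^sub>R v) - h (x + 0 *\<^sub>R u)) =
      (t - 0) * (fd h (x + s *\<^sub>R u + t *\<^sub>R v) u - fd h (x + s *\<^sub>R u) u)"
  proof (rule MVT2[OF t(1)])
    fix s assume s: "0 \<le> s" "s \<le> t"
    have "((\<lambda>s. h ((x + t *\<^sub>R v) + s *\<^sub>R u)) has_real_derivative fd h ((x + t *\<^sub>R v) + s *\<^sub>R u) u) (at s)"
      using sm[of s t] s t by (intro DERIV_along_line) (simp add: algebra_simps)
    moreover have "((\<lambda>s. h (x + s *\<^sub>R u)) has_real_derivative fd h (x + s *\<^sub>R u) u) (at s)"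
      using sm[of s 0] s t by (intro DERIV_along_line) simp
    ultimately show "((\<lambda>s. h (x + s *\<^sub>R u + t *\<^sub>R v) - h (x + s *\<^sub>R u)) has_real_derivative
        fd h (x + s *\<^sub>R u + t *\<^sub>R v) u - fd h (x + s *\<^sub>R u) u) (at s)"
      using DERIV_diff by (fastforce simp: add_ac)
  qed
  then obtain s where s: "0 < s" "s < t"
    and 1: "h (x + t *\<^sub>R u + t *\<^sub>R v) - h (x + t *\<^sub>R u) - h (x + t *\<^sub>R v) + h x =
      t * (fd h (x + s *\<^sub>R u + t *\<^sub>R v) u - fd h (x + s *\<^sub>R u) u)"
    by auto
  have "\<exists>r. 0 < r \<and> r < t \<and> fd h (x + s *\<^sub>R u + t *\<^sub>R v) u - fd h (x + s *\<^sub>R u + 0 *\<^sub>R v) u =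
      (t - 0) * fd (\<lambda>y. fd h y u) (x + s *\<^sub>R u + r *\<^sub>R v) v"
    using s sm by (intro MVT2[OF t(1)] DERIV_along_line smooth_at_fd) auto
  then obtain r where r: "0 < r" "r < t"
    and 2: "fd h (x + s *\<^sub>R u + t *\<^sub>R v) u - fd h (x + s *\<^sub>R u) u =
      t * fd (\<lambda>y. fd h y u) (x + s *\<^sub>R u + r *\<^sub>R v) v"
    by auto
  show ?thesis
    using 1 2 bound[of s r] s r by (intro exI[of _ "x + s *\<^sub>R u + r *\<^sub>R v"]) (simp add: add.assoc)
qed

text \<open>Both mixed derivatives, taken at suitable intermediate points, equal the same second
  difference quotient. A gap between them at \<open>x\<close> would contradict continuity once these
  points are close enough to \<open>x\<close>.\<close>

lemma second_derivative_symmetric_real: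
  fixes h :: "'a::real_normed_vector \<Rightarrow> real"
  assumes h: "smooth_at x h"
  shows "fd (\<lambda>y. fd h y u) x v = fd (\<lambda>y. fd h y v) x u"
proof (rule ccontr)
  define F where "F = fd (\<lambda>y. fd h y u)"
  define G where "G = fd (\<lambda>y. fd h y v)"
  assume "\<not> ?thesis"
  then have ne: "\<bar>F x v - G x u\<bar> / 2 > 0" by (simp add: F_def G_def)
  have cont: "isCont (\<lambda>y. F y v) x" "isCont (\<lambda>y. G y u) x"
    unfolding F_def G_def by (intro smooth_at_isCont smooth_at_fd h)+
  obtain e where e: "e > 0" "\<And>y. dist y x < e \<Longrightarrow> smooth_at y h"
    using smooth_at_eventually[OF h] by (auto simp: eventually_nhds_metric)
  obtain d1 where d1: "d1 > 0" "\<And>y. dist y x < d1 \<Longrightarrow> dist (F y v) (F x v) < \<bar>F x v - G x u\<bar> / 2"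
    using cont(1) ne unfolding continuous_at_eps_delta by metis
  obtain d2 where d2: "d2 > 0" "\<And>y. dist y x < d2 \<Longrightarrow> dist (G y u) (G x u) < \<bar>F x v - G x u\<bar> / 2"
    using cont(2) ne unfolding continuous_at_eps_delta by metis
  define m where "m = min e (min d1 d2)"
  have m: "m > 0" using e d1 d2 by (simp add: m_def)
  \<comment> \<open>The summand 1 keeps the denominator positive even for \<open>u = v = 0\<close>.
    The resulting bound \<open>t * (norm u + norm v) < m\<close> puts both intermediate points
    inside all three neighbourhoods.\<close>
  define t where "t = m / (norm u + norm v + 1)"
  have n1: "norm u + norm v + 1 > 0" by (simp add: add_nonneg_pos)
  have t: "t > 0" "t * (norm u + norm v) < m"
    using m n1 by (auto simp: t_def field_simps)
  obtain y where y: "norm (y - x) \<le> t * (norm u + norm v)"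
    "h (x + t *\<^sub>R u + t *\<^sub>R v) - h (x + t *\<^sub>R u) - h (x + t *\<^sub>R v) + h x = t * (t * F y v)"
    using second_difference[of x e h t u v] e t unfolding F_def m_def by auto
  obtain z where z: "norm (z - x) \<le> t * (norm u + norm v)"
    "h (x + t *\<^sub>R v + t *\<^sub>R u) - h (x + t *\<^sub>R v) - h (x + t *\<^sub>R u) + h x = t * (t * G z u)"
    using second_difference[of x e h t v u] e t unfolding G_def m_def by (auto simp: add.commute)
  have "h (x + t *\<^sub>R v + t *\<^sub>R u) = h (x + t *\<^sub>R u + t *\<^sub>R v)" by (simp add: algebra_simps)
  then have "t * (t * F y v) = t * (t * G z u)" using y(2) z(2) by linarith
  then have "F y v = G z u" using t(1) by simp
  moreover have "dist (F y v) (F x v) < \<bar>F x v - G x u\<bar> / 2"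
    using y(1) t(2) by (intro d1(2)) (simp add: dist_norm m_def)
  moreover have "dist (G z u) (G x u) < \<bar>F x v - G x u\<bar> / 2"
    using z(1) t(2) by (intro d2(2)) (simp add: dist_norm m_def)
  ultimately show False
    using dist_triangle_half_r[of "F y v" "F x v" "\<bar>F x v - G x u\<bar>" "G x u"]
    by (simp add: dist_real_def)
qed

lemma fd_inner_left:
  assumes "smooth_at x f"
  shows "fd (\<lambda>y. f y \<bullet> b) x v = fd f x v \<bullet> b"
  using fd_eq[OF bounded_linear.has_derivative[OF bounded_linear_inner_left smooth_at_has_derivative[OF assms]]]
  by simp

text \<open>Reduction to components. This symmetry is what lets the second derivatives of an
  isometry in coordinates collapse to a single term in the Koszul formula.\<close>

lemma second_derivative_symmetric:
  fixes f :: "'a::real_normed_vector \<Rightarrow> 'b::euclidean_space"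
  assumes f: "smooth_at x f"
  shows "fd (\<lambda>y. fd f y u) x v = fd (\<lambda>y. fd f y v) x u"
proof (rule euclidean_eqI)
  fix b :: 'b assume "b \<in> Basis"
  have fb: "smooth_at x (\<lambda>y. f y \<bullet> b)" by (intro smooth_at_inner f smooth_at_const)
  have *: "fd (\<lambda>y. fd f y u) x v \<bullet> b = fd (\<lambda>y. fd (\<lambda>y. f y \<bullet> b) y u) x v" for u v
  proof -
    have "fd (\<lambda>y. fd f y u) x v \<bullet> b = fd (\<lambda>y. fd f y u \<bullet> b) x v"
      by (simp add: fd_inner_left smooth_at_fd f)
    also have "\<dots> = fd (\<lambda>y. fd (\<lambda>y. f y \<bullet> b) y u) x v"
      by (rule fun_cong[OF fd_cong], rule eventually_mono[OF smooth_at_eventually[OF f]])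
        (simp add: fd_inner_left)
    finally show ?thesis .
  qed
  show "fd (\<lambda>y. fd f y u) x v \<bullet> b = fd (\<lambda>y. fd f y v) x u \<bullet> b"
    unfolding * by (rule second_derivative_symmetric_real[OF fb])
qed

section \<open>Charts\<close>

lemma coord_param: "x \<in> coord C ` cdom C \<Longrightarrow> coord C (param C x) = x"
  by (rule f_inv_into_f)

lemma filterlim_isCont: "isCont f a \<Longrightarrow> filterlim f (nhds (f a)) (nhds a)"
  by (simp add: isCont_def tendsto_at_iff_tendsto_nhds)

lemma eventually_isCont:
  "isCont f a \<Longrightarrow> \<forall>\<^sub>F y in nhds (f a). P y \<Longrightarrow> \<forall>\<^sub>F x in nhds a. P (f x)"
  using eventually_compose_filterlim filterlim_isCont by blast

lemma isCont_transfer: "isCont f x \<Longrightarrow> \<forall>\<^sub>F y in nhds x. f y = g y \<Longrightarrow> isCont g x"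
  using isCont_cong[of f g x] by blast

context
  fixes C :: "('m::t2_space, 'e::euclidean_space) chart"
  assumes C: "is_chart C"
begin

lemma open_cdom: "open (cdom C)"
  using C by (simp add: is_chart_def)

lemma open_coord_image_Int: "open X \<Longrightarrow> open (coord C ` (cdom C \<inter> X))"
proof -
  assume "open X"
  then have "openin (top_of_set (cdom C)) (cdom C \<inter> X)" by (auto simp: openin_open)
  then have "openin (top_of_set (coord C ` cdom C)) (coord C ` (cdom C \<inter> X))"
    using C homeomorphism_imp_open_map unfolding is_chart_def by blast
  then show ?thesis using C openin_open_eq unfolding is_chart_def by blast
qed

lemma param_coord: "p \<in> cdom C \<Longrightarrow> param C (coord C p) = p"
  using C by (simp add: is_chart_def)

lemma eventually_cdom: "p \<in> cdom C \<Longrightarrow> \<forall>\<^sub>F q in nhds p. q \<in> cdom C"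
  using open_cdom eventually_nhds by blast

lemma eventually_coord_image: "p \<in> cdom C \<Longrightarrow> \<forall>\<^sub>F x in nhds (coord C p). x \<in> coord C ` cdom C"
  using open_coord_image_Int[of UNIV] eventually_nhds by auto

lemma isCont_coord: "p \<in> cdom C \<Longrightarrow> isCont (coord C) p"
  using C open_cdom by (simp add: is_chart_def homeomorphism_def continuous_on_eq_continuous_at)

lemma isCont_param: "p \<in> cdom C \<Longrightarrow> isCont (param C) (coord C p)"
  using C continuous_on_eq_continuous_at[of "coord C ` cdom C" "param C"]
  by (simp add: is_chart_def homeomorphism_def)

lemma eventually_coord:
  "p \<in> cdom C \<Longrightarrow> \<forall>\<^sub>F x in nhds (coord C p). P x \<Longrightarrow> \<forall>\<^sub>F q in nhds p. P (coord C q)"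
  using eventually_isCont isCont_coord by blast

lemma eventually_param:
  "p \<in> cdom C \<Longrightarrow> \<forall>\<^sub>F q in nhds p. P q \<Longrightarrow> \<forall>\<^sub>F x in nhds (coord C p). P (param C x)"
  using eventually_isCont[OF isCont_param] param_coord by simp

end

lemma in_atlas: "smooth_atlas A \<Longrightarrow> p \<in> cdom (A p)"
  and is_chart_atlas: "smooth_atlas A \<Longrightarrow> is_chart (A p)"
  and admissible_atlas: "smooth_atlas A \<Longrightarrow> admissible_chart A (A p)"
  by (auto simp: smooth_atlas_def admissible_chart_def)

lemma admissible_is_chart: "admissible_chart A C \<Longrightarrow> is_chart C"
  by (simp add: admissible_chart_def)

lemma transition_smooth_atlas:
  assumes "smooth_atlas A" "admissible_chart A C" "p \<in> cdom C" "p \<in> cdom (A q)"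
  shows "smooth_at (coord C p) (\<lambda>x. coord (A q) (param C x))"
    and "smooth_at (coord (A q) p) (\<lambda>x. coord C (param (A q) x))"
proof -
  have comp: "compatible C (A q)" and C: "is_chart C" and Aq: "is_chart (A q)"
    using assms by (auto simp: admissible_chart_def smooth_atlas_def)
  show "smooth_at (coord C p) (\<lambda>x. coord (A q) (param C x))"
    using comp assms(3,4) open_coord_image_Int[OF C open_cdom[OF Aq]]
    unfolding compatible_def o_def by (auto intro: smooth_atI)
  show "smooth_at (coord (A q) p) (\<lambda>x. coord C (param (A q) x))"
    using comp assms(3,4) open_coord_image_Int[OF Aq open_cdom[OF C]]
    unfolding compatible_def o_def by (auto intro: smooth_atI simp: Int_commute)
qed

lemma transition_smooth:
  assumes A: "smooth_atlas A" and C: "admissible_chart A C" and D: "admissible_chart A D"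
    and p: "p \<in> cdom C" "p \<in> cdom D"
  shows "smooth_at (coord C p) (\<lambda>x. coord D (param C x))"
proof (rule smooth_at_cong)
  note C' = admissible_is_chart[OF C] and Ap = is_chart_atlas[OF A, of p]
  have "smooth_at (coord (A p) (param C (coord C p))) (\<lambda>x. coord D (param (A p) x))"
    using transition_smooth_atlas(2)[OF A D p(2) in_atlas[OF A]] p by (simp add: param_coord[OF C'])
  then show "smooth_at (coord C p) (\<lambda>x. coord D (param (A p) (coord (A p) (param C x))))"
    using smooth_at_compose[OF transition_smooth_atlas(1)[OF A C p(1) in_atlas[OF A]]] by blast
  show "\<forall>\<^sub>F x in nhds (coord C p). coord D (param (A p) (coord (A p) (param C x))) = coord D (param C x)"
    using eventually_param[OF C' p(1) eventually_cdom[OF Ap in_atlas[OF A]]]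
    by eventually_elim (simp add: param_coord[OF Ap])
qed

lemma to_chart_eq: "to_chart A C q = fd (\<lambda>x. coord C (param (A q) x)) (coord (A q) q)"
  by (simp add: to_chart_def o_def)

lemma to_chart_change:
  assumes A: "smooth_atlas A" and C: "admissible_chart A C" and D: "admissible_chart A D"
    and q: "q \<in> cdom C" "q \<in> cdom D"
  shows "to_chart A D q v = fd (\<lambda>x. coord D (param C x)) (coord C q) (to_chart A C q v)"
proof -
  note C' = admissible_is_chart[OF C] and Aq = is_chart_atlas[OF A, of q]
    and qq = in_atlas[OF A, of q]
  have "fd (\<lambda>x. coord D (param C (coord C (param (A q) x)))) (coord (A q) q) v =
      fd (\<lambda>x. coord D (param C x)) (coord C q) (to_chart A C q v)"
    using fd_compose[of "coord (A q) q" "\<lambda>x. coord C (param (A q) x)" "\<lambda>x. coord D (param C x)" v]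
      transition_smooth_atlas(2)[OF A C q(1) qq] transition_smooth[OF A C D q]
    by (simp add: to_chart_eq param_coord[OF Aq qq])
  moreover have ev: "\<forall>\<^sub>F x in nhds (coord (A q) q).
      coord D (param C (coord C (param (A q) x))) = coord D (param (A q) x)"
    using eventually_param[OF Aq qq eventually_cdom[OF C' q(1)]]
    by eventually_elim (simp add: param_coord[OF C'])
  ultimately show ?thesis
    using fd_cong[OF ev] by (simp add: to_chart_eq)
qed

text \<open>The tangent space at \<open>q\<close> is modelled on the chart \<open>A q\<close>
  itself, so the transition involved is the identity near \<open>coord (A q) q\<close>.\<close>

lemma to_chart_self:
  assumes A: "smooth_atlas A"
  shows "to_chart A (A q) q v = v"
proof -
  note Aq = is_chart_atlas[OF A, of q] and qq = in_atlas[OF A, of q]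
  have "\<forall>\<^sub>F x in nhds (coord (A q) q). coord (A q) (param (A q) x) = x"
    using eventually_coord_image[OF Aq qq] by eventually_elim (simp add: coord_param)
  from fd_cong[OF this] show ?thesis by (simp add: to_chart_eq frechet_derivative_ident)
qed

lemma linear_to_chart:
  assumes "smooth_atlas A" "admissible_chart A C" "q \<in> cdom C"
  shows "linear (to_chart A C q)"
  using transition_smooth_atlas(2)[OF assms in_atlas[OF assms(1)]] smooth_at_linear_fd
  by (simp add: to_chart_eq)

lemma from_to_chart:
  assumes "smooth_atlas A" "admissible_chart A C" "q \<in> cdom C"
  shows "from_chart A C q (to_chart A C q v) = v"
  using to_chart_change[OF assms(1,2) admissible_atlas[OF assms(1)] assms(3) in_atlas[OF assms(1)], of v]
    assms(1)
  by (simp add: from_chart_def o_def to_chart_self)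

lemma to_from_chart:
  assumes A: "smooth_atlas A" and C: "admissible_chart A C" and q: "q \<in> cdom C"
  shows "to_chart A C q (from_chart A C q v) = v"
proof -
  note C' = admissible_is_chart[OF C] and Aq = is_chart_atlas[OF A, of q]
    and qq = in_atlas[OF A, of q]
  have "fd (\<lambda>x. coord C (param (A q) (coord (A q) (param C x)))) (coord C q) v =
      to_chart A C q (from_chart A C q v)"
    using fd_compose[of "coord C q" "\<lambda>x. coord (A q) (param C x)" "\<lambda>x. coord C (param (A q) x)" v]
      transition_smooth_atlas[OF A C q qq]
    by (simp add: to_chart_eq from_chart_def o_def param_coord[OF C' q])
  moreover have ev: "\<forall>\<^sub>F x in nhds (coord C q). coord C (param (A q) (coord (A q) (param C x))) = x"
    using eventually_param[OF C' q eventually_cdom[OF Aq qq]] eventually_coord_image[OF C' q]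
    by eventually_elim (simp add: param_coord[OF Aq] coord_param)
  ultimately show ?thesis
    using fd_cong[OF ev] by (simp add: frechet_derivative_ident)
qed

lemma linear_from_chart:
  assumes "smooth_atlas A" "admissible_chart A C" "q \<in> cdom C"
  shows "linear (from_chart A C q)"
  using transition_smooth_atlas(1)[OF assms in_atlas[OF assms(1)]] smooth_at_linear_fd
  by (simp add: from_chart_def o_def)

section \<open>Smooth maps at a point\<close>

text \<open>Continuity is a separate clause because a coordinate map is arbitrary off its domain:
  smoothness of the coordinate expression alone would not keep the images of nearby points in the
  chart around \<open>f p\<close>.\<close>

definition smooth_map_at ::
    "('m::t2_space, 'e::euclidean_space) atlas \<Rightarrow>
     ('n::topological_space, 'f::euclidean_space) atlas \<Rightarrow> 'm \<Rightarrow> ('m \<Rightarrow> 'n) \<Rightarrow> bool" where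
  "smooth_map_at A B p f \<longleftrightarrow> isCont f p \<and>
     smooth_at (coord (A p) p) (\<lambda>x. coord (B (f p)) (f (param (A p) x)))"

text \<open>Transitions are inserted on both sides; continuity of \<open>f\<close> ensures that near
  \<open>p\<close> all points lie in the domains where \<open>param\<close> inverts
  \<open>coord\<close>.\<close>

lemma smooth_change_charts:
  assumes A: "smooth_atlas A" and B: "smooth_atlas B"
    and C: "admissible_chart A C" "admissible_chart A C'" "p \<in> cdom C" "p \<in> cdom C'"
    and D: "admissible_chart B D" "admissible_chart B D'" "f p \<in> cdom D" "f p \<in> cdom D'"
    and f: "isCont f p" and s: "smooth_at (coord C p) (\<lambda>x. coord D (f (param C x)))"
  shows "smooth_at (coord C' p) (\<lambda>x. coord D' (f (param C' x)))"
proof (rule smooth_at_cong)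
  note iC = admissible_is_chart[OF C(1)] admissible_is_chart[OF C(2)]
    and iD = admissible_is_chart[OF D(1)]
  have 1: "smooth_at (coord C' p) (\<lambda>x. coord D (f (param C (coord C (param C' x)))))"
    using smooth_at_compose[OF transition_smooth[OF A C(2,1,4,3)]] s
    by (simp add: param_coord[OF iC(2) C(4)])
  show "smooth_at (coord C' p)
      (\<lambda>x. coord D' (param D (coord D (f (param C (coord C (param C' x)))))))"
    using smooth_at_compose[OF 1, of "\<lambda>y. coord D' (param D y)"] transition_smooth[OF B D]
    by (simp add: param_coord[OF iC(2) C(4)] param_coord[OF iC(1) C(3)])
  show "\<forall>\<^sub>F x in nhds (coord C' p). coord D' (param D (coord D (f (param C (coord C (param C' x)))))) =
      coord D' (f (param C' x))"
    using eventually_param[OF iC(2) C(4) eventually_cdom[OF iC(1) C(3)]]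
      eventually_param[OF iC(2) C(4) eventually_isCont[OF f eventually_cdom[OF iD D(3)]]]
    by eventually_elim (simp add: param_coord[OF iC(1)] param_coord[OF iD])
qed

lemma smooth_map_at_chart:
  assumes "smooth_atlas A" "smooth_atlas B" "admissible_chart A C" "admissible_chart B D"
    and "p \<in> cdom C" "f p \<in> cdom D" "smooth_map_at A B p f"
  shows "smooth_at (coord C p) (\<lambda>x. coord D (f (param C x)))"
  using smooth_change_charts[where f = f, OF assms(1,2) admissible_atlas[OF assms(1)] assms(3)
      in_atlas[OF assms(1)] assms(5) admissible_atlas[OF assms(2)] assms(4) in_atlas[OF assms(2)] assms(6)]
    assms by (simp add: smooth_map_at_def)

lemma smooth_map_atI:
  assumes "smooth_atlas A" "smooth_atlas B" "admissible_chart A C" "admissible_chart B D"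
    and "p \<in> cdom C" "f p \<in> cdom D" "isCont f p"
    and "smooth_at (coord C p) (\<lambda>x. coord D (f (param C x)))"
  shows "smooth_map_at A B p f"
  using smooth_change_charts[where f = f, OF assms(1,2,3) admissible_atlas[OF assms(1)] assms(5)
      in_atlas[OF assms(1)] assms(4) admissible_atlas[OF assms(2)] assms(6) in_atlas[OF assms(2)]]
    assms by (simp add: smooth_map_at_def)

lemma smooth_map_at_isCont: "smooth_map_at A B p f \<Longrightarrow> isCont f p"
  by (simp add: smooth_map_at_def)

lemma smooth_map_on_iff:
  assumes A: "smooth_atlas A" and B: "smooth_atlas B"
  shows "smooth_map_on A B W f \<longleftrightarrow> open W \<and> (\<forall>p\<in>W. smooth_map_at A B p f)"
proof (intro iffI conjI ballI)
  assume f: "smooth_map_on A B W f"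
  then show W: "open W" by (simp add: smooth_map_on_def)
  fix p assume p: "p \<in> W"
  have cont: "isCont f p"
    using f p W by (simp add: smooth_map_on_def continuous_on_eq_continuous_at)
  have "open (W \<inter> f -` cdom (B (f p)))"
    using f W open_cdom[OF is_chart_atlas[OF B]]
    by (auto simp: smooth_map_on_def continuous_open_preimage)
  then have "open (coord (A p) ` (cdom (A p) \<inter> (W \<inter> f -` cdom (B (f p)))))"
    by (rule open_coord_image_Int[OF is_chart_atlas[OF A]])
  then have "smooth_at (coord (A p) p) (coord (B (f p)) \<circ> f \<circ> param (A p))"
    using f p in_atlas[OF A, of p] in_atlas[OF B, of "f p"] unfolding smooth_map_on_def
    by (auto intro!: smooth_atI simp: Int_assoc)
  then show "smooth_map_at A B p f"
    using cont by (simp add: smooth_map_at_def o_def)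
next
  assume f: "open W \<and> (\<forall>p\<in>W. smooth_map_at A B p f)"
  have "smooth_on (coord (A p) ` (cdom (A p) \<inter> W \<inter> f -` cdom (B q))) (coord (B q) \<circ> f \<circ> param (A p))"
    for p q
    using f by (auto intro!: smooth_onI
        smooth_map_at_chart[OF A B admissible_atlas[OF A] admissible_atlas[OF B]] simp: o_def)
  then show "smooth_map_on A B W f"
    using f by (auto simp: smooth_map_on_def intro!: continuous_at_imp_continuous_on smooth_map_at_isCont)
qed

lemma smooth_map_at_compose:
  assumes A: "smooth_atlas A" and B: "smooth_atlas B" and C: "smooth_atlas C"
    and f: "smooth_map_at A B p f" and h: "smooth_map_at B C (f p) h"
  shows "smooth_map_at A C p (\<lambda>x. h (f x))"
    and "tangent_map A C (\<lambda>x. h (f x)) p v = tangent_map B C h (f p) (tangent_map A B f p v)"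
proof -
  note cA = is_chart_atlas[OF A, of p] in_atlas[OF A, of p]
    and cB = is_chart_atlas[OF B, of "f p"] in_atlas[OF B, of "f p"]
  have cont: "isCont (\<lambda>x. h (f x)) p"
    using f h by (auto simp: smooth_map_at_def intro: isCont_o2)
  have f': "smooth_at (coord (A p) p) (\<lambda>x. coord (B (f p)) (f (param (A p) x)))"
    and h': "smooth_at (coord (B (f p)) (f (param (A p) (coord (A p) p))))
      (\<lambda>y. coord (C (h (f p))) (h (param (B (f p)) y)))"
    using f h by (auto simp: smooth_map_at_def param_coord[OF cA])
  have ev: "\<forall>\<^sub>F x in nhds (coord (A p) p).
      coord (C (h (f p))) (h (param (B (f p)) (coord (B (f p)) (f (param (A p) x))))) =
      coord (C (h (f p))) (h (f (param (A p) x)))"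
    using eventually_param[OF cA eventually_isCont[OF smooth_map_at_isCont[OF f] eventually_cdom[OF cB]]]
    by eventually_elim (simp add: param_coord[OF cB(1)])
  show "smooth_map_at A C p (\<lambda>x. h (f x))"
    using cont smooth_at_cong[OF smooth_at_compose[OF f' h'] ev] by (simp add: smooth_map_at_def)
  show "tangent_map A C (\<lambda>x. h (f x)) p v = tangent_map B C h (f p) (tangent_map A B f p v)"
    using fd_compose[OF f' h', of v] fd_cong[OF ev]
    by (simp add: tangent_map_def o_def param_coord[OF cA])
qed

lemma smooth_map_at_cong:
  assumes A: "smooth_atlas A" and f: "smooth_map_at A B p f" and ev: "\<forall>\<^sub>F q in nhds p. f q = h q"
  shows "smooth_map_at A B p h" and "tangent_map A B f p = tangent_map A B h p"
proof -
  note cA = is_chart_atlas[OF A, of p] in_atlas[OF A, of p]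
  have eq: "h p = f p" using eventually_nhds_x_imp_x[OF ev] by simp
  have "isCont f p = isCont h p" using ev by (rule isCont_cong)
  have ev': "\<forall>\<^sub>F x in nhds (coord (A p) p).
      coord (B (f p)) (f (param (A p) x)) = coord (B (h p)) (h (param (A p) x))"
    using eventually_param[OF cA ev] by eventually_elim (simp add: eq)
  show "smooth_map_at A B p h"
    using f smooth_at_cong[OF _ ev'] \<open>isCont f p = isCont h p\<close> by (auto simp: smooth_map_at_def eq)
  show "tangent_map A B f p = tangent_map A B h p"
    using fd_cong[OF ev'] by (simp add: tangent_map_def o_def eq)
qed

lemma smooth_map_at_ident: "smooth_atlas A \<Longrightarrow> smooth_map_at A A p (\<lambda>x. x)"
  and tangent_map_ident: "smooth_atlas A \<Longrightarrow> tangent_map A A (\<lambda>x. x) p v = v"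
proof -
  assume A: "smooth_atlas A"
  show "smooth_map_at A A p (\<lambda>x. x)"
    using transition_smooth[OF A admissible_atlas[OF A] admissible_atlas[OF A] in_atlas[OF A] in_atlas[OF A], of p]
    by (simp add: smooth_map_at_def)
  show "tangent_map A A (\<lambda>x. x) p v = v"
    using to_chart_self[OF A, of p v] by (simp add: tangent_map_def to_chart_eq o_def)
qed

lemma tangent_map_chart:
  assumes A: "smooth_atlas A" and B: "smooth_atlas B"
    and C: "admissible_chart A C" "p \<in> cdom C" and D: "admissible_chart B D" "f p \<in> cdom D"
    and f: "smooth_map_at A B p f"
  shows "to_chart B D (f p) (tangent_map A B f p v) =
    fd (\<lambda>x. coord D (f (param C x))) (coord C p) (to_chart A C p v)"
proof -
  note cA = is_chart_atlas[OF A, of p] in_atlas[OF A, of p]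
    and cB = is_chart_atlas[OF B, of "f p"] in_atlas[OF B, of "f p"]
    and iC = admissible_is_chart[OF C(1)]
  have f': "smooth_at (coord (A p) p) (\<lambda>x. coord (B (f p)) (f (param (A p) x)))"
    using f by (simp add: smooth_map_at_def)
  have t: "smooth_at (coord (B (f p)) (f (param (A p) (coord (A p) p))))
      (\<lambda>y. coord D (param (B (f p)) y))"
    using transition_smooth_atlas(2)[OF B D cB(2)] by (simp add: param_coord[OF cA])
  have ev: "\<forall>\<^sub>F x in nhds (coord (A p) p).
      coord D (param (B (f p)) (coord (B (f p)) (f (param (A p) x)))) = coord D (f (param (A p) x))"
    using eventually_param[OF cA eventually_isCont[OF smooth_map_at_isCont[OF f] eventually_cdom[OF cB]]]
    by eventually_elim (simp add: param_coord[OF cB(1)])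
  have 1: "to_chart B D (f p) (tangent_map A B f p v) = fd (\<lambda>x. coord D (f (param (A p) x))) (coord (A p) p) v"
    using fd_compose[OF f' t, of v] fd_cong[OF ev]
    by (simp add: tangent_map_def o_def param_coord[OF cA] to_chart_eq)
  have ev2: "\<forall>\<^sub>F x in nhds (coord (A p) p).
      coord D (f (param C (coord C (param (A p) x)))) = coord D (f (param (A p) x))"
    using eventually_param[OF cA eventually_cdom[OF iC C(2)]]
    by eventually_elim (simp add: param_coord[OF iC])
  have f2: "smooth_at (coord C (param (A p) (coord (A p) p))) (\<lambda>x. coord D (f (param C x)))"
    using smooth_map_at_chart[OF A B C(1) D(1) C(2) D(2) f] by (simp add: param_coord[OF cA])
  have 2: "fd (\<lambda>x. coord D (f (param C x))) (coord C p) (to_chart A C p v) =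
      fd (\<lambda>x. coord D (f (param (A p) x))) (coord (A p) p) v"
    using fd_compose[OF transition_smooth_atlas(2)[OF A C cA(2)] f2, of v] fd_cong[OF ev2]
    by (simp add: to_chart_eq param_coord[OF cA])
  show ?thesis using 1 2 by simp
qed

lemma linear_tangent_map: "smooth_map_at A B p f \<Longrightarrow> linear (tangent_map A B f p)"
  unfolding smooth_map_at_def tangent_map_def o_def by (rule smooth_at_linear_fd) simp

text \<open>The line with its one global identity chart: real functions and curves become smooth
  maps between manifolds, so one chain rule serves all of them.\<close>

definition real_atlas :: "(real, real) atlas" where
  "real_atlas = (\<lambda>_. (UNIV, \<lambda>x. x))"

lemma inv_into_UNIV_ident [simp]: "inv_into UNIV (\<lambda>x. x) = (\<lambda>x. x)"
  using inv_id by (simp add: id_def)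

lemma smooth_atlas_real: "smooth_atlas real_atlas"
  by (auto simp: smooth_atlas_def real_atlas_def is_chart_def compatible_def o_def homeomorphism_def
      continuous_on_id intro!: smooth_onI)

text \<open>The target chart is global, so here continuity does follow from the coordinate
  expression.\<close>

lemma smooth_map_at_realI:
  assumes A: "smooth_atlas A" and C: "admissible_chart A C" "p \<in> cdom C"
    and h: "smooth_at (coord C p) (\<lambda>x. h (param C x))"
  shows "smooth_map_at A real_atlas p h"
proof -
  note iC = admissible_is_chart[OF C(1)]
  have "isCont (\<lambda>q. h (param C (coord C q))) p"
    using isCont_o2[OF isCont_coord[OF iC C(2)] smooth_at_isCont[OF h]] .
  moreover have "\<forall>\<^sub>F q in nhds p. h (param C (coord C q)) = h q"
    using eventually_cdom[OF iC C(2)] by eventually_elim (simp add: param_coord[OF iC])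
  ultimately have "isCont h p" by (rule isCont_transfer)
  then show ?thesis
    using h by (intro smooth_map_atI[OF A smooth_atlas_real C(1) admissible_atlas[OF smooth_atlas_real] C(2)])
      (auto simp: real_atlas_def)
qed

lemma smooth_map_at_realD:
  assumes A: "smooth_atlas A" and C: "admissible_chart A C" "p \<in> cdom C"
    and h: "smooth_map_at A real_atlas p h"
  shows "smooth_at (coord C p) (\<lambda>x. h (param C x))"
  using smooth_map_at_chart[OF A smooth_atlas_real C(1) admissible_atlas[OF smooth_atlas_real] C(2) _ h]
  by (simp add: real_atlas_def)

section \<open>Curves in subsets\<close>

lemma curve_coordinate_derivative:
  assumes c: "curve_through A S p v c" and G: "smooth_at (coord (A p) p) G"
  shows "((\<lambda>t. G (coord (A p) (c t))) has_vector_derivative fd G (coord (A p) p) v) (at 0)"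
proof -
  have c': "((\<lambda>t. coord (A p) (c t)) has_derivative (\<lambda>t. t *\<^sub>R v)) (at 0)" and "c 0 = p"
    using c by (auto simp: curve_through_def has_vector_derivative_def o_def)
  from diff_chain_at[OF c', of G "fd G (coord (A p) p)"] show ?thesis
    using smooth_at_has_derivative[OF G] smooth_at_linear_fd[OF G] \<open>c 0 = p\<close>
    by (simp add: has_vector_derivative_def o_def linear_scale)
qed

lemma curve_in: "curve_through A S p v c \<Longrightarrow> c t \<in> S"
  by (auto simp: curve_through_def)

lemma curve_eventually:
  assumes "curve_through A S p v c" "\<forall>\<^sub>F q in nhds p. P q"
  shows "\<forall>\<^sub>F t in nhds 0. P (c t)"
  using eventually_isCont[of 0 c P] assms by (auto simp: curve_through_def)

lemma has_vector_derivative_transfer: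
  assumes "(f has_vector_derivative D) (at x)" "\<forall>\<^sub>F t in nhds x. f t = g t"
  shows "(g has_vector_derivative D) (at x)"
  using has_derivative_cong_nhds[OF assms(2)] assms(1) by (simp add: has_vector_derivative_def)

lemma curve_through_map:
  assumes A: "smooth_atlas A" and B: "smooth_atlas B"
    and c: "curve_through A S p v c" and f: "smooth_map_at A B p f" and S: "f ` S \<subseteq> S'"
  shows "curve_through B S' (f p) (tangent_map A B f p v) (\<lambda>t. f (c t))"
proof -
  note cA = is_chart_atlas[OF A, of p] in_atlas[OF A, of p]
  have "((\<lambda>t. coord (B (f p)) (f (param (A p) (coord (A p) (c t)))))
      has_vector_derivative tangent_map A B f p v) (at 0)"
    using curve_coordinate_derivative[OF c, of "\<lambda>x. coord (B (f p)) (f (param (A p) x))"] f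
    by (simp add: smooth_map_at_def tangent_map_def o_def)
  moreover have "\<forall>\<^sub>F t in nhds 0. coord (B (f p)) (f (param (A p) (coord (A p) (c t)))) =
      coord (B (f p)) (f (c t))"
    using curve_eventually[OF c eventually_cdom[OF cA]]
    by eventually_elim (simp add: param_coord[OF cA(1)])
  ultimately have "((\<lambda>t. coord (B (f p)) (f (c t))) has_vector_derivative tangent_map A B f p v) (at 0)"
    by (rule has_vector_derivative_transfer)
  moreover have "isCont (\<lambda>t. f (c t)) 0"
    using c f by (auto simp: curve_through_def smooth_map_at_def intro!: isCont_o2[of _ c f])
  ultimately show ?thesis
    using c S by (auto simp: curve_through_def o_def)
qed

lemma curve_real_derivative:
  assumes A: "smooth_atlas A" and c: "curve_through A S p v c" and h: "smooth_map_at A real_atlas p h"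
  shows "((\<lambda>t. h (c t)) has_real_derivative tangent_map A real_atlas h p v) (at 0)"
  using curve_through_map[OF A smooth_atlas_real c h order_refl]
  by (simp add: curve_through_def o_def real_atlas_def has_real_derivative_iff_has_vector_derivative)

section \<open>Vector fields and functions along subsets\<close>

text \<open>The vectors \<open>X q\<close> have components in different charts \<open>A q\<close>,
  with no continuity in \<open>q\<close>. Only after \<open>to_chart\<close> moves them all to
  \<open>A p\<close> is a derivative meaningful.\<close>

definition smooth_field_at ::
    "('m::t2_space, 'e::euclidean_space) atlas \<Rightarrow> 'm \<Rightarrow> ('m \<Rightarrow> 'e) \<Rightarrow> bool" where
  "smooth_field_at A p X \<longleftrightarrow>
     smooth_at (coord (A p) p) (\<lambda>x. to_chart A (A p) (param (A p) x) (X (param (A p) x)))"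

lemma smooth_field_change_chart:
  assumes A: "smooth_atlas A" and C: "admissible_chart A C" "p \<in> cdom C"
    and D: "admissible_chart A D" "p \<in> cdom D"
    and X: "smooth_at (coord C p) (\<lambda>x. to_chart A C (param C x) (X (param C x)))"
  shows "smooth_at (coord D p) (\<lambda>x. to_chart A D (param D x) (X (param D x)))"
proof (rule smooth_at_cong)
  note iC = admissible_is_chart[OF C(1)] and iD = admissible_is_chart[OF D(1)]
  note t = transition_smooth[OF A D(1) C(1) D(2) C(2)]
  have 1: "smooth_at (coord D p) (\<lambda>y. to_chart A C (param C (coord C (param D y))) (X (param C (coord C (param D y)))))"
    using smooth_at_compose[OF t] X by (simp add: param_coord[OF iD D(2)])
  show "smooth_at (coord D p) (\<lambda>y. fd (\<lambda>x. coord D (param C x)) (coord C (param D y))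
      (to_chart A C (param C (coord C (param D y))) (X (param C (coord C (param D y))))))"
    using smooth_at_fd_apply[OF _ t 1, of "\<lambda>x. coord D (param C x)"]
      transition_smooth[OF A C(1) D(1) C(2) D(2)] by (simp add: param_coord[OF iD D(2)])
  show "\<forall>\<^sub>F y in nhds (coord D p). fd (\<lambda>x. coord D (param C x)) (coord C (param D y))
      (to_chart A C (param C (coord C (param D y))) (X (param C (coord C (param D y))))) =
      to_chart A D (param D y) (X (param D y))"
    using eventually_param[OF iD D(2) eventually_cdom[OF iC C(2)]]
      eventually_param[OF iD D(2) eventually_cdom[OF iD D(2)]]
    by eventually_elim (simp add: param_coord[OF iC] to_chart_change[OF A C(1) D(1)])
qed

lemma smooth_field_at_chart:
  assumes A: "smooth_atlas A" and C: "admissible_chart A C" "p \<in> cdom C"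
  shows "smooth_field_at A p X \<longleftrightarrow> smooth_at (coord C p) (\<lambda>x. to_chart A C (param C x) (X (param C x)))"
  using smooth_field_change_chart[OF A C admissible_atlas[OF A] in_atlas[OF A]]
    smooth_field_change_chart[OF A admissible_atlas[OF A] in_atlas[OF A] C]
  unfolding smooth_field_at_def by blast

lemma smooth_field_at_eventually:
  assumes A: "smooth_atlas A" and X: "smooth_field_at A p X"
  shows "\<forall>\<^sub>F q in nhds p. smooth_field_at A q X"
proof -
  note cA = is_chart_atlas[OF A, of p] in_atlas[OF A, of p]
  have "\<forall>\<^sub>F q in nhds p. smooth_at (coord (A p) q)
      (\<lambda>x. to_chart A (A p) (param (A p) x) (X (param (A p) x)))"
    using eventually_coord[OF cA smooth_at_eventually] X by (simp add: smooth_field_at_def)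
  with eventually_cdom[OF cA] show ?thesis
    by eventually_elim (simp add: smooth_field_at_chart[OF A admissible_atlas[OF A]])
qed

lemma smooth_vector_field_on_iff:
  assumes A: "smooth_atlas A"
  shows "smooth_vector_field_on A W X \<longleftrightarrow> open W \<and> (\<forall>p\<in>W. smooth_field_at A p X)"
proof (intro iffI conjI ballI)
  assume X: "smooth_vector_field_on A W X"
  then show W: "open W" by (simp add: smooth_vector_field_on_def)
  show "smooth_field_at A p X" if "p \<in> W" for p
    using X that in_atlas[OF A, of p] open_coord_image_Int[OF is_chart_atlas[OF A] W, of p]
    unfolding smooth_field_at_def smooth_vector_field_on_def
    by (auto intro: smooth_atI)
next
  assume X: "open W \<and> (\<forall>p\<in>W. smooth_field_at A p X)"
  then show "smooth_vector_field_on A W X"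
    unfolding smooth_vector_field_on_def
    by (auto intro!: smooth_onI simp: smooth_field_at_chart[OF A admissible_atlas[OF A], symmetric])
qed

text \<open>Germ form of the definition. For the converse, a field smooth at \<open>p\<close> is
  smooth at all nearby points, which supplies the open set \<open>W\<close>.\<close>

lemma smooth_field_along_iff:
  assumes A: "smooth_atlas A"
  shows "smooth_field_along A S N \<longleftrightarrow>
    (\<forall>p\<in>S. \<exists>X. smooth_field_at A p X \<and> (\<forall>\<^sub>F q in nhds p. q \<in> S \<longrightarrow> N q = X q))"
proof
  assume N: "smooth_field_along A S N"
  show "\<forall>p\<in>S. \<exists>X. smooth_field_at A p X \<and> (\<forall>\<^sub>F q in nhds p. q \<in> S \<longrightarrow> N q = X q)"
  proof
    fix p assume "p \<in> S"
    then obtain W X where W: "p \<in> W" "smooth_vector_field_on A W X" "\<And>q. q \<in> S \<inter> W \<Longrightarrow> N q = X q"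
      using N unfolding smooth_field_along_def by meson
    then have "open W" "smooth_field_at A p X" by (auto simp: smooth_vector_field_on_iff[OF A])
    moreover from \<open>open W\<close> have "\<forall>\<^sub>F q in nhds p. q \<in> S \<longrightarrow> N q = X q"
      unfolding eventually_nhds using W by blast
    ultimately show "\<exists>X. smooth_field_at A p X \<and> (\<forall>\<^sub>F q in nhds p. q \<in> S \<longrightarrow> N q = X q)" by blast
  qed
next
  assume N: "\<forall>p\<in>S. \<exists>X. smooth_field_at A p X \<and> (\<forall>\<^sub>F q in nhds p. q \<in> S \<longrightarrow> N q = X q)"
  show "smooth_field_along A S N" unfolding smooth_field_along_def
  proof
    fix p assume "p \<in> S"
    then obtain X where X: "smooth_field_at A p X" "\<forall>\<^sub>F q in nhds p. q \<in> S \<longrightarrow> N q = X q"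
      using N by blast
    have "\<forall>\<^sub>F q in nhds p. smooth_field_at A q X \<and> (q \<in> S \<longrightarrow> N q = X q)"
      using smooth_field_at_eventually[OF A X(1)] X(2) by (rule eventually_conj)
    then obtain W where "open W" "p \<in> W" "\<forall>q\<in>W. smooth_field_at A q X \<and> (q \<in> S \<longrightarrow> N q = X q)"
      unfolding eventually_nhds by blast
    then show "\<exists>W X. p \<in> W \<and> smooth_vector_field_on A W X \<and> (\<forall>q\<in>S \<inter> W. N q = X q)"
      by (intro exI[of _ W] exI[of _ X]) (auto simp: smooth_vector_field_on_iff[OF A])
  qed
qed

text \<open>The counterpart of \<open>smooth_field_along\<close> for functions: local smooth
  extensions to the ambient manifold, since a function such as \<nu> is only controlled on the
  hypersurface.\<close>

definition smooth_fun_along ::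
    "('m::t2_space, 'e::euclidean_space) atlas \<Rightarrow> 'm set \<Rightarrow> ('m \<Rightarrow> real) \<Rightarrow> bool" where
  "smooth_fun_along A S h \<longleftrightarrow>
     (\<forall>p\<in>S. \<exists>H. smooth_map_at A real_atlas p H \<and> (\<forall>\<^sub>F q in nhds p. q \<in> S \<longrightarrow> h q = H q))"

lemma smooth_field_at_add:
  assumes A: "smooth_atlas A" and "smooth_field_at A p X" "smooth_field_at A p Y"
  shows "smooth_field_at A p (\<lambda>q. X q + Y q)"
proof -
  note cA = is_chart_atlas[OF A, of p] in_atlas[OF A, of p]
  have "smooth_at (coord (A p) p) (\<lambda>x. to_chart A (A p) (param (A p) x) (X (param (A p) x)) +
      to_chart A (A p) (param (A p) x) (Y (param (A p) x)))"
    using assms by (auto simp: smooth_field_at_def intro: smooth_at_add)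
  then show ?thesis unfolding smooth_field_at_def
  proof (rule smooth_at_cong)
    show "\<forall>\<^sub>F x in nhds (coord (A p) p). to_chart A (A p) (param (A p) x) (X (param (A p) x)) +
        to_chart A (A p) (param (A p) x) (Y (param (A p) x)) =
        to_chart A (A p) (param (A p) x) (X (param (A p) x) + Y (param (A p) x))"
      using eventually_param[OF cA eventually_cdom[OF cA]]
      by eventually_elim (simp add: linear_add[OF linear_to_chart[OF A admissible_atlas[OF A]]])
  qed
qed

lemma smooth_field_at_scaleR:
  assumes A: "smooth_atlas A" and h: "smooth_map_at A real_atlas p h" and X: "smooth_field_at A p X"
  shows "smooth_field_at A p (\<lambda>q. h q *\<^sub>R X q)"
proof -
  note cA = is_chart_atlas[OF A, of p] in_atlas[OF A, of p]
  have "smooth_at (coord (A p) p) (\<lambda>x. h (param (A p) x) *\<^sub>R to_chart A (A p) (param (A p) x) (X (param (A p) x)))"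
    using smooth_map_at_realD[OF A admissible_atlas[OF A] cA(2) h] X
    by (auto simp: smooth_field_at_def intro: smooth_at_scaleR)
  then show ?thesis unfolding smooth_field_at_def
  proof (rule smooth_at_cong)
    show "\<forall>\<^sub>F x in nhds (coord (A p) p).
        h (param (A p) x) *\<^sub>R to_chart A (A p) (param (A p) x) (X (param (A p) x)) =
        to_chart A (A p) (param (A p) x) (h (param (A p) x) *\<^sub>R X (param (A p) x))"
      using eventually_param[OF cA eventually_cdom[OF cA]]
      by eventually_elim (simp add: linear_scale[OF linear_to_chart[OF A admissible_atlas[OF A]]])
  qed
qed

lemma smooth_field_along_add:
  assumes "smooth_atlas A" "smooth_field_along A S X" "smooth_field_along A S Y"
  shows "smooth_field_along A S (\<lambda>q. X q + Y q)"
  unfolding smooth_field_along_iff[OF assms(1)]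
proof
  fix p assume "p \<in> S"
  then obtain X' Y' where X: "smooth_field_at A p X'" "\<forall>\<^sub>F q in nhds p. q \<in> S \<longrightarrow> X q = X' q"
    and Y: "smooth_field_at A p Y'" "\<forall>\<^sub>F q in nhds p. q \<in> S \<longrightarrow> Y q = Y' q"
    using assms unfolding smooth_field_along_iff[OF assms(1)] by meson
  have "\<forall>\<^sub>F q in nhds p. q \<in> S \<longrightarrow> X q + Y q = X' q + Y' q"
    using X(2) Y(2) by eventually_elim simp
  then show "\<exists>Z. smooth_field_at A p Z \<and> (\<forall>\<^sub>F q in nhds p. q \<in> S \<longrightarrow> X q + Y q = Z q)"
    using smooth_field_at_add[OF assms(1) X(1) Y(1)] by blast
qed

lemma smooth_field_along_scaleR:
  assumes "smooth_atlas A" "smooth_fun_along A S h" "smooth_field_along A S X"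
  shows "smooth_field_along A S (\<lambda>q. h q *\<^sub>R X q)"
  unfolding smooth_field_along_iff[OF assms(1)]
proof
  fix p assume "p \<in> S"
  then obtain X' h' where X: "smooth_field_at A p X'" "\<forall>\<^sub>F q in nhds p. q \<in> S \<longrightarrow> X q = X' q"
    and h: "smooth_map_at A real_atlas p h'" "\<forall>\<^sub>F q in nhds p. q \<in> S \<longrightarrow> h q = h' q"
    using assms unfolding smooth_field_along_iff[OF assms(1)] smooth_fun_along_def by meson
  have "\<forall>\<^sub>F q in nhds p. q \<in> S \<longrightarrow> h q *\<^sub>R X q = h' q *\<^sub>R X' q"
    using X(2) h(2) by eventually_elim simp
  then show "\<exists>Z. smooth_field_at A p Z \<and> (\<forall>\<^sub>F q in nhds p. q \<in> S \<longrightarrow> h q *\<^sub>R X q = Z q)"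
    using smooth_field_at_scaleR[OF assms(1) h(1) X(1)] by blast
qed

lemma smooth_fun_along_compose:
  assumes A: "smooth_atlas A" and h: "smooth_fun_along A S h" and \<phi>: "\<And>x. smooth_at x \<phi>"
  shows "smooth_fun_along A S (\<lambda>q. \<phi> (h q))"
  unfolding smooth_fun_along_def
proof
  fix p assume "p \<in> S"
  then obtain h' where h': "smooth_map_at A real_atlas p h'" "\<forall>\<^sub>F q in nhds p. q \<in> S \<longrightarrow> h q = h' q"
    using h unfolding smooth_fun_along_def by meson
  have "smooth_at (coord (A p) p) (\<lambda>x. \<phi> (h' (param (A p) x)))"
    using smooth_map_at_realD[OF A admissible_atlas[OF A] in_atlas[OF A] h'(1)] \<phi>
    by (rule smooth_at_compose)
  then have "smooth_map_at A real_atlas p (\<lambda>q. \<phi> (h' q))"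
    by (rule smooth_map_at_realI[OF A admissible_atlas[OF A] in_atlas[OF A]])
  moreover have "\<forall>\<^sub>F q in nhds p. q \<in> S \<longrightarrow> \<phi> (h q) = \<phi> (h' q)"
    using h'(2) by eventually_elim simp
  ultimately show "\<exists>H. smooth_map_at A real_atlas p H \<and> (\<forall>\<^sub>F q in nhds p. q \<in> S \<longrightarrow> \<phi> (h q) = H q)"
    by blast
qed

lemma smooth_fun_along_continuous_on:
  assumes "smooth_fun_along A S h"
  shows "continuous_on S h"
  unfolding continuous_on_eq_continuous_within
proof
  fix p assume p: "p \<in> S"
  then obtain H where H: "smooth_map_at A real_atlas p H" "\<forall>\<^sub>F q in nhds p. q \<in> S \<longrightarrow> h q = H q"
    using assms unfolding smooth_fun_along_def by meson
  have "continuous (at p within S) H"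
    using smooth_map_at_isCont[OF H(1)] continuous_at_imp_continuous_at_within by blast
  moreover have "\<forall>\<^sub>F q in at p within S. H q = h q"
    using H(2) by (auto simp: eventually_at_filter elim: eventually_mono)
  moreover have "H p = h p" using eventually_nhds_x_imp_x[OF H(2)] p by simp
  ultimately show "continuous (at p within S) h"
    unfolding continuous_within using tendsto_cong by force
qed

text \<open>The differential of a local extension serves as \<open>l\<close>. Curves stay in
  \<open>S\<close>, so the extension and \<open>h\<close> agree along them near time 0, and the
  derivative depends on the velocity alone.\<close>

lemma smooth_fun_along_curve:
  assumes A: "smooth_atlas A" and p: "p \<in> S" and h: "smooth_fun_along A S h"
  obtains l where "linear l"
    "\<And>c v. curve_through A S p v c \<Longrightarrow> ((\<lambda>t. h (c t)) has_real_derivative l v) (at 0)"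
proof -
  obtain H where H: "smooth_map_at A real_atlas p H" "\<forall>\<^sub>F q in nhds p. q \<in> S \<longrightarrow> h q = H q"
    using h p unfolding smooth_fun_along_def by meson
  have "((\<lambda>t. h (c t)) has_real_derivative tangent_map A real_atlas H p v) (at 0)"
    if c: "curve_through A S p v c" for c v
  proof -
    have "\<forall>\<^sub>F t in nhds 0. H (c t) = h (c t)"
      using curve_eventually[OF c H(2)] by eventually_elim (simp add: curve_in[OF c])
    then show ?thesis
      using curve_real_derivative[OF A c H(1)]
      unfolding has_real_derivative_iff_has_vector_derivative
      by (rule has_vector_derivative_transfer[rotated])
  qed
  then show thesis using that linear_tangent_map[OF H(1)] by blast
qed

lemma smooth_field_along_curve:
  assumes A: "smooth_atlas A" and p: "p \<in> S" and N: "smooth_field_along A S N"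
  obtains l where "linear l"
    "\<And>c v. curve_through A S p v c \<Longrightarrow>
      ((\<lambda>t. to_chart A (A p) (c t) (N (c t))) has_vector_derivative l v) (at 0)"
proof -
  note cA = is_chart_atlas[OF A, of p] in_atlas[OF A, of p]
  obtain X where X: "smooth_field_at A p X" "\<forall>\<^sub>F q in nhds p. q \<in> S \<longrightarrow> N q = X q"
    using N p unfolding smooth_field_along_iff[OF A] by meson
  let ?\<xi> = "\<lambda>x. to_chart A (A p) (param (A p) x) (X (param (A p) x))"
  have \<xi>: "smooth_at (coord (A p) p) ?\<xi>" using X(1) by (simp add: smooth_field_at_def)
  have "((\<lambda>t. to_chart A (A p) (c t) (N (c t))) has_vector_derivative fd ?\<xi> (coord (A p) p) v) (at 0)"
    if c: "curve_through A S p v c" for c v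
  proof (rule has_vector_derivative_transfer[OF curve_coordinate_derivative[OF c \<xi>]])
    show "\<forall>\<^sub>F t in nhds 0. ?\<xi> (coord (A p) (c t)) = to_chart A (A p) (c t) (N (c t))"
      using curve_eventually[OF c X(2)] curve_eventually[OF c eventually_cdom[OF cA]]
      by eventually_elim (simp add: param_coord[OF cA(1)] curve_in[OF c])
  qed
  then show thesis using that smooth_at_linear_fd[OF \<xi>] by blast
qed

text \<open>Smoothness of the metric is only available for constant arguments in a chart, so both
  fields are expanded in \<open>Basis\<close> and the function becomes a finite sum of
  products.\<close>

lemma smooth_map_at_metric:
  assumes A: "smooth_atlas A" and g: "riemannian_metric A g"
    and X: "smooth_field_at A p X" and Y: "smooth_field_at A p Y"
  shows "smooth_map_at A real_atlas p (\<lambda>q. g q (X q) (Y q))"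
proof (rule smooth_map_at_realI[OF A admissible_atlas[OF A] in_atlas[OF A]])
  note cA = is_chart_atlas[OF A, of p] in_atlas[OF A, of p]
  let ?x = "coord (A p) p"
  define \<xi> where "\<xi> x = to_chart A (A p) (param (A p) x) (X (param (A p) x))" for x
  define \<zeta> where "\<zeta> x = to_chart A (A p) (param (A p) x) (Y (param (A p) x))" for x
  have \<xi>\<zeta>: "smooth_at ?x \<xi>" "smooth_at ?x \<zeta>"
    using X Y by (auto simp: smooth_field_at_def \<xi>_def[abs_def] \<zeta>_def[abs_def])
  have m: "smooth_at ?x (\<lambda>x. metric_in_chart A g (A p) x v w)" for v w
    using g cA(2) open_coord_image_Int[OF cA(1) open_UNIV] unfolding riemannian_metric_def
    by (auto intro: smooth_atI)
  have "smooth_at ?x (\<lambda>x. \<Sum>b\<in>Basis. \<Sum>b'\<in>Basis.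
      (\<xi> x \<bullet> b) * ((\<zeta> x \<bullet> b') * metric_in_chart A g (A p) x b b'))"
    by (intro smooth_at_sum smooth_at_mult smooth_at_inner \<xi>\<zeta> m smooth_at_const)
  then show "smooth_at ?x (\<lambda>x. g (param (A p) x) (X (param (A p) x)) (Y (param (A p) x)))"
  proof (rule smooth_at_cong)
    show "\<forall>\<^sub>F x in nhds ?x. (\<Sum>b\<in>Basis. \<Sum>b'\<in>Basis.
        (\<xi> x \<bullet> b) * ((\<zeta> x \<bullet> b') * metric_in_chart A g (A p) x b b')) =
        g (param (A p) x) (X (param (A p) x)) (Y (param (A p) x))"
      using eventually_param[OF cA eventually_cdom[OF cA]]
    proof eventually_elim
      case (elim x)
      let ?q = "param (A p) x"
      note ft = from_to_chart[OF A admissible_atlas[OF A] elim]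
      have F: "linear (from_chart A (A p) ?q)"
        by (rule linear_from_chart[OF A admissible_atlas[OF A] elim])
      have bil: "bilinear (g ?q)" using g by (simp add: riemannian_metric_def)
      have l: "linear (\<lambda>v. metric_in_chart A g (A p) x v w)" "linear (metric_in_chart A g (A p) x w)" for w
        unfolding metric_in_chart_def using F bil
        by (auto simp: bilinear_def intro!: linear_compose[OF F, unfolded o_def])
      have "g ?q (X ?q) (Y ?q) = metric_in_chart A g (A p) x (\<xi> x) (\<zeta> x)"
        by (simp add: metric_in_chart_def \<xi>_def \<zeta>_def ft)
      also have "\<dots> = (\<Sum>b\<in>Basis. (\<xi> x \<bullet> b) * metric_in_chart A g (A p) x b (\<zeta> x))"
        using linear_basis_expansion[OF l(1), of "\<xi> x" "\<zeta> x"] by simp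
      also have "\<dots> = (\<Sum>b\<in>Basis. (\<xi> x \<bullet> b) * (\<Sum>b'\<in>Basis. (\<zeta> x \<bullet> b') * metric_in_chart A g (A p) x b b'))"
        using linear_basis_expansion[OF l(2), of _ "\<zeta> x"] by simp
      finally show ?case by (simp add: sum_distrib_left)
    qed
  qed
qed

lemma smooth_fun_along_metric:
  assumes "smooth_atlas A" "riemannian_metric A g" "smooth_field_along A S X" "smooth_field_along A S Y"
  shows "smooth_fun_along A S (\<lambda>q. g q (X q) (Y q))"
  unfolding smooth_fun_along_def
proof
  fix p assume "p \<in> S"
  then obtain X' Y' where X: "smooth_field_at A p X'" "\<forall>\<^sub>F q in nhds p. q \<in> S \<longrightarrow> X q = X' q"
    and Y: "smooth_field_at A p Y'" "\<forall>\<^sub>F q in nhds p. q \<in> S \<longrightarrow> Y q = Y' q"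
    using assms unfolding smooth_field_along_iff[OF assms(1)] by meson
  have "\<forall>\<^sub>F q in nhds p. q \<in> S \<longrightarrow> g q (X q) (Y q) = g q (X' q) (Y' q)"
    using X(2) Y(2) by eventually_elim simp
  then show "\<exists>H. smooth_map_at A real_atlas p H \<and> (\<forall>\<^sub>F q in nhds p. q \<in> S \<longrightarrow> g q (X q) (Y q) = H q)"
    using smooth_map_at_metric[OF assms(1,2) X(1) Y(1)] by blast
qed

section \<open>Diffeomorphisms between open sets\<close>

definition diffeo ::
    "('m::{t2_space, second_countable_topology}, 'e::euclidean_space) atlas \<Rightarrow>
     ('n::{t2_space, second_countable_topology}, 'f::euclidean_space) atlas \<Rightarrow>
     'm set \<Rightarrow> 'n set \<Rightarrow> ('m \<Rightarrow> 'n) \<Rightarrow> ('n \<Rightarrow> 'm) \<Rightarrow> bool" where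
  "diffeo A B U V f h \<longleftrightarrow> smooth_map_on A B U f \<and> smooth_map_on B A V h \<and>
     f ` U \<subseteq> V \<and> h ` V \<subseteq> U \<and> (\<forall>x\<in>U. h (f x) = x) \<and> (\<forall>y\<in>V. f (h y) = y)"

definition push_field ::
    "('m, 'e::euclidean_space) atlas \<Rightarrow> ('n, 'f::euclidean_space) atlas \<Rightarrow>
     ('m \<Rightarrow> 'n) \<Rightarrow> ('n \<Rightarrow> 'm) \<Rightarrow> ('m \<Rightarrow> 'e) \<Rightarrow> 'n \<Rightarrow> 'f" where
  "push_field A B f h X y = tangent_map A B f (h y) (X (h y))"

context
  fixes A :: "('m::{t2_space, second_countable_topology}, 'e::euclidean_space) atlas"
    and B :: "('n::{t2_space, second_countable_topology}, 'e) atlas"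
    and U V f h
  assumes A: "smooth_atlas A" and B: "smooth_atlas B" and d: "diffeo A B U V f h"
begin

lemma diffeo_open: "open U" "open V"
  using d by (auto simp: diffeo_def smooth_map_on_def)

lemma diffeo_smooth: "p \<in> U \<Longrightarrow> smooth_map_at A B p f" "q \<in> V \<Longrightarrow> smooth_map_at B A q h"
  using d by (auto simp: diffeo_def smooth_map_on_iff[OF A B] smooth_map_on_iff[OF B A])

lemma diffeo_simps:
  "p \<in> U \<Longrightarrow> f p \<in> V" "q \<in> V \<Longrightarrow> h q \<in> U" "p \<in> U \<Longrightarrow> h (f p) = p" "q \<in> V \<Longrightarrow> f (h q) = q"
  using d by (auto simp: diffeo_def)

lemma tangent_map_inverse:
  assumes p: "p \<in> U"
  shows "tangent_map B A h (f p) (tangent_map A B f p v) = v"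
proof -
  have "tangent_map A A (\<lambda>x. h (f x)) p v = tangent_map B A h (f p) (tangent_map A B f p v)"
    using smooth_map_at_compose(2)[OF A B A] diffeo_smooth diffeo_simps p by blast
  moreover have "\<forall>\<^sub>F q in nhds p. q = h (f q)"
    using eventually_nhds_in_open[OF diffeo_open(1) p] by eventually_elim (simp add: diffeo_simps)
  ultimately show ?thesis
    using smooth_map_at_cong(2)[OF A smooth_map_at_ident[OF A]] tangent_map_ident[OF A] by metis
qed

text \<open>In coordinates the pushed field at \<open>y\<close> is the derivative of
  \<open>f\<close> at \<open>h y\<close> applied to the components of \<open>X\<close> there, an
  instance of \<open>smooth_at_fd_apply\<close>.\<close>

lemma smooth_field_at_push:
  assumes p: "p \<in> U" and X: "smooth_field_at A p X"
  shows "smooth_field_at B (f p) (push_field A B f h X)"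
proof -
  let ?D = "B (f p)" and ?C = "A p"
  note cC = is_chart_atlas[OF A, of p] in_atlas[OF A, of p]
    and cD = is_chart_atlas[OF B, of "f p"] in_atlas[OF B, of "f p"]
  let ?\<phi> = "\<lambda>x. coord ?D (f (param ?C x))" and ?\<psi> = "\<lambda>y. coord ?C (h (param ?D y))"
    and ?\<xi> = "\<lambda>x. to_chart A ?C (param ?C x) (X (param ?C x))"
  have q: "f p \<in> V" and hf: "h (f p) = p" using p diffeo_simps by auto
  have \<psi>0: "?\<psi> (coord ?D (f p)) = coord ?C p" by (simp add: param_coord[OF cD] hf)
  have \<psi>: "smooth_at (coord ?D (f p)) ?\<psi>"
    using diffeo_smooth(2)[OF q] by (simp add: smooth_map_at_def hf)
  have \<phi>: "smooth_at (?\<psi> (coord ?D (f p))) ?\<phi>"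
    using diffeo_smooth(1)[OF p] unfolding \<psi>0 by (simp add: smooth_map_at_def)
  have \<xi>: "smooth_at (?\<psi> (coord ?D (f p))) ?\<xi>"
    using X unfolding \<psi>0 by (simp add: smooth_field_at_def)
  have "smooth_at (coord ?D (f p)) (\<lambda>y. fd ?\<phi> (?\<psi> y) (?\<xi> (?\<psi> y)))"
    by (rule smooth_at_fd_apply[OF \<phi> \<psi> smooth_at_compose[OF \<psi> \<xi>]])
  then show ?thesis unfolding smooth_field_at_def
  proof (rule smooth_at_cong)
    have "\<forall>\<^sub>F y in nhds (f p). h y \<in> cdom ?C"
      using eventually_isCont[OF smooth_map_at_isCont[OF diffeo_smooth(2)[OF q]]]
        eventually_cdom[OF cC] hf by simp
    from eventually_param[OF cD this] eventually_param[OF cD eventually_cdom[OF cD]]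
      eventually_param[OF cD eventually_nhds_in_open[OF diffeo_open(2) q]]
    show "\<forall>\<^sub>F y in nhds (coord ?D (f p)). fd ?\<phi> (?\<psi> y) (?\<xi> (?\<psi> y)) =
        to_chart B ?D (param ?D y) (push_field A B f h X (param ?D y))"
    proof eventually_elim
      case (elim y)
      let ?q = "param ?D y"
      have "to_chart B ?D (f (h ?q)) (tangent_map A B f (h ?q) (X (h ?q))) =
          fd ?\<phi> (coord ?C (h ?q)) (to_chart A ?C (h ?q) (X (h ?q)))"
        using elim diffeo_simps(2,4)[OF elim(3)]
        by (intro tangent_map_chart[OF A B admissible_atlas[OF A] _ admissible_atlas[OF B]] diffeo_smooth)
          auto
      then show ?case
        using elim by (simp add: push_field_def diffeo_simps(4) param_coord[OF cC(1)])
    qed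
  qed
qed

lemma smooth_field_along_push:
  assumes N: "smooth_field_along A S N"
  shows "smooth_field_along B (f ` (S \<inter> U)) (push_field A B f h N)"
  unfolding smooth_field_along_iff[OF B]
proof
  fix q assume "q \<in> f ` (S \<inter> U)"
  then obtain p where p: "p \<in> S" "p \<in> U" "q = f p" by blast
  then obtain X where X: "smooth_field_at A p X" "\<forall>\<^sub>F x in nhds p. x \<in> S \<longrightarrow> N x = X x"
    using N unfolding smooth_field_along_iff[OF A] by meson
  have "\<forall>\<^sub>F y in nhds (f p). h y \<in> S \<longrightarrow> N (h y) = X (h y)"
    using eventually_isCont[OF smooth_map_at_isCont[OF diffeo_smooth(2)], of "f p"] X(2) p diffeo_simps
    by simp
  then have "\<forall>\<^sub>F y in nhds q. y \<in> f ` (S \<inter> U) \<longrightarrow> push_field A B f h N y = push_field A B f h X y"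
    unfolding p(3) by eventually_elim (auto simp: push_field_def diffeo_simps)
  then show "\<exists>X. smooth_field_at B q X \<and>
      (\<forall>\<^sub>F y in nhds q. y \<in> f ` (S \<inter> U) \<longrightarrow> push_field A B f h N y = X y)"
    using smooth_field_at_push[OF p(2) X(1)] p(3) by blast
qed

text \<open>A chart is transported by composing it with the inverse \<open>h\<close>. Slice charts
  of an image are obtained this way directly, without solving any equation.\<close>

lemma admissible_chart_push:
  assumes C: "admissible_chart A C"
  shows "admissible_chart B (f ` (cdom C \<inter> U), coord C \<circ> h)" (is "admissible_chart B ?D")
    and "\<And>x. x \<in> coord C ` (cdom C \<inter> U) \<Longrightarrow>
      inv_into (f ` (cdom C \<inter> U)) (coord C \<circ> h) x = f (param C x)"
proof -
  note iC = admissible_is_chart[OF C]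
  have img: "(coord C \<circ> h) ` f ` (cdom C \<inter> U) = coord C ` (cdom C \<inter> U)"
    using diffeo_simps by (force simp: image_image)
  have dom: "f ` (cdom C \<inter> U) = V \<inter> h -` (cdom C \<inter> U)"
    using diffeo_simps by (force simp: image_iff)
  have conth: "continuous_on V h" and contf: "continuous_on U f"
    using d by (auto simp: diffeo_def smooth_map_on_def)
  have contC: "continuous_on (cdom C) (coord C)" "continuous_on (coord C ` cdom C) (param C)"
    using iC by (simp_all add: is_chart_def homeomorphism_def)
  have open1: "open (f ` (cdom C \<inter> U))"
    unfolding dom using conth diffeo_open open_cdom[OF iC] by (intro continuous_open_preimage) auto
  have open2: "open (coord C ` (cdom C \<inter> U))"
    by (rule open_coord_image_Int[OF iC diffeo_open(1)])
  have inj: "inj_on (coord C \<circ> h) (f ` (cdom C \<inter> U))"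
    using iC diffeo_simps unfolding is_chart_def inj_on_def by force
  show par: "inv_into (f ` (cdom C \<inter> U)) (coord C \<circ> h) x = f (param C x)"
    if "x \<in> coord C ` (cdom C \<inter> U)" for x
  proof (rule inv_into_f_eq[OF inj])
    show "f (param C x) \<in> f ` (cdom C \<inter> U)" using that by (auto simp: param_coord[OF iC])
    show "(coord C \<circ> h) (f (param C x)) = x"
      using that by (auto simp: param_coord[OF iC] diffeo_simps)
  qed
  have chart: "is_chart ?D"
    unfolding is_chart_def fst_conv snd_conv img
  proof (intro conjI open1 open2 inj)
    have c1: "continuous_on (f ` (cdom C \<inter> U)) (coord C \<circ> h)"
    proof (rule continuous_on_compose)
      show "continuous_on (f ` (cdom C \<inter> U)) h"
        by (rule continuous_on_subset[OF conth]) (simp add: dom)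
      show "continuous_on (h ` f ` (cdom C \<inter> U)) (coord C)"
        by (rule continuous_on_subset[OF contC(1)]) (auto simp: diffeo_simps)
    qed
    have "continuous_on (coord C ` (cdom C \<inter> U)) (\<lambda>x. f (param C x))"
    proof (rule continuous_on_compose2[OF contf])
      show "continuous_on (coord C ` (cdom C \<inter> U)) (param C)"
        by (rule continuous_on_subset[OF contC(2)]) auto
    qed (auto simp: param_coord[OF iC])
    then have c2: "continuous_on (coord C ` (cdom C \<inter> U)) (inv_into (f ` (cdom C \<inter> U)) (coord C \<circ> h))"
      using par by (simp cong: continuous_on_cong)
    show "homeomorphism (f ` (cdom C \<inter> U)) (coord C ` (cdom C \<inter> U)) (coord C \<circ> h)
        (inv_into (f ` (cdom C \<inter> U)) (coord C \<circ> h))"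
      unfolding homeomorphism_def
    proof (intro conjI c1 c2 ballI)
      show "inv_into (f ` (cdom C \<inter> U)) (coord C \<circ> h) ((coord C \<circ> h) x) = x"
        if "x \<in> f ` (cdom C \<inter> U)" for x using inj that by (rule inv_into_f_f)
      then show "inv_into (f ` (cdom C \<inter> U)) (coord C \<circ> h) ` coord C ` (cdom C \<inter> U) = f ` (cdom C \<inter> U)"
        unfolding img[symmetric] by force
      show "(coord C \<circ> h) (inv_into (f ` (cdom C \<inter> U)) (coord C \<circ> h) y) = y"
        if "y \<in> coord C ` (cdom C \<inter> U)" for y
        using that unfolding img[symmetric] by (rule f_inv_into_f)
    qed (use img in blast)
  qed
  have comp: "compatible ?D (B q)" for q
    unfolding compatible_def fst_conv snd_conv
  proof
    note iB = is_chart_atlas[OF B, of q]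
    show "smooth_on ((coord C \<circ> h) ` (f ` (cdom C \<inter> U) \<inter> cdom (B q)))
        (coord (B q) \<circ> inv_into (f ` (cdom C \<inter> U)) (coord C \<circ> h))"
    proof (rule smooth_onI)
      fix x assume "x \<in> (coord C \<circ> h) ` (f ` (cdom C \<inter> U) \<inter> cdom (B q))"
      then obtain p where p: "p \<in> cdom C" "p \<in> U" "f p \<in> cdom (B q)" "x = coord C p"
        using diffeo_simps by auto
      have "smooth_at x (\<lambda>x. coord (B q) (f (param C x)))"
        using smooth_map_at_chart[OF A B C admissible_atlas[OF B] p(1,3) diffeo_smooth(1)[OF p(2)]] p(4)
        by simp
      then show "smooth_at x (coord (B q) \<circ> inv_into (f ` (cdom C \<inter> U)) (coord C \<circ> h))"
      proof (rule smooth_at_cong)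
        show "\<forall>\<^sub>F x in nhds x. coord (B q) (f (param C x)) =
            (coord (B q) \<circ> inv_into (f ` (cdom C \<inter> U)) (coord C \<circ> h)) x"
          using eventually_nhds_in_open[OF open2, of x] p
          by (auto simp: par elim: eventually_mono)
      qed
    qed
    show "smooth_on (coord (B q) ` (f ` (cdom C \<inter> U) \<inter> cdom (B q))) ((coord C \<circ> h) \<circ> param (B q))"
      using diffeo_simps
      by (auto intro!: smooth_onI smooth_map_at_chart[OF B A admissible_atlas[OF B] C] diffeo_smooth
          simp: o_def)
  qed
  show "admissible_chart B ?D" using chart comp by (simp add: admissible_chart_def)
qed

lemma hypersurface_image:
  assumes S: "hypersurface A S"
  shows "hypersurface B (f ` (S \<inter> U))"
  unfolding hypersurface_def
proof
  fix q assume "q \<in> f ` (S \<inter> U)"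
  then obtain p where p: "p \<in> S" "p \<in> U" "q = f p" by blast
  then obtain C b where C: "admissible_chart A C" "p \<in> cdom C" "b \<noteq> 0"
    "coord C ` (cdom C \<inter> S) = coord C ` cdom C \<inter> {x. x \<bullet> b = 0}"
    using S unfolding hypersurface_def by blast
  let ?D = "(f ` (cdom C \<inter> U), coord C \<circ> h)"
  have inj: "inj_on (coord C) (cdom C)" using admissible_is_chart[OF C(1)] by (simp add: is_chart_def)
  have img: "(coord C \<circ> h) ` f ` X = coord C ` X" if "X \<subseteq> U" for X
    using diffeo_simps that by (force simp: image_image)
  \<comment> \<open>Injectivity of \<open>f\<close> on \<open>U\<close> makes image and intersection
    commute; the normal vector \<open>b\<close> of the slice can then be kept unchanged.\<close>
  have "f ` (cdom C \<inter> U) \<inter> f ` (S \<inter> U) = f ` (cdom C \<inter> U \<inter> S)"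
    using diffeo_simps by (auto; metis IntI image_eqI)
  then have "coord ?D ` (cdom ?D \<inter> f ` (S \<inter> U)) = coord C ` (cdom C \<inter> U \<inter> S)"
    using img[of "cdom C \<inter> U \<inter> S"] by auto
  also have "\<dots> = coord C ` (cdom C \<inter> U) \<inter> coord C ` (cdom C \<inter> S)"
    using inj by (auto simp: inj_on_def image_iff; metis)
  also have "\<dots> = coord ?D ` cdom ?D \<inter> {x. x \<bullet> b = 0}"
    using C(4) img[of "cdom C \<inter> U"] by auto
  finally show "\<exists>C b. admissible_chart B C \<and> q \<in> cdom C \<and> b \<noteq> 0 \<and>
      coord C ` (cdom C \<inter> f ` (S \<inter> U)) = coord C ` cdom C \<inter> {x. x \<bullet> b = 0}"
    using C p by (intro exI[of _ ?D] exI[of _ b]) (auto intro: admissible_chart_push)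
qed

lemma tangent_space_image:
  assumes S: "S \<subseteq> U" and p: "p \<in> S"
  shows "tangent_space B (f ` S) (f p) = tangent_map A B f p ` tangent_space A S p"
proof
  have pU: "p \<in> U" using assms by blast
  show "tangent_map A B f p ` tangent_space A S p \<subseteq> tangent_space B (f ` S) (f p)"
    using curve_through_map[OF A B _ diffeo_smooth(1)[OF pU] order_refl]
    by (auto simp: tangent_space_def)
  show "tangent_space B (f ` S) (f p) \<subseteq> tangent_map A B f p ` tangent_space A S p"
  proof
    fix w assume "w \<in> tangent_space B (f ` S) (f p)"
    then obtain c where c: "curve_through B (f ` S) (f p) w c" by (auto simp: tangent_space_def)
    have fp: "f p \<in> V" "h (f p) = p" using pU diffeo_simps by auto
    have hS: "h ` f ` S \<subseteq> S" using S diffeo_simps by (auto simp: subset_iff)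
    have hc: "curve_through A S p (tangent_map B A h (f p) w) (\<lambda>t. h (c t))"
      using curve_through_map[OF B A c diffeo_smooth(2)[OF fp(1)] hS] fp by simp
    \<comment> \<open>The curve runs inside the image of \<open>S\<close>, so pulling it back and
      pushing it again returns the same curve, and uniqueness of its velocity identifies the two
      tangent vectors.\<close>
    have "(\<lambda>t. f (h (c t))) = c"
    proof
      fix t
      obtain s where "s \<in> S" "c t = f s" using curve_in[OF c, of t] by blast
      then show "f (h (c t)) = c t" using S diffeo_simps(3)[of s] by auto
    qed
    then have "curve_through B (f ` S) (f p) (tangent_map A B f p (tangent_map B A h (f p) w)) c"
      using curve_through_map[OF A B hc diffeo_smooth(1)[OF pU] order_refl] by simp
    then have "tangent_map A B f p (tangent_map B A h (f p) w) = w"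
      using c vector_derivative_unique_at[of "coord (B (f p)) \<circ> c" _ 0 w]
      unfolding curve_through_def by blast
    moreover have "tangent_map B A h (f p) w \<in> tangent_space A S p"
      using hc by (auto simp: tangent_space_def)
    ultimately show "w \<in> tangent_map A B f p ` tangent_space A S p" by (metis imageI)
  qed
qed

end

text \<open>The identity counts as a diffeomorphism of \<open>W\<close> with itself, so intersecting
  a hypersurface with an open set becomes a case of \<open>hypersurface_image\<close>.\<close>

lemma diffeo_restrict: "smooth_atlas A \<Longrightarrow> open W \<Longrightarrow> diffeo A A W W (\<lambda>x. x) (\<lambda>x. x)"
  by (simp add: diffeo_def smooth_map_on_iff smooth_map_at_ident)

lemma hypersurface_Int_open:
  assumes "smooth_atlas A" "hypersurface A S" "open W"
  shows "hypersurface A (S \<inter> W)"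
  using hypersurface_image[OF assms(1,1) diffeo_restrict[OF assms(1,3)] assms(2)] by simp

section \<open>Tangent spaces of hypersurfaces\<close>

lemma curve_through_subset: "curve_through A S p v c \<Longrightarrow> S \<subseteq> S' \<Longrightarrow> curve_through A S' p v c"
  by (auto simp: curve_through_def)

lemma tangent_space_slice:
  assumes A: "smooth_atlas A" and C: "admissible_chart A C" "p \<in> cdom C" and p: "p \<in> S"
    and slice: "coord C ` (cdom C \<inter> S) = coord C ` cdom C \<inter> {x. x \<bullet> b = 0}"
  shows "tangent_space A S p = {v. to_chart A C p v \<bullet> b = 0}"
proof (intro equalityI subsetI CollectI)
  note cA = is_chart_atlas[OF A, of p] in_atlas[OF A, of p] and iC = admissible_is_chart[OF C(1)]
  {
    fix v assume "v \<in> tangent_space A S p"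
    then obtain c where c: "curve_through A S p v c" by (auto simp: tangent_space_def)
    have "((\<lambda>t. coord C (param (A p) (coord (A p) (c t))) \<bullet> b) has_vector_derivative to_chart A C p v \<bullet> b) (at 0)"
      using curve_coordinate_derivative[OF c transition_smooth_atlas(2)[OF A C cA(2)]]
      by (auto simp: to_chart_eq intro: bounded_linear.has_vector_derivative[OF bounded_linear_inner_left])
    moreover have "\<forall>\<^sub>F t in nhds 0. coord C (param (A p) (coord (A p) (c t))) \<bullet> b = 0"
      using curve_eventually[OF c eventually_cdom[OF cA]] curve_eventually[OF c eventually_cdom[OF iC C(2)]]
    proof eventually_elim
      case (elim t)
      then show ?case using slice curve_in[OF c, of t] by (auto simp: param_coord[OF cA(1)])
    qed
    ultimately have "((\<lambda>t. 0::real) has_vector_derivative to_chart A C p v \<bullet> b) (at 0)"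
      by (rule has_vector_derivative_transfer)
    then show "to_chart A C p v \<bullet> b = 0"
      using vector_derivative_unique_at[OF _ has_vector_derivative_const] by blast
  }
  fix v assume "v \<in> {v. to_chart A C p v \<bullet> b = 0}"
  then have w0: "to_chart A C p v \<bullet> b = 0" by simp
  define w where "w = to_chart A C p v"
  \<comment> \<open>The candidate curve is a straight line in the slice chart, which stays in the
    hyperplane orthogonal to \<open>b\<close>.\<close>
  define l where "l t = coord C p + t *\<^sub>R w" for t :: real
  have lin: "isCont l 0" "l 0 = coord C p" unfolding l_def by (auto intro!: continuous_intros)
  have ld: "(l has_derivative (\<lambda>t. t *\<^sub>R w)) (at 0)"
    unfolding l_def by (auto intro!: derivative_eq_intros)
  define G where "G = {t. l t \<in> coord C ` cdom C}"
  have ev: "\<forall>\<^sub>F t in nhds 0. t \<in> G"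
    using eventually_isCont[OF lin(1)] eventually_coord_image[OF iC C(2)] by (simp add: lin(2) G_def)
  have "coord C p \<bullet> b = 0" using slice p C(2) by auto
  then have l0: "l t \<bullet> b = 0" for t using w0 by (simp add: l_def w_def inner_add_left)
  \<comment> \<open>\<open>curve_through\<close> demands \<open>range c \<subseteq> S\<close>, so at
    parameters where the line has left the chart the curve takes the default value \<open>p\<close>;
    the germ at 0 is unaffected.\<close>
  define c where "c t = (if t \<in> G then param C (l t) else p)" for t
  have cS: "c t \<in> S" for t
  proof (cases "t \<in> G")
    case True
    then have "l t \<in> coord C ` (cdom C \<inter> S)" using slice l0 by (auto simp: G_def)
    then show ?thesis using True by (auto simp: c_def param_coord[OF iC])
  qed (simp add: c_def p)
  have evc: "\<forall>\<^sub>F t in nhds 0. param C (l t) = c t"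
    using ev by eventually_elim (simp add: c_def)
  have "isCont c 0"
    using isCont_o2[OF lin(1), of "param C"] isCont_param[OF iC C(2)]
    by (intro isCont_transfer[OF _ evc]) (simp add: lin(2))
  moreover have "c 0 = p" using C(2) by (simp add: c_def lin(2) param_coord[OF iC])
  moreover have "((\<lambda>t. coord (A p) (param C (l t))) has_vector_derivative v) (at 0)"
  proof -
    have s: "smooth_at (l 0) (\<lambda>x. coord (A p) (param C x))"
      using transition_smooth_atlas(1)[OF A C cA(2)] lin(2) by simp
    have "from_chart A C p w = v" unfolding w_def by (rule from_to_chart[OF A C])
    then show ?thesis
      using diff_chain_at[OF ld smooth_at_has_derivative[OF s]] smooth_at_linear_fd[OF s]
      by (simp add: has_vector_derivative_def o_def linear_scale from_chart_def lin(2))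
  qed
  then have "((\<lambda>t. coord (A p) (c t)) has_vector_derivative v) (at 0)"
    by (rule has_vector_derivative_transfer) (use evc in \<open>auto elim: eventually_mono\<close>)
  ultimately have "curve_through A S p v c"
    using cS by (auto simp: curve_through_def o_def)
  then show "v \<in> tangent_space A S p" by (auto simp: tangent_space_def)
qed

text \<open>Kernels of nonzero functionals have codimension one, so an inclusion between two of them
  is an equality: any \<open>v\<close> is corrected by a multiple of \<open>w\<close> to land in the
  smaller kernel.\<close>

lemma kernel_eqI:
  assumes "linear l" "linear l'" "{v. l v = 0} \<subseteq> {v. l' v = (0::real)}" "l' w \<noteq> 0"
  shows "{v. l v = (0::real)} = {v. l' v = 0}"
proof
  have lw: "l w \<noteq> 0" using assms(3,4) by auto
  show "{v. l' v = 0} \<subseteq> {v. l v = 0}"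
  proof
    fix v assume v: "v \<in> {v. l' v = 0}"
    have "l (v - (l v / l w) *\<^sub>R w) = 0"
      using lw by (simp add: linear_diff[OF assms(1)] linear_scale[OF assms(1)])
    then have "l' (v - (l v / l w) *\<^sub>R w) = 0" using assms(3) by blast
    then have "l v / l w * l' w = 0"
      using v by (simp add: linear_diff[OF assms(2)] linear_scale[OF assms(2)])
    then show "v \<in> {v. l v = 0}" using assms(4) lw by simp
  qed
qed (use assms(3) in blast)

lemma metric_linear:
  assumes "riemannian_metric A g"
  shows "linear (g p u)" "linear (\<lambda>u. g p u v)"
  using assms by (auto simp: riemannian_metric_def bilinear_def)

lemma metric_commute: "riemannian_metric A g \<Longrightarrow> g p u v = g p v u"
  by (simp add: riemannian_metric_def)

lemma metric_simps:
  assumes "riemannian_metric A g"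
  shows "g p (u + u') v = g p u v + g p u' v" "g p v (u + u') = g p v u + g p v u'"
    "g p (u - u') v = g p u v - g p u' v" "g p v (u - u') = g p v u - g p v u'"
    "g p (r *\<^sub>R u) v = r * g p u v" "g p v (r *\<^sub>R u) = r * g p v u"
    "g p (- u) v = - g p u v" "g p v (- u) = - g p v u" "g p 0 v = 0" "g p v 0 = 0"
  using metric_linear(1)[OF assms, of p v] linear_diff[OF metric_linear(2)[OF assms, of p v]]
    linear_neg[OF metric_linear(2)[OF assms, of p v]] linear_0[OF metric_linear(2)[OF assms, of p v]]
    linear_add[OF metric_linear(2)[OF assms, of p v]] linear_scale[OF metric_linear(2)[OF assms, of p v]]
  by (auto simp: linear_add linear_diff linear_scale linear_0 linear_neg)

lemma metric_pos: "riemannian_metric A g \<Longrightarrow> v \<noteq> 0 \<Longrightarrow> g p v v > 0"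
  by (simp add: riemannian_metric_def)

lemma metric_eq_0_iff: "riemannian_metric A g \<Longrightarrow> g p v v = 0 \<longleftrightarrow> v = 0"
  using metric_pos[of A g v p] metric_simps(9)[of A g] by fastforce

text \<open>A slice chart makes the tangent space a hyperplane, and \<open>N p\<close> is orthogonal
  to it but not to itself; the resulting inclusion of hyperplanes is an equality. The traces below
  are all taken on such kernels.\<close>

lemma tangent_space_eq_normal_complement:
  assumes A: "smooth_atlas A" and g: "riemannian_metric A g" and S: "hypersurface A S"
    and N: "unit_normal_field A g S N" and p: "p \<in> S"
  shows "tangent_space A S p = {v. g p (N p) v = 0}"
proof -
  obtain C b where C: "admissible_chart A C" "p \<in> cdom C"
    "coord C ` (cdom C \<inter> S) = coord C ` cdom C \<inter> {x. x \<bullet> b = 0}"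
    using S p unfolding hypersurface_def by blast
  note T = tangent_space_slice[OF A C(1,2) p C(3)]
  have "linear (\<lambda>v. to_chart A C p v \<bullet> b)"
    using linear_to_chart[OF A C(1,2)] by (simp add: linear_iff inner_add_left)
  then show ?thesis unfolding T
  proof (rule kernel_eqI)
    show "linear (g p (N p))" by (rule metric_linear[OF g])
    show "{v. to_chart A C p v \<bullet> b = 0} \<subseteq> {v. g p (N p) v = 0}"
      using N p T unfolding unit_normal_field_def by auto
    show "g p (N p) (N p) \<noteq> 0" using N p by (simp add: unit_normal_field_def)
  qed
qed

lemma tangent_space_mono: "S \<subseteq> S' \<Longrightarrow> tangent_space A S p \<subseteq> tangent_space A S' p"
  unfolding tangent_space_def using curve_through_subset[of A S p _ _ S'] by auto

lemma smooth_field_along_subset: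
  assumes N: "smooth_field_along A S N" and S: "S' \<subseteq> S"
  shows "smooth_field_along A S' N"
  unfolding smooth_field_along_def
proof
  fix p assume "p \<in> S'"
  then have "p \<in> S" using S by blast
  then obtain W X where "p \<in> W" "smooth_vector_field_on A W X" "\<forall>q\<in>S \<inter> W. N q = X q"
    using N unfolding smooth_field_along_def by meson
  then show "\<exists>W X. p \<in> W \<and> smooth_vector_field_on A W X \<and> (\<forall>q\<in>S' \<inter> W. N q = X q)"
    using S by (intro exI[of _ W] exI[of _ X]) auto
qed

lemma unit_normal_field_subset:
  "unit_normal_field A g S N \<Longrightarrow> S' \<subseteq> S \<Longrightarrow> unit_normal_field A g S' N"
  unfolding unit_normal_field_def
  using smooth_field_along_subset[of A S N S'] tangent_space_mono[of S' S A]
  by (auto simp: subset_iff)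

section \<open>The product with the real line\<close>

lemma smooth_at_compose_fst:
  fixes F :: "'a::euclidean_space \<Rightarrow> 'c::real_normed_vector"
  shows "smooth_at (fst z) F \<Longrightarrow> smooth_at z (\<lambda>x. F (fst x))"
  by (rule smooth_at_compose[OF smooth_at_fst[OF smooth_at_ident]])

lemma fd_fst: "fd fst x = fst" and fd_snd: "fd snd x = snd"
  by (rule fd_eq, rule bounded_linear_imp_has_derivative, rule bounded_linear_fst bounded_linear_snd)+

text \<open>Formed for an arbitrary chart and not only for \<open>A p\<close>, because slice charts
  of a hypersurface are merely admissible.\<close>

definition product_chart :: "('m, 'e) chart \<Rightarrow> ('m \<times> real, 'e \<times> real) chart" where
  "product_chart C = (cdom C \<times> UNIV, \<lambda>y. (coord C (fst y), snd y))"

lemma product_atlas_eq: "product_atlas A z = product_chart (A (fst z))"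
  by (simp add: product_atlas_def product_chart_def)

lemma cdom_product_chart: "cdom (product_chart C) = cdom C \<times> UNIV"
  by (simp add: product_chart_def)

lemma in_cdom_product_chart [simp]: "z \<in> cdom (product_chart C) \<longleftrightarrow> fst z \<in> cdom C"
  and coord_product_chart [simp]: "coord (product_chart C) y = (coord C (fst y), snd y)"
  by (auto simp: product_chart_def mem_Times_iff)

lemma coord_image_product_chart:
  "coord (product_chart C) ` (X \<times> UNIV) = coord C ` X \<times> UNIV"
  by (auto simp: product_chart_def image_iff)

lemma inj_on_product_chart:
  assumes "is_chart C"
  shows "inj_on (coord (product_chart C)) (cdom (product_chart C))"
  using assms by (auto simp: inj_on_def is_chart_def)

lemma param_product_chart:
  fixes C :: "('m::t2_space, 'e::euclidean_space) chart"
  assumes C: "is_chart C" and x: "fst x \<in> coord C ` cdom C"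
  shows "param (product_chart C) x = (param C (fst x), snd x)"
  by (rule inv_into_f_eq[OF inj_on_product_chart[OF C]])
    (use x in \<open>auto simp: param_coord[OF C] prod_eq_iff\<close>)

lemma is_chart_product_chart:
  fixes C :: "('m::t2_space, 'e::euclidean_space) chart"
  assumes C: "is_chart C"
  shows "is_chart (product_chart C)"
proof -
  have cont: "continuous_on (cdom C) (coord C)" "continuous_on (coord C ` cdom C) (param C)"
    using C by (simp_all add: is_chart_def homeomorphism_def)
  have img: "coord (product_chart C) ` cdom (product_chart C) = coord C ` cdom C \<times> UNIV"
    by (simp add: cdom_product_chart coord_image_product_chart del: coord_product_chart)
  have c1: "continuous_on (cdom (product_chart C)) (coord (product_chart C))"
    unfolding product_chart_def snd_conv fst_conv
    by (intro continuous_on_Pair continuous_on_compose2[OF cont(1)] continuous_on_fst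
        continuous_on_snd continuous_on_id) auto
  have "continuous_on (coord C ` cdom C \<times> UNIV) (\<lambda>x. (param C (fst x), snd x))"
    by (intro continuous_on_Pair continuous_on_compose2[OF cont(2)] continuous_on_fst
        continuous_on_snd continuous_on_id) auto
  then have c2: "continuous_on (coord C ` cdom C \<times> UNIV) (param (product_chart C))"
    by (rule continuous_on_eq) (simp add: param_product_chart[OF C] mem_Times_iff)
  have inv: "param (product_chart C) (coord (product_chart C) z) = z" if "z \<in> cdom (product_chart C)" for z
    using inj_on_product_chart[OF C] that by (rule inv_into_f_f)
  have open1: "open (cdom (product_chart C))" and open2: "open (coord C ` cdom C \<times> (UNIV :: real set))"
    using C by (auto simp: is_chart_def cdom_product_chart intro: open_Times)
  have "param (product_chart C) ` (coord C ` cdom C \<times> UNIV) = cdom (product_chart C)"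
    unfolding img[symmetric] image_image using inv by (rule image_cong[OF refl, THEN trans]) auto
  moreover have "coord (product_chart C) (param (product_chart C) y) = y"
    if "y \<in> coord C ` cdom C \<times> UNIV" for y
    using that unfolding img[symmetric] by (rule f_inv_into_f)
  ultimately have "homeomorphism (cdom (product_chart C)) (coord C ` cdom C \<times> UNIV)
      (coord (product_chart C)) (param (product_chart C))"
    unfolding homeomorphism_def using inv img c1 c2 by blast
  then show ?thesis
    unfolding is_chart_def img using open1 open2 inj_on_product_chart[OF C] by blast
qed

lemma transition_product_chart:
  fixes C :: "('m::t2_space, 'e::euclidean_space) chart"
  assumes C: "is_chart C" and s: "smooth_at (coord C (fst z)) (\<lambda>x. coord D (param C x))"
    and z: "fst z \<in> cdom C"
  shows "smooth_at (coord (product_chart C) z) (\<lambda>x. coord (product_chart D) (param (product_chart C) x))"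
proof (rule smooth_at_cong)
  show "smooth_at (coord (product_chart C) z) (\<lambda>x. (coord D (param C (fst x)), snd x))"
    using smooth_at_compose_fst[of "coord (product_chart C) z" "\<lambda>x. coord D (param C x)"] s
    by (intro smooth_at_Pair smooth_at_snd smooth_at_ident) simp
  have "\<forall>\<^sub>F x in nhds (coord (product_chart C) z). fst x \<in> coord C ` cdom C"
    using eventually_coord_image[OF is_chart_product_chart[OF C], of z] z
    by (auto elim!: eventually_mono)
  then show "\<forall>\<^sub>F x in nhds (coord (product_chart C) z). (coord D (param C (fst x)), snd x) =
      coord (product_chart D) (param (product_chart C) x)"
    by eventually_elim (simp add: param_product_chart[OF C])
qed

lemma compatible_product_chart:
  fixes C D :: "('m::t2_space, 'e::euclidean_space) chart"
  assumes C: "is_chart C" and D: "is_chart D" and comp: "compatible C D"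
  shows "compatible (product_chart C) (product_chart D)"
proof -
  have 1: "smooth_on (coord (product_chart C) ` (cdom (product_chart C) \<inter> cdom (product_chart D)))
      (coord (product_chart D) \<circ> param (product_chart C))"
    if C: "is_chart C" and D: "is_chart D"
      and s: "smooth_on (coord C ` (cdom C \<inter> cdom D)) (coord D \<circ> param C)"
    for C D :: "('m, 'e) chart"
  proof (rule smooth_onI)
    fix x assume "x \<in> coord (product_chart C) ` (cdom (product_chart C) \<inter> cdom (product_chart D))"
    then obtain z where z: "fst z \<in> cdom C" "fst z \<in> cdom D" "x = coord (product_chart C) z" by auto
    have "smooth_at (coord C (fst z)) (\<lambda>x. coord D (param C x))"
      using s z open_coord_image_Int[OF C open_cdom[OF D]] by (auto intro: smooth_atI simp: o_def)
    from transition_product_chart[OF C this z(1)]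
    show "smooth_at x (coord (product_chart D) \<circ> param (product_chart C))" by (simp add: z(3) o_def)
  qed
  show ?thesis
    using 1[OF C D] 1[OF D C] comp by (simp add: compatible_def Int_commute)
qed

lemma smooth_atlas_product:
  "smooth_atlas A \<Longrightarrow> smooth_atlas (product_atlas A)"
  by (auto simp: smooth_atlas_def product_atlas_eq mem_Times_iff
      intro: is_chart_product_chart compatible_product_chart)

lemma admissible_product_chart:
  "smooth_atlas A \<Longrightarrow> admissible_chart A C \<Longrightarrow> admissible_chart (product_atlas A) (product_chart C)"
  by (auto simp: admissible_chart_def product_atlas_eq is_chart_atlas
      intro: is_chart_product_chart compatible_product_chart)

text \<open>The product of a slice chart of \<open>S\<close> with the line is a slice chart of the
  cylinder, with hyperplane normal \<open>(b, 0)\<close>.\<close>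

lemma hypersurface_times_UNIV:
  assumes A: "smooth_atlas A" and S: "hypersurface A S"
  shows "hypersurface (product_atlas A) (S \<times> UNIV)"
  unfolding hypersurface_def
proof
  fix z :: "'a \<times> real" assume "z \<in> S \<times> UNIV"
  then obtain C b where C: "admissible_chart A C" "fst z \<in> cdom C" "b \<noteq> 0"
    "coord C ` (cdom C \<inter> S) = coord C ` cdom C \<inter> {x. x \<bullet> b = 0}"
    using S unfolding hypersurface_def by (metis mem_Times_iff)
  have "cdom (product_chart C) \<inter> S \<times> UNIV = (cdom C \<inter> S) \<times> (UNIV :: real set)"
    by (auto simp: cdom_product_chart)
  then have "coord (product_chart C) ` (cdom (product_chart C) \<inter> S \<times> UNIV) =
      coord (product_chart C) ` cdom (product_chart C) \<inter> {x. x \<bullet> (b, 0) = 0}"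
    unfolding cdom_product_chart coord_image_product_chart using C(4)
    by (auto simp: coord_image_product_chart simp del: coord_product_chart)
  then show "\<exists>C b. admissible_chart (product_atlas A) C \<and> z \<in> cdom C \<and> b \<noteq> 0 \<and>
      coord C ` (cdom C \<inter> S \<times> UNIV) = coord C ` cdom C \<inter> {x. x \<bullet> b = 0}"
    using C by (intro exI[of _ "product_chart C"] exI[of _ "(b, 0)"])
      (auto simp: admissible_product_chart[OF A] mem_Times_iff zero_prod_def)
qed

lemma smooth_map_at_const_real: "smooth_atlas A \<Longrightarrow> smooth_map_at A real_atlas p (\<lambda>_. r)"
  and tangent_map_const_real: "tangent_map A real_atlas (\<lambda>_. r) p v = 0"
  by (rule smooth_map_at_realI[OF _ admissible_atlas in_atlas], simp_all)
    (simp add: tangent_map_def real_atlas_def o_def)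

lemma fd_Pair: "smooth_at x f \<Longrightarrow> smooth_at x g \<Longrightarrow> fd (\<lambda>x. (f x, g x)) x v = (fd f x v, fd g x v)"
  using fd_eq[OF has_derivative_Pair[OF smooth_at_has_derivative smooth_at_has_derivative]] by metis

lemma smooth_map_at_Pair:
  assumes f: "smooth_map_at D A p f" and r: "smooth_map_at D real_atlas p r"
  shows "smooth_map_at D (product_atlas A) p (\<lambda>x. (f x, r x))"
    and "tangent_map D (product_atlas A) (\<lambda>x. (f x, r x)) p v =
      (tangent_map D A f p v, tangent_map D real_atlas r p v)"
proof -
  have s: "smooth_at (coord (D p) p) (\<lambda>x. coord (A (f p)) (f (param (D p) x)))"
    "smooth_at (coord (D p) p) (\<lambda>x. r (param (D p) x))"
    using f r by (auto simp: smooth_map_at_def real_atlas_def)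
  show "smooth_map_at D (product_atlas A) p (\<lambda>x. (f x, r x))"
    using f r smooth_at_Pair[OF s]
    by (auto simp: smooth_map_at_def product_atlas_eq intro: isCont_Pair)
  show "tangent_map D (product_atlas A) (\<lambda>x. (f x, r x)) p v =
      (tangent_map D A f p v, tangent_map D real_atlas r p v)"
    using fd_Pair[OF s] by (simp add: tangent_map_def product_atlas_eq o_def real_atlas_def)
qed

lemma product_chart_eventually:
  assumes A: "smooth_atlas A"
  shows "\<forall>\<^sub>F x in nhds (coord (product_atlas A z) z).
    param (product_atlas A z) x = (param (A (fst z)) (fst x), snd x) \<and>
    fst x \<in> coord (A (fst z)) ` cdom (A (fst z))"
proof -
  note P = smooth_atlas_product[OF A]
  from eventually_coord_image[OF is_chart_atlas[OF P] in_atlas[OF P], of z]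
  show ?thesis
    by eventually_elim
      (auto simp: product_atlas_eq param_product_chart[OF is_chart_atlas[OF A]])
qed

lemma smooth_map_at_fst:
  assumes A: "smooth_atlas A"
  shows "smooth_map_at (product_atlas A) A z fst" "tangent_map (product_atlas A) A fst z v = fst v"
proof -
  have s: "smooth_at (coord (product_atlas A z) z) fst"
    by (simp add: smooth_at_fst)
  have ev: "\<forall>\<^sub>F x in nhds (coord (product_atlas A z) z).
      fst x = coord (A (fst z)) (fst (param (product_atlas A z) x))"
    using product_chart_eventually[OF A] by eventually_elim (auto simp: coord_param)
  show "smooth_map_at (product_atlas A) A z fst"
    using smooth_at_cong[OF s ev] by (auto simp: smooth_map_at_def intro: continuous_intros)
  show "tangent_map (product_atlas A) A fst z v = fst v"
    using fd_cong[OF ev, symmetric] by (simp add: tangent_map_def o_def fd_fst)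
qed

lemma smooth_map_at_snd:
  assumes A: "smooth_atlas A"
  shows "smooth_map_at (product_atlas A) real_atlas z snd"
    "tangent_map (product_atlas A) real_atlas snd z v = snd v"
proof -
  have s: "smooth_at (coord (product_atlas A z) z) snd"
    by (simp add: smooth_at_snd)
  have ev: "\<forall>\<^sub>F x in nhds (coord (product_atlas A z) z). snd x = snd (param (product_atlas A z) x)"
    using product_chart_eventually[OF A] by eventually_elim auto
  show "smooth_map_at (product_atlas A) real_atlas z snd"
    using smooth_at_cong[OF s ev] by (auto simp: smooth_map_at_def real_atlas_def intro: continuous_intros)
  show "tangent_map (product_atlas A) real_atlas snd z v = snd v"
    using fd_cong[OF ev, symmetric] by (simp add: tangent_map_def o_def real_atlas_def fd_snd)
qed

lemma smooth_map_at_affine: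
  assumes A: "smooth_atlas A" and h: "smooth_map_at A real_atlas p h"
  shows "smooth_map_at A real_atlas p (\<lambda>x. a * h x + b)"
    "tangent_map A real_atlas (\<lambda>x. a * h x + b) p v = a * tangent_map A real_atlas h p v"
proof -
  have s: "smooth_at (coord (A p) p) (\<lambda>x. h (param (A p) x))"
    by (rule smooth_map_at_realD[OF A admissible_atlas[OF A] in_atlas[OF A] h])
  show "smooth_map_at A real_atlas p (\<lambda>x. a * h x + b)"
    by (intro smooth_map_at_realI[OF A admissible_atlas[OF A] in_atlas[OF A]]
        smooth_at_add smooth_at_mult s smooth_at_const)
  have "((\<lambda>x. a * h (param (A p) x) + b) has_derivative
      (\<lambda>v. a * fd (\<lambda>x. h (param (A p) x)) (coord (A p) p) v)) (at (coord (A p) p))"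
    using smooth_at_has_derivative[OF s] by (auto intro!: derivative_eq_intros)
  from fd_eq[OF this] show "tangent_map A real_atlas (\<lambda>x. a * h x + b) p v = a * tangent_map A real_atlas h p v"
    by (simp add: tangent_map_def o_def real_atlas_def)
qed

lemma to_chart_product:
  assumes A: "smooth_atlas A" and C: "admissible_chart A C" "fst z \<in> cdom C"
  shows "to_chart (product_atlas A) (product_chart C) z v = (to_chart A C (fst z) (fst v), snd v)"
proof -
  have t: "smooth_at (coord (A (fst z)) (fst z)) (\<lambda>x. coord C (param (A (fst z)) x))"
    by (rule transition_smooth_atlas(2)[OF A C in_atlas[OF A]])
  have s: "smooth_at (coord (product_atlas A z) z) (\<lambda>x. coord C (param (A (fst z)) (fst x)))"
    using smooth_at_compose_fst[of "coord (product_atlas A z) z" "\<lambda>x. coord C (param (A (fst z)) x)"] t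
    by (simp add: product_atlas_eq)
  have "to_chart (product_atlas A) (product_chart C) z v =
      fd (\<lambda>x. (coord C (param (A (fst z)) (fst x)), snd x)) (coord (product_atlas A z) z) v"
    unfolding to_chart_eq
    by (rule fun_cong[OF fd_cong], rule eventually_mono[OF product_chart_eventually[OF A, of z]]) auto
  also have "\<dots> = (fd (\<lambda>x. coord C (param (A (fst z)) (fst x))) (coord (product_atlas A z) z) v,
      fd snd (coord (product_atlas A z) z) v)"
    by (rule fd_Pair[OF s]) (simp add: smooth_at_snd)
  also have "fd (\<lambda>x. coord C (param (A (fst z)) (fst x))) (coord (product_atlas A z) z) v =
      fd (\<lambda>x. coord C (param (A (fst z)) x)) (coord (A (fst z)) (fst z))
        (fd fst (coord (product_atlas A z) z) v)"
    using fd_compose[of "coord (product_atlas A z) z" fst "\<lambda>x. coord C (param (A (fst z)) x)" v] t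
    by (simp add: product_atlas_eq smooth_at_fst)
  finally show ?thesis
    by (simp add: to_chart_eq fd_fst fd_snd)
qed

lemma from_chart_product:
  assumes A: "smooth_atlas A" and C: "admissible_chart A C" "fst z \<in> cdom C"
  shows "from_chart (product_atlas A) (product_chart C) z v = (from_chart A C (fst z) (fst v), snd v)"
proof -
  let ?w = "(from_chart A C (fst z) (fst v), snd v)"
  have "to_chart (product_atlas A) (product_chart C) z ?w = v"
    by (simp add: to_chart_product[OF assms] to_from_chart[OF A C])
  then show ?thesis
    using from_to_chart[OF smooth_atlas_product[OF A] admissible_product_chart[OF A C(1)], of z ?w] C(2)
    by (simp add: mem_Times_iff)
qed

lemma metric_in_product_chart:
  assumes A: "smooth_atlas A" and C: "admissible_chart A C" "fst y \<in> coord C ` cdom C"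
  shows "metric_in_chart (product_atlas A) (product_metric g) (product_chart C) y v w =
    metric_in_chart A g C (fst y) (fst v) (fst w) + snd v * snd w"
proof -
  note iC = admissible_is_chart[OF C(1)]
  have "fst (param C (fst y), snd y) \<in> cdom C" using C(2) by (auto simp: param_coord[OF iC])
  note from_chart_product[OF A C(1) this]
  then show ?thesis
    using param_product_chart[OF iC C(2)]
    by (simp add: metric_in_chart_def product_metric_def)
qed

lemma riemannian_metric_product:
  assumes A: "smooth_atlas A" and g: "riemannian_metric A g"
  shows "riemannian_metric (product_atlas A) (product_metric g)"
  unfolding riemannian_metric_def
proof (intro conjI allI impI)
  fix z :: "'a \<times> real"
  show "bilinear (product_metric g z)"
    by (auto simp: bilinear_def linear_iff product_metric_def metric_simps[OF g] algebra_simps)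
  show "product_metric g z v w = product_metric g z w v" for v w
    by (simp add: product_metric_def metric_commute[OF g] mult.commute)
  show "product_metric g z v v > 0" if "v \<noteq> 0" for v
  proof (cases "fst v = 0")
    case True
    then have "snd v \<noteq> 0" using that by (auto simp: prod_eq_iff)
    then have "snd v * snd v > 0" by (metis not_real_square_gt_zero)
    then show ?thesis using True by (simp add: product_metric_def metric_simps[OF g])
  next
    case False
    from metric_pos[OF g this, of "fst z"] show ?thesis
      by (simp add: product_metric_def add_pos_nonneg)
  qed
  fix v w
  let ?C = "A (fst z)"
  have "smooth_at x (\<lambda>x. metric_in_chart (product_atlas A) (product_metric g) (product_chart ?C) x v w)"
    if "x \<in> coord (product_chart ?C) ` cdom (product_chart ?C)" for x
  proof -
    note iC = is_chart_atlas[OF A, of "fst z"]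
    have x: "fst x \<in> coord ?C ` cdom ?C" using that by (auto simp: coord_image_product_chart)
    have op: "open (coord ?C ` cdom ?C)" using open_coord_image_Int[OF iC open_UNIV] by simp
    have "smooth_at (fst x) (\<lambda>x. metric_in_chart A g ?C x (fst v) (fst w))"
      using g x op unfolding riemannian_metric_def by (auto intro: smooth_atI)
    then have "smooth_at x (\<lambda>x. metric_in_chart A g ?C (fst x) (fst v) (fst w) + snd v * snd w)"
      by (intro smooth_at_add smooth_at_const smooth_at_compose_fst)
    then show ?thesis
    proof (rule smooth_at_cong)
      have "\<forall>\<^sub>F y in nhds x. fst y \<in> coord ?C ` cdom ?C"
        using eventually_isCont[of x fst "\<lambda>y. y \<in> coord ?C ` cdom ?C"] eventually_nhds_in_open[OF op x]
        by (simp add: isCont_fst)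
      then show "\<forall>\<^sub>F y in nhds x. metric_in_chart A g ?C (fst y) (fst v) (fst w) + snd v * snd w =
          metric_in_chart (product_atlas A) (product_metric g) (product_chart ?C) y v w"
        by eventually_elim (simp add: metric_in_product_chart[OF A admissible_atlas[OF A]])
    qed
  qed
  then show "smooth_on (coord (product_atlas A z) ` cdom (product_atlas A z))
      (\<lambda>x. metric_in_chart (product_atlas A) (product_metric g) (product_atlas A z) x v w)"
    unfolding product_atlas_eq by (rule smooth_onI)
qed

lemma smooth_field_at_Pair:
  assumes A: "smooth_atlas A" and X: "smooth_field_at A (fst z) X"
  shows "smooth_field_at (product_atlas A) z (\<lambda>y. (X (fst y), r))"
proof -
  let ?C = "A (fst z)"
  have "smooth_at (coord (product_atlas A z) z)
      (\<lambda>x. (to_chart A ?C (param ?C (fst x)) (X (param ?C (fst x))), r))"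
    using smooth_at_compose_fst[of "coord (product_atlas A z) z"
      "\<lambda>x. to_chart A ?C (param ?C x) (X (param ?C x))"] X
    by (intro smooth_at_Pair smooth_at_const) (simp add: smooth_field_at_def product_atlas_eq)
  then show ?thesis unfolding smooth_field_at_def
  proof (rule smooth_at_cong)
    show "\<forall>\<^sub>F x in nhds (coord (product_atlas A z) z).
        (to_chart A ?C (param ?C (fst x)) (X (param ?C (fst x))), r) =
        to_chart (product_atlas A) (product_atlas A z) (param (product_atlas A z) x)
          (X (fst (param (product_atlas A z) x)), r)"
      using product_chart_eventually[OF A]
    proof eventually_elim
      case (elim x)
      then have "fst (param ?C (fst x), snd x) \<in> cdom ?C"
        by (auto simp: param_coord[OF is_chart_atlas[OF A]])
      from to_chart_product[OF A admissible_atlas[OF A] this] elim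
      show ?case by (simp add: product_atlas_eq)
    qed
  qed
qed

lemma smooth_field_along_Pair:
  assumes A: "smooth_atlas A" and X: "smooth_field_along A S X"
  shows "smooth_field_along (product_atlas A) (S \<times> UNIV) (\<lambda>y. (X (fst y), r))"
  unfolding smooth_field_along_iff[OF smooth_atlas_product[OF A]]
proof
  fix z :: "'a \<times> real" assume "z \<in> S \<times> UNIV"
  then have "fst z \<in> S" by auto
  then obtain Y where Y: "smooth_field_at A (fst z) Y" "\<forall>\<^sub>F q in nhds (fst z). q \<in> S \<longrightarrow> X q = Y q"
    using X unfolding smooth_field_along_iff[OF A] by meson
  have "\<forall>\<^sub>F y in nhds z. fst y \<in> S \<longrightarrow> X (fst y) = Y (fst y)"
    using eventually_isCont[of z fst "\<lambda>q. q \<in> S \<longrightarrow> X q = Y q"] Y(2) by (simp add: isCont_fst)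
  then have "\<forall>\<^sub>F y in nhds z. y \<in> S \<times> UNIV \<longrightarrow> (X (fst y), r) = (Y (fst y), r)"
    by eventually_elim auto
  then show "\<exists>Z. smooth_field_at (product_atlas A) z Z \<and>
      (\<forall>\<^sub>F y in nhds z. y \<in> S \<times> UNIV \<longrightarrow> (X (fst y), r) = Z y)"
    using smooth_field_at_Pair[OF A Y(1)] by blast
qed

lemma smooth_field_at_zero: "smooth_atlas A \<Longrightarrow> smooth_field_at A p (\<lambda>_. 0)"
  unfolding smooth_field_at_def
proof -
  assume A: "smooth_atlas A"
  note cA = is_chart_atlas[OF A, of p] in_atlas[OF A, of p]
  show "smooth_at (coord (A p) p) (\<lambda>x. to_chart A (A p) (param (A p) x) 0)"
    by (rule smooth_at_cong[OF smooth_at_const[of _ 0]],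
        rule eventually_mono[OF eventually_param[OF cA eventually_cdom[OF cA]]])
      (simp add: linear_0[OF linear_to_chart[OF A admissible_atlas[OF A]]])
qed

lemma smooth_field_along_vertical:
  assumes A: "smooth_atlas A"
  shows "smooth_field_along (product_atlas A) S (\<lambda>_. vertical)"
  unfolding smooth_field_along_iff[OF smooth_atlas_product[OF A]] vertical_def
proof
  fix z
  show "\<exists>X. smooth_field_at (product_atlas A) z X \<and> (\<forall>\<^sub>F q in nhds z. q \<in> S \<longrightarrow> (0, 1) = X q)"
    by (rule exI[of _ "\<lambda>_. (0, 1)"])
      (simp add: smooth_field_at_Pair[OF A smooth_field_at_zero[OF A], of z 1])
qed

lemma tangent_space_times_UNIV:
  fixes A :: "('m::{t2_space, second_countable_topology}, 'e::euclidean_space) atlas"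
  assumes A: "smooth_atlas A"
  shows "tangent_space (product_atlas A) (S \<times> UNIV) z = tangent_space A S (fst z) \<times> UNIV"
proof (intro equalityI subsetI)
  fix v assume "v \<in> tangent_space (product_atlas A) (S \<times> UNIV) z"
  then obtain c where "curve_through (product_atlas A) (S \<times> UNIV) z v c" by (auto simp: tangent_space_def)
  from curve_through_map[OF smooth_atlas_product[OF A] A this smooth_map_at_fst(1)[OF A], of S]
  show "v \<in> tangent_space A S (fst z) \<times> UNIV"
    by (auto simp: tangent_space_def smooth_map_at_fst(2)[OF A] mem_Times_iff)
next
  fix v :: "'e \<times> real" assume "v \<in> tangent_space A S (fst z) \<times> UNIV"
  then obtain c where c: "curve_through A S (fst z) (fst v) c" by (auto simp: tangent_space_def)
  let ?c = "\<lambda>t. (c t, snd z + t * snd v)"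
  have "((\<lambda>t. (coord (A (fst z)) (c t), snd z + t * snd v)) has_vector_derivative (fst v, snd v)) (at 0)"
    using c unfolding curve_through_def o_def
    by (intro has_vector_derivative_Pair)
      (auto intro!: derivative_eq_intros simp: has_real_derivative_iff_has_vector_derivative[symmetric])
  then have "curve_through (product_atlas A) (S \<times> UNIV) z v ?c"
    using c by (auto simp: curve_through_def product_atlas_eq o_def prod_eq_iff intro!: isCont_Pair continuous_intros)
  then show "v \<in> tangent_space (product_atlas A) (S \<times> UNIV) z" by (auto simp: tangent_space_def)
qed

section \<open>The Levi-Civita connection along curves\<close>

lemma bilinear_basis_expansion:
  fixes \<beta> :: "'a::euclidean_space \<Rightarrow> 'a \<Rightarrow> real"
  assumes "bilinear \<beta>"
  shows "\<beta> u w = (\<Sum>b\<in>Basis. \<Sum>b'\<in>Basis. (u \<bullet> b) * ((w \<bullet> b') * \<beta> b b'))"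
proof -
  have l: "linear (\<lambda>u. \<beta> u w)" "linear (\<beta> u)" for u w using assms by (auto simp: bilinear_def)
  have "\<beta> u w = (\<Sum>b\<in>Basis. (u \<bullet> b) * \<beta> b w)"
    using linear_basis_expansion[OF l(1), of u w] by simp
  also have "\<dots> = (\<Sum>b\<in>Basis. (u \<bullet> b) * (\<Sum>b'\<in>Basis. (w \<bullet> b') * \<beta> b b'))"
    using linear_basis_expansion[OF l(2), of _ w] by simp
  finally show ?thesis by (simp add: sum_distrib_left)
qed

text \<open>Riesz representation for a form other than the inner product of the model space: sending
  \<open>z\<close> to its values on \<open>Basis\<close> is injective, hence surjective in finite
  dimension. It yields both the Christoffel symbols and the gradients.\<close>

lemma bilinear_form_represents:
  fixes \<beta> :: "'a::euclidean_space \<Rightarrow> 'a \<Rightarrow> real"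
  assumes \<beta>: "bilinear \<beta>" and pos: "\<And>v. v \<noteq> 0 \<Longrightarrow> \<beta> v v > 0" and \<phi>: "linear \<phi>"
  shows "\<exists>!z. \<forall>w. \<beta> z w = \<phi> w"
proof -
  have l: "linear (\<lambda>u. \<beta> u w)" "linear (\<beta> u)" for u w using \<beta> by (auto simp: bilinear_def)
  have uniq: "z = z'" if "\<And>w. \<beta> z w = \<beta> z' w" for z z'
  proof (rule ccontr)
    assume "z \<noteq> z'"
    then have "\<beta> (z - z') (z - z') > 0" using pos by simp
    then show False using that by (simp add: linear_diff[OF l(1)])
  qed
  define G where "G z = (\<Sum>b\<in>Basis. \<beta> z b *\<^sub>R b)" for z
  have Gb: "G z \<bullet> b = \<beta> z b" if "b \<in> Basis" for z b
    using that by (simp add: G_def inner_sum_left inner_Basis if_distrib cong: if_cong)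
  have "linear G" unfolding G_def
    by (auto simp: linear_iff linear_add[OF l(1)] linear_scale[OF l(1)] scaleR_add_left sum.distrib
        scaleR_sum_right)
  moreover have "inj G"
  proof (rule injI)
    fix z z' assume "G z = G z'"
    then have "\<beta> z b = \<beta> z' b" if "b \<in> Basis" for b using Gb that by metis
    then have "\<beta> z w = \<beta> z' w" for w
      using linear_basis_expansion[OF l(2), of z w] linear_basis_expansion[OF l(2), of z' w] by simp
    then show "z = z'" by (rule uniq)
  qed
  ultimately have "surj G" by (rule linear_inj_imp_surj)
  then obtain z where z: "G z = (\<Sum>b\<in>Basis. \<phi> b *\<^sub>R b)" by (metis surjD)
  have "\<beta> z b = \<phi> b" if "b \<in> Basis" for b
    using Gb[OF that, of z] that unfolding z
    by (simp add: inner_sum_left inner_Basis if_distrib cong: if_cong)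
  then have "\<beta> z w = \<phi> w" for w
    using linear_basis_expansion[OF l(2), of z w] linear_basis_expansion[OF \<phi>, of w] by simp
  then show ?thesis using uniq by metis
qed

text \<open>A relational form of the definite description in \<open>shape_operator\<close>: one map
  \<open>L\<close> is correct for all velocities and all curves. It makes sense for any field along
  \<open>S\<close>, in particular for the Lorentzian normal.\<close>

definition covariant_differential ::
    "('m::topological_space, 'e::euclidean_space) atlas \<Rightarrow> ('m, 'e) metric \<Rightarrow> 'm set \<Rightarrow> ('m \<Rightarrow> 'e) \<Rightarrow>
     'm \<Rightarrow> ('e \<Rightarrow> 'e) \<Rightarrow> bool" where
  "covariant_differential A g S N p L \<longleftrightarrow>
     (\<forall>v c. curve_through A S p v c \<longrightarrow> has_covariant_derivative A g c (N \<circ> c) (L v))"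

context
  fixes A :: "('m::{t2_space, second_countable_topology}, 'e::euclidean_space) atlas"
    and g :: "('m, 'e) metric"
  assumes A: "smooth_atlas A" and g: "riemannian_metric A g"
begin

abbreviation (input) gm :: "'m \<Rightarrow> 'e \<Rightarrow> 'e \<Rightarrow> 'e \<Rightarrow> real" where
  "gm p \<equiv> metric_in_chart A g (A p)"

abbreviation (input) dgm :: "'m \<Rightarrow> 'e \<Rightarrow> 'e \<Rightarrow> 'e \<Rightarrow> real" where
  "dgm p u v w \<equiv> fd (\<lambda>y. gm p y v w) (coord (A p) p) u"

abbreviation (input) christoffel_at :: "'m \<Rightarrow> 'e \<Rightarrow> 'e \<Rightarrow> 'e" where
  "christoffel_at p \<equiv> christoffel A g (A p) (coord (A p) p)"

lemma smooth_at_metric_in_chart: "smooth_at (coord (A p) p) (\<lambda>y. gm p y v w)"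
  using g in_atlas[OF A, of p] open_coord_image_Int[OF is_chart_atlas[OF A] open_UNIV, of p]
  unfolding riemannian_metric_def by (auto intro: smooth_atI)

lemma bilinear_metric_in_chart:
  assumes "y \<in> coord (A p) ` cdom (A p)"
  shows "bilinear (gm p y)"
proof -
  have "param (A p) y \<in> cdom (A p)" using assms by (rule inv_into_into)
  from linear_from_chart[OF A admissible_atlas[OF A] this] show ?thesis
    by (auto simp: bilinear_def linear_iff metric_in_chart_def metric_simps[OF g])
qed

lemma eventually_bilinear_metric_in_chart: "\<forall>\<^sub>F y in nhds (coord (A p) p). bilinear (gm p y)"
  using eventually_coord_image[OF is_chart_atlas[OF A] in_atlas[OF A], of p]
  by eventually_elim (rule bilinear_metric_in_chart)

lemma metric_in_chart_commute: "gm p y v w = gm p y w v"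
  by (simp add: metric_in_chart_def metric_commute[OF g])

lemma metric_in_chart_base: "gm p (coord (A p) p) v w = g p v w"
proof -
  note cA = is_chart_atlas[OF A, of p] in_atlas[OF A, of p]
  have "from_chart A (A p) p v = v" for v
    using from_to_chart[OF A admissible_atlas[OF A] cA(2), of v] by (simp add: to_chart_self[OF A])
  then show ?thesis by (simp add: metric_in_chart_def param_coord[OF cA])
qed

lemma dgm_linear:
  "linear (\<lambda>u. dgm p u v w)" "linear (\<lambda>v. dgm p u v w)" "linear (\<lambda>w. dgm p u v w)"
proof -
  note s = smooth_at_metric_in_chart
  show "linear (\<lambda>u. dgm p u v w)" by (rule smooth_at_linear_fd[OF s])
  have add: "dgm p u (v + v') w = dgm p u v w + dgm p u v' w" for v v' w
  proof -
    have "dgm p u (v + v') w = fd (\<lambda>y. gm p y v w + gm p y v' w) (coord (A p) p) u"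
      by (rule fun_cong[OF fd_cong], rule eventually_mono[OF eventually_bilinear_metric_in_chart])
        (simp add: bilinear_ladd)
    also have "\<dots> = dgm p u v w + dgm p u v' w"
      using fd_eq[OF has_derivative_add[OF smooth_at_has_derivative[OF s[of p v w]] smooth_at_has_derivative[OF s[of p v' w]]]]
      by simp
    finally show ?thesis .
  qed
  have scale: "dgm p u (r *\<^sub>R v) w = r * dgm p u v w" for r v w
  proof -
    have "dgm p u (r *\<^sub>R v) w = fd (\<lambda>y. r *\<^sub>R gm p y v w) (coord (A p) p) u"
      by (rule fun_cong[OF fd_cong], rule eventually_mono[OF eventually_bilinear_metric_in_chart])
        (simp add: bilinear_lmul)
    also have "\<dots> = r * dgm p u v w"
      using fd_eq[OF has_derivative_scaleR_right[OF smooth_at_has_derivative[OF s[of p v w]], of r]]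
      by simp
    finally show ?thesis .
  qed
  show 1: "linear (\<lambda>v. dgm p u v w)" for w by (rule linearI) (simp_all add: add scale)
  show "linear (\<lambda>w. dgm p u v w)"
    using 1[of v] metric_in_chart_commute[of p _ v] by simp
qed

lemma bilinear_dgm: "bilinear (\<lambda>v w. dgm p u v w)"
  using dgm_linear by (simp add: bilinear_def)

lemma dgm_commute: "dgm p u v w = dgm p u w v"
  using metric_in_chart_commute by simp

lemma christoffel_unique:
  "\<exists>!z. \<forall>w. 2 * g p z w = dgm p u v w + dgm p v u w - dgm p w u v"
proof -
  note l = dgm_linear(3)[where p = p and u = u and v = v] dgm_linear(3)[where p = p and u = v and v = u]
    dgm_linear(1)[where p = p and v = u and w = v]
  have "linear (\<lambda>w. dgm p u v w + dgm p v u w - dgm p w u v)"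
    by (rule linearI) (simp_all add: l[THEN linear_add] l[THEN linear_scale] algebra_simps)
  moreover have "bilinear (\<lambda>z w. 2 * g p z w)"
    by (auto simp: bilinear_def linear_iff metric_simps[OF g] algebra_simps)
  ultimately show ?thesis
    using metric_pos[OF g] by (intro bilinear_form_represents) auto
qed

lemma christoffel_koszul:
  "2 * g p (christoffel_at p u v) w = dgm p u v w + dgm p v u w - dgm p w u v"
  using theI'[OF christoffel_unique[where p = p and u = u and v = v]]
  unfolding christoffel_def metric_in_chart_base by blast

lemma christoffel_eqI:
  assumes "\<And>w. 2 * g p z w = dgm p u v w + dgm p v u w - dgm p w u v"
  shows "christoffel_at p u v = z"
  using christoffel_unique[where p = p and u = u and v = v] assms christoffel_koszul[where p = p and u = u and v = v]
  by blast

lemma bilinear_christoffel: "bilinear (christoffel_at p)"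
  unfolding bilinear_def
proof (intro conjI allI)
  note k = christoffel_koszul[of p] and m = metric_simps[OF g] and l = dgm_linear[of p]
  note la = l[THEN linear_add] and ls = l[THEN linear_scale]
  show "linear (christoffel_at p u)" for u
    by (rule linearI; rule christoffel_eqI)
      (simp_all add: m k la ls algebra_simps)
  show "linear (\<lambda>u. christoffel_at p u v)" for v
    by (rule linearI; rule christoffel_eqI)
      (simp_all add: m k la ls algebra_simps)
qed

text \<open>Metric compatibility of the connection: adding the Koszul formulas for
  \<open>(u, v, w)\<close> and \<open>(u, w, v)\<close> leaves twice the derivative along
  \<open>u\<close>, as the other terms cancel by symmetry of the metric.\<close>

lemma christoffel_metric:
  "dgm p u v w = g p (christoffel_at p u v) w + g p v (christoffel_at p u w)"
proof -
  have "2 * g p v (christoffel_at p u w) = dgm p u w v + dgm p w u v - dgm p v u w"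
    using christoffel_koszul[where p = p and u = u and v = w and w = v]
      metric_commute[OF g, of p v "christoffel_at p u w"] by simp
  then show ?thesis
    using christoffel_koszul[where p = p and u = u and v = v and w = w]
      dgm_commute[where p = p and u = u and v = v and w = w]
      dgm_commute[where p = p and u = v and v = u and w = w]
      dgm_commute[where p = p and u = w and v = u and w = v] by simp
qed

text \<open>Product rule with base point and both arguments moving. The parameter \<open>s\<close>
  is not restricted to real numbers: it is a time for curves, but a point of a chart for
  isometries.\<close>

lemma has_derivative_metric_in_chart:
  assumes \<psi>: "(\<psi> has_derivative \<psi>') (at s)" and \<psi>s: "\<psi> s = coord (A p) p"
    and a: "(a has_derivative a') (at s)" and b: "(b has_derivative b') (at s)"
  shows "((\<lambda>s. gm p (\<psi> s) (a s) (b s)) has_derivative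
    (\<lambda>h. dgm p (\<psi>' h) (a s) (b s) + g p (a' h) (b s) + g p (a s) (b' h))) (at s)"
proof -
  have d: "((\<lambda>s. gm p (\<psi> s) i j) has_derivative (\<lambda>h. dgm p (\<psi>' h) i j)) (at s)" for i j
    using diff_chain_at[OF \<psi>, of "\<lambda>y. gm p y i j"] smooth_at_has_derivative[OF smooth_at_metric_in_chart[of p i j]]
    by (simp add: \<psi>s o_def)
  have "((\<lambda>s. \<Sum>i\<in>Basis. \<Sum>j\<in>Basis. (a s \<bullet> i) * ((b s \<bullet> j) * gm p (\<psi> s) i j)) has_derivative
      (\<lambda>h. \<Sum>i\<in>Basis. \<Sum>j\<in>Basis. (a s \<bullet> i) * ((b s \<bullet> j) * dgm p (\<psi>' h) i j + (b' h \<bullet> j) * gm p (\<psi> s) i j) +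
        (a' h \<bullet> i) * ((b s \<bullet> j) * gm p (\<psi> s) i j))) (at s)"
    by (intro has_derivative_sum has_derivative_mult has_derivative_inner_left a b d)
  also have "(\<lambda>h. \<Sum>i\<in>Basis. \<Sum>j\<in>Basis. (a s \<bullet> i) * ((b s \<bullet> j) * dgm p (\<psi>' h) i j + (b' h \<bullet> j) * gm p (\<psi> s) i j) +
        (a' h \<bullet> i) * ((b s \<bullet> j) * gm p (\<psi> s) i j)) =
      (\<lambda>h. dgm p (\<psi>' h) (a s) (b s) + g p (a' h) (b s) + g p (a s) (b' h))"
  proof
    fix h
    have G: "bilinear (g p)" using g by (simp add: riemannian_metric_def)
    show "(\<Sum>i\<in>Basis. \<Sum>j\<in>Basis. (a s \<bullet> i) * ((b s \<bullet> j) * dgm p (\<psi>' h) i j + (b' h \<bullet> j) * gm p (\<psi> s) i j) +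
        (a' h \<bullet> i) * ((b s \<bullet> j) * gm p (\<psi> s) i j)) =
      dgm p (\<psi>' h) (a s) (b s) + g p (a' h) (b s) + g p (a s) (b' h)"
      unfolding bilinear_basis_expansion[OF bilinear_dgm[where p = p and u = "\<psi>' h"], of "a s" "b s"]
        bilinear_basis_expansion[OF G, of "a' h" "b s"] bilinear_basis_expansion[OF G, of "a s" "b' h"]
      by (simp add: \<psi>s metric_in_chart_base sum.distrib distrib_left)
  qed
  finally have *: "((\<lambda>s. \<Sum>i\<in>Basis. \<Sum>j\<in>Basis. (a s \<bullet> i) * ((b s \<bullet> j) * gm p (\<psi> s) i j)) has_derivative
      (\<lambda>h. dgm p (\<psi>' h) (a s) (b s) + g p (a' h) (b s) + g p (a s) (b' h))) (at s)" .
  have "\<forall>\<^sub>F s in nhds s. bilinear (gm p (\<psi> s))"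
    using eventually_isCont[OF has_derivative_continuous[OF \<psi>]] eventually_bilinear_metric_in_chart[of p]
    by (simp add: \<psi>s)
  then have "\<forall>\<^sub>F s in nhds s. (\<Sum>i\<in>Basis. \<Sum>j\<in>Basis. (a s \<bullet> i) * ((b s \<bullet> j) * gm p (\<psi> s) i j)) =
      gm p (\<psi> s) (a s) (b s)"
    by eventually_elim (simp add: bilinear_basis_expansion)
  from has_derivative_cong_nhds[OF this] * show ?thesis by blast
qed

lemma curve_velocity: "curve_through A S p v c \<Longrightarrow> velocity A c 0 = v"
  by (auto simp: curve_through_def velocity_def vector_derivative_at)

lemma has_covariant_derivative_iff:
  assumes "curve_through A S p v c"
  shows "has_covariant_derivative A g c V Z \<longleftrightarrow>
    ((\<lambda>t. to_chart A (A p) (c t) (V t)) has_vector_derivative Z - christoffel_at p v (V 0)) (at 0)"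
proof -
  have "c 0 = p" using assms by (simp add: curve_through_def)
  then show ?thesis
    unfolding has_covariant_derivative_def curve_velocity[OF assms]
    by (auto simp: algebra_simps intro!: exI[of _ "Z - christoffel_at p v (V 0)"])
qed

lemma covariant_derivative_unique:
  assumes "curve_through A S p v c" "has_covariant_derivative A g c V Z" "has_covariant_derivative A g c V Z'"
  shows "Z = Z'"
  using vector_derivative_unique_at assms(2,3) unfolding has_covariant_derivative_iff[OF assms(1)]
  by (metis diff_add_cancel)

lemma curve_chart_eventually:
  assumes c: "curve_through A S p v c"
  shows "\<forall>\<^sub>F t in nhds 0. c t \<in> cdom (A p)"
  by (rule curve_eventually[OF c eventually_cdom[OF is_chart_atlas[OF A] in_atlas[OF A]]])

lemma has_covariant_derivative_add:
  assumes c: "curve_through A S p v c" and V: "has_covariant_derivative A g c V Z"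
    and W: "has_covariant_derivative A g c W Y"
  shows "has_covariant_derivative A g c (\<lambda>t. V t + W t) (Z + Y)"
proof -
  have "\<forall>\<^sub>F t in nhds 0. to_chart A (A p) (c t) (V t) + to_chart A (A p) (c t) (W t) =
      to_chart A (A p) (c t) (V t + W t)"
    using curve_chart_eventually[OF c]
    by eventually_elim (simp add: linear_add[OF linear_to_chart[OF A admissible_atlas[OF A]]])
  from has_vector_derivative_transfer[OF has_vector_derivative_add this]
    V[unfolded has_covariant_derivative_iff[OF c]] W[unfolded has_covariant_derivative_iff[OF c]]
  show ?thesis
    unfolding has_covariant_derivative_iff[OF c]
    by (force simp: bilinear_radd[OF bilinear_christoffel] algebra_simps)
qed

lemma has_covariant_derivative_scaleR:
  assumes c: "curve_through A S p v c" and V: "has_covariant_derivative A g c V Z"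
    and h: "(h has_real_derivative h') (at 0)"
  shows "has_covariant_derivative A g c (\<lambda>t. h t *\<^sub>R V t) (h' *\<^sub>R V 0 + h 0 *\<^sub>R Z)"
proof -
  have "c 0 = p" using c by (simp add: curve_through_def)
  have "\<forall>\<^sub>F t in nhds 0. h t *\<^sub>R to_chart A (A p) (c t) (V t) = to_chart A (A p) (c t) (h t *\<^sub>R V t)"
    using curve_chart_eventually[OF c]
    by eventually_elim (simp add: linear_scale[OF linear_to_chart[OF A admissible_atlas[OF A]]])
  from has_vector_derivative_transfer[OF has_vector_derivative_scaleR[OF h] this]
    V[unfolded has_covariant_derivative_iff[OF c]]
  show ?thesis
    unfolding has_covariant_derivative_iff[OF c]
    by (force simp: bilinear_rmul[OF bilinear_christoffel] algebra_simps \<open>c 0 = p\<close> to_chart_self[OF A])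
qed

lemma has_covariant_derivative_zero:
  assumes c: "curve_through A S p v c"
  shows "has_covariant_derivative A g c (\<lambda>_. 0) 0"
proof -
  have "\<forall>\<^sub>F t in nhds 0. (0::'e) = to_chart A (A p) (c t) 0"
    using curve_chart_eventually[OF c]
    by eventually_elim (simp add: linear_0[OF linear_to_chart[OF A admissible_atlas[OF A]]])
  from has_vector_derivative_transfer[OF has_vector_derivative_const this]
  show ?thesis
    unfolding has_covariant_derivative_iff[OF c] by (simp add: bilinear_rzero[OF bilinear_christoffel])
qed

lemma metric_along_curve_derivative:
  assumes c: "curve_through A S p v c" and V: "has_covariant_derivative A g c V Z"
    and W: "has_covariant_derivative A g c W Y"
  shows "((\<lambda>t. g (c t) (V t) (W t)) has_real_derivative g p Z (W 0) + g p (V 0) Y) (at 0)"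
proof -
  note cA = is_chart_atlas[OF A, of p] in_atlas[OF A, of p]
  have c0: "c 0 = p" and cd: "((\<lambda>t. coord (A p) (c t)) has_derivative (\<lambda>t. t *\<^sub>R v)) (at 0)"
    using c by (auto simp: curve_through_def has_vector_derivative_def o_def)
  let ?a = "\<lambda>t. to_chart A (A p) (c t) (V t)" and ?b = "\<lambda>t. to_chart A (A p) (c t) (W t)"
  have a: "(?a has_derivative (\<lambda>t. t *\<^sub>R (Z - christoffel_at p v (V 0)))) (at 0)"
    and b: "(?b has_derivative (\<lambda>t. t *\<^sub>R (Y - christoffel_at p v (W 0)))) (at 0)"
    using V W unfolding has_covariant_derivative_iff[OF c] has_vector_derivative_def by auto
  have "((\<lambda>t. gm p (coord (A p) (c t)) (?a t) (?b t)) has_derivative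
      (\<lambda>t. dgm p (t *\<^sub>R v) (V 0) (W 0) + g p (t *\<^sub>R (Z - christoffel_at p v (V 0))) (W 0) +
        g p (V 0) (t *\<^sub>R (Y - christoffel_at p v (W 0))))) (at 0)"
    using has_derivative_metric_in_chart[OF cd _ a b, of p] by (simp add: c0 to_chart_self[OF A])
  also have "(\<lambda>t. dgm p (t *\<^sub>R v) (V 0) (W 0) + g p (t *\<^sub>R (Z - christoffel_at p v (V 0))) (W 0) +
        g p (V 0) (t *\<^sub>R (Y - christoffel_at p v (W 0)))) = (*) (g p Z (W 0) + g p (V 0) Y)"
    \<comment> \<open>Metric compatibility cancels the derivative of the metric coefficients against
      the two Christoffel terms.\<close>
    using christoffel_metric[where p = p and u = v and v = "V 0" and w = "W 0"]
    by (simp add: fun_eq_iff linear_scale[OF dgm_linear(1)] metric_simps[OF g] algebra_simps)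
  finally have *: "((\<lambda>t. gm p (coord (A p) (c t)) (?a t) (?b t)) has_real_derivative
      g p Z (W 0) + g p (V 0) Y) (at 0)" by (simp add: has_field_derivative_def)
  have "\<forall>\<^sub>F t in nhds 0. gm p (coord (A p) (c t)) (?a t) (?b t) = g (c t) (V t) (W t)"
    using curve_chart_eventually[OF c]
    by eventually_elim (simp add: metric_in_chart_def param_coord[OF cA(1)]
        from_to_chart[OF A admissible_atlas[OF A]])
  from has_derivative_cong_nhds[OF this] * show ?thesis by (simp add: has_field_derivative_def)
qed

text \<open>\<open>L\<close> is the chart derivative of the components plus the Christoffel term;
  both are linear in the velocity.\<close>

lemma smooth_field_covariant_differential:
  assumes p: "p \<in> S" and N: "smooth_field_along A S N"
  obtains L where "linear L" "covariant_differential A g S N p L"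
proof -
  obtain l where l: "linear l" "\<And>c v. curve_through A S p v c \<Longrightarrow>
      ((\<lambda>t. to_chart A (A p) (c t) (N (c t))) has_vector_derivative l v) (at 0)"
    using smooth_field_along_curve[OF A p N] by metis
  define L where "L v = l v + christoffel_at p v (N p)" for v
  have "linear L" unfolding L_def
    using l(1) bilinear_christoffel[of p] by (auto simp: linear_iff bilinear_def algebra_simps)
  moreover have "has_covariant_derivative A g c (N \<circ> c) (L v)" if c: "curve_through A S p v c" for v c
    using l(2)[OF c] c by (simp add: has_covariant_derivative_iff[OF c] L_def curve_through_def)
  ultimately show thesis using that by (simp add: covariant_differential_def)
qed

text \<open>Tangency provides one curve with velocity \<open>v\<close>, which pins the value down;
  if there were none, every vector would satisfy the description in
  \<open>shape_operator\<close>.\<close>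

lemma shape_operator_eq:
  assumes L: "covariant_differential A g S N p L" and v: "v \<in> tangent_space A S p"
  shows "shape_operator A g S N p v = - L v"
proof -
  obtain c where c: "curve_through A S p v c" using v by (auto simp: tangent_space_def)
  have "(THE Z. \<forall>c. curve_through A S p v c \<longrightarrow> has_covariant_derivative A g c (N \<circ> c) Z) = L v"
  proof (rule the_equality)
    show "\<forall>c. curve_through A S p v c \<longrightarrow> has_covariant_derivative A g c (N \<circ> c) (L v)"
      using L by (simp add: covariant_differential_def)
    show "Z = L v" if "\<forall>c. curve_through A S p v c \<longrightarrow> has_covariant_derivative A g c (N \<circ> c) Z" for Z
      using that L c covariant_derivative_unique[OF c] unfolding covariant_differential_def by blast
  qed
  then show ?thesis by (simp add: shape_operator_def)
qed

text \<open>The squared length of \<open>N\<close> is constantly 1 along curves in \<open>S\<close>,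
  and its derivative is twice the product in question. Hence the shape operator maps the tangent
  space into itself, as the trace computations require.\<close>

lemma covariant_differential_normal:
  assumes N: "unit_normal_field A g S N" and p: "p \<in> S"
    and L: "covariant_differential A g S N p L" and v: "v \<in> tangent_space A S p"
  shows "g p (N p) (L v) = 0"
proof -
  obtain c where c: "curve_through A S p v c" using v by (auto simp: tangent_space_def)
  have c0: "c 0 = p" using c by (simp add: curve_through_def)
  have cov: "has_covariant_derivative A g c (N \<circ> c) (L v)"
    using L c by (simp add: covariant_differential_def)
  have "((\<lambda>t. g (c t) (N (c t)) (N (c t))) has_real_derivative 2 * g p (N p) (L v)) (at 0)"
    using metric_along_curve_derivative[OF c cov cov] metric_commute[OF g, of p "L v" "N p"]
    by (simp add: c0)
  moreover have "(\<lambda>t. g (c t) (N (c t)) (N (c t))) = (\<lambda>_. 1)"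
    using N curve_in[OF c] by (auto simp: unit_normal_field_def)
  ultimately show ?thesis using DERIV_unique[OF _ DERIV_const[of 1]] by fastforce
qed

end

section \<open>Traces\<close>

lemma subspace_basis:
  fixes T :: "'e::euclidean_space set"
  assumes "subspace T"
  obtains B where "independent B" "span B = T"
  using basis_exists[of T] span_minimal[OF _ assms] by (metis subset_antisym)

lemma trace_on_some_basis:
  fixes T :: "'e::euclidean_space set"
  assumes "subspace T"
  obtains B where "independent B" "span B = T" "\<And>L. trace_on T L = (\<Sum>b\<in>B. representation B (L b) b)"
proof -
  define B where "B = (SOME B. independent B \<and> span B = T)"
  have B: "independent B \<and> span B = T"
    unfolding B_def by (rule someI_ex) (use subspace_basis[OF assms] in metis)
  then show thesis by (intro that[of B]) (auto simp: trace_on_def B_def[symmetric] Let_def)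
qed

text \<open>The basis chosen in \<open>trace_on\<close> depends on \<open>T\<close> alone, so only
  values on \<open>T\<close> enter. \<open>shape_operator\<close> can thus be replaced by a linear
  map that agrees with it on tangent vectors.\<close>

lemma trace_on_cong:
  fixes T :: "'e::euclidean_space set"
  assumes "subspace T" "\<And>v. v \<in> T \<Longrightarrow> L v = L' v"
  shows "trace_on T L = trace_on T L'"
proof -
  obtain B where "span B = T" and *: "\<And>L. trace_on T L = (\<Sum>b\<in>B. representation B (L b) b)"
    using trace_on_some_basis[OF assms(1)] by metis
  then have "L b = L' b" if "b \<in> B" for b using that span_base assms(2) by blast
  then show ?thesis unfolding * by (intro sum.cong) auto
qed

text \<open>Basis independence: writing \<open>e\<close> in terms of \<open>B\<close> and
  \<open>L b\<close> in terms of \<open>E\<close> turns both traces into the same double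
  sum.\<close>

lemma trace_on_basis:
  fixes T :: "'e::euclidean_space set"
  assumes T: "subspace T" and L: "linear L" "L ` T \<subseteq> T" and E: "independent E" "span E = T"
  shows "trace_on T L = (\<Sum>e\<in>E. representation E (L e) e)"
proof -
  obtain B where B: "independent B" "span B = T" "trace_on T L = (\<Sum>b\<in>B. representation B (L b) b)"
    using trace_on_some_basis[OF T] by metis
  have fin: "finite B" "finite E" using B(1) E(1) independent_imp_finite by auto
  have LB: "L b \<in> span E" "L b \<in> span B" if "b \<in> B" for b
    using L(2) that B(2) E(2) span_base[OF that] by auto
  have eB: "e \<in> span B" if "e \<in> E" for e using that B(2) E(2) span_base[OF that] by simp
  have "representation E (L e) e = (\<Sum>b\<in>B. representation B e b * representation E (L b) e)"
    if e: "e \<in> E" for e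
  proof -
    have "L e = L (\<Sum>b\<in>B. representation B e b *\<^sub>R b)"
      using sum_representation_eq[OF B(1) eB[OF e] fin(1) order_refl] by simp
    also have "\<dots> = (\<Sum>b\<in>B. representation B e b *\<^sub>R L b)"
      by (simp add: linear_sum[OF L(1)] linear_scale[OF L(1)])
    finally show ?thesis
      using LB by (simp add: representation_sum[OF E(1)] representation_scale[OF E(1)] span_scale)
  qed
  then have "(\<Sum>e\<in>E. representation E (L e) e) =
      (\<Sum>b\<in>B. \<Sum>e\<in>E. representation B e b * representation E (L b) e)"
    by (simp add: sum.swap[of _ B])
  also have "\<dots> = (\<Sum>b\<in>B. representation B (L b) b)"
  proof (rule sum.cong[OF refl])
    fix b assume b: "b \<in> B"
    have "representation B (L b) b = representation B (\<Sum>e\<in>E. representation E (L b) e *\<^sub>R e) b"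
      using sum_representation_eq[OF E(1) LB(1)[OF b] fin(2) order_refl] by simp
    also have "\<dots> = (\<Sum>e\<in>E. representation E (L b) e * representation B e b)"
      using eB by (simp add: representation_sum[OF B(1)] representation_scale[OF B(1)] span_scale)
    finally show "(\<Sum>e\<in>E. representation B e b * representation E (L b) e) = representation B (L b) b"
      by (simp add: mult.commute)
  qed
  finally show ?thesis using B(3) by simp
qed

lemma representation_image:
  fixes D :: "'a::euclidean_space \<Rightarrow> 'b::euclidean_space"
  assumes D: "linear D" "inj D" and B: "independent B" and v: "v \<in> span B" and b: "b \<in> B"
  shows "representation (D ` B) (D v) (D b) = representation B v b"
proof -
  have DB: "independent (D ` B)"
    using B D linear_independent_injective_image by (metis subset_UNIV inj_on_subset)
  have fin: "finite B" using B independent_imp_finite by auto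
  have "D v = D (\<Sum>b\<in>B. representation B v b *\<^sub>R b)"
    using sum_representation_eq[OF B v fin order_refl] by simp
  also have "\<dots> = (\<Sum>b\<in>B. representation B v b *\<^sub>R D b)"
    by (simp add: linear_sum[OF D(1)] linear_scale[OF D(1)])
  finally have "representation (D ` B) (D v) (D b) =
      (\<Sum>c\<in>B. representation B v c * representation (D ` B) (D c) (D b))"
    by (simp add: representation_sum[OF DB] representation_scale[OF DB] span_scale span_base)
  also have "\<dots> = (\<Sum>c\<in>B. if c = b then representation B v c else 0)"
    using inj_eq[OF D(2)] by (intro sum.cong) (auto simp: representation_basis[OF DB])
  finally show ?thesis using fin b by simp
qed

text \<open>Conjugate operators have equal traces. \<open>D\<close> will be the differential of an
  isometry, between tangent spaces at different points.\<close>

lemma trace_on_image: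
  fixes D :: "'a::euclidean_space \<Rightarrow> 'b::euclidean_space"
  assumes D: "linear D" "inj D" and T: "subspace T" and L: "linear L" "L ` T \<subseteq> T" "linear L'"
    and eq: "\<And>v. v \<in> T \<Longrightarrow> L' (D v) = D (L v)"
  shows "trace_on (D ` T) L' = trace_on T L"
proof -
  obtain B where B: "independent B" "span B = T" using subspace_basis[OF T] .
  have DB: "independent (D ` B)"
    using B D linear_independent_injective_image by (metis subset_UNIV inj_on_subset)
  have "trace_on (D ` T) L' = (\<Sum>b\<in>D ` B. representation (D ` B) (L' b) b)"
    using L eq B(2) by (intro trace_on_basis DB) (auto simp: linear_subspace_image[OF D(1) T] linear_span_image[OF D(1)])
  also have "\<dots> = (\<Sum>b\<in>B. representation (D ` B) (L' (D b)) (D b))"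
    using D(2) by (simp add: sum.reindex inj_on_subset)
  also have "\<dots> = (\<Sum>b\<in>B. representation B (L b) b)"
  proof (rule sum.cong[OF refl])
    fix b assume b: "b \<in> B"
    then have "b \<in> T" "L b \<in> span B" using B(2) span_base L(2) by auto
    then show "representation (D ` B) (L' (D b)) (D b) = representation B (L b) b"
      using representation_image[OF D B(1) _ b] eq by simp
  qed
  also have "\<dots> = trace_on T L" by (rule trace_on_basis[OF T L(1,2) B, symmetric])
  finally show ?thesis .
qed

text \<open>
  A splitting of \<open>T\<close> into horizontal vectors and a line transversal to them. In the application the
  line is spanned by the gradient of the height function.
\<close>

lemma trace_on_splitting:
  fixes T :: "('e::euclidean_space \<times> real) set"
  assumes T: "subspace T" and U: "subspace U" and w: "w \<in> T" "snd w = 1"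
    and TU: "\<And>v. v \<in> T \<Longrightarrow> fst v - snd v *\<^sub>R fst w \<in> U" and UT: "\<And>u. u \<in> U \<Longrightarrow> (u, 0) \<in> T"
    and L: "linear L" "L ` T \<subseteq> T" and M: "linear M" "M ` U \<subseteq> U"
    and LM: "\<And>u. u \<in> U \<Longrightarrow> L (u, 0) = (\<kappa> *\<^sub>R M u, 0) + snd (L (u, 0)) *\<^sub>R w" and Lw: "snd (L w) = 0"
  shows "trace_on T L = \<kappa> * trace_on U M"
proof -
  define D where "D u = (u, 0::real)" for u :: 'e
  have D: "linear D" "inj D" by (auto simp: D_def linear_iff inj_def)
  obtain B where B: "independent B" "span B = U" using subspace_basis[OF U] .
  have DB: "independent (D ` B)"
    using B D linear_independent_injective_image by (metis subset_UNIV inj_on_subset)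
  have spanD: "span (D ` B) = D ` U" using linear_span_image[OF D(1)] B(2) by simp
  have wD: "w \<notin> D ` U" "w \<notin> D ` B" using w(2) by (auto simp: D_def)
  let ?E = "insert w (D ` B)"
  have E: "independent ?E" using DB wD spanD by (simp add: independent_insert)
  have spanE: "span ?E = T"
  proof
    show "span ?E \<subseteq> T"
      using w(1) UT span_base B(2) by (intro span_minimal T) (auto simp: D_def)
    show "T \<subseteq> span ?E"
    proof
      fix v assume v: "v \<in> T"
      have "D (fst v - snd v *\<^sub>R fst w) \<in> span (D ` B)" using TU[OF v] spanD by blast
      then have "D (fst v - snd v *\<^sub>R fst w) \<in> span ?E"
        using span_mono[of "D ` B" ?E] by blast
      moreover have "snd v *\<^sub>R w \<in> span ?E" by (intro span_scale span_base) simp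
      moreover have "v = D (fst v - snd v *\<^sub>R fst w) + snd v *\<^sub>R w"
        using w(2) by (simp add: D_def prod_eq_iff)
      ultimately show "v \<in> span ?E" using span_add by metis
    qed
  qed
  have rep: "representation ?E (D u) = representation (D ` B) (D u)" if "u \<in> U" for u
    using that spanD by (intro representation_extend[OF E]) auto
  \<comment> \<open>\<open>L w\<close> is horizontal by the assumption \<open>Lw\<close>, so it has
    no component along \<open>w\<close> and contributes nothing to the diagonal.\<close>
  have "representation ?E (L w) w = 0"
  proof -
    have "L w \<in> T" using L(2) w(1) by blast
    from TU[OF this] Lw have "fst (L w) \<in> U" by simp
    moreover have "L w = D (fst (L w))" using Lw by (simp add: D_def prod_eq_iff)
    ultimately show ?thesis
      using rep[of "fst (L w)"] wD(2) representation_ne_zero[of "D ` B" "L w" w] by auto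
  qed
  \<comment> \<open>The \<open>w\<close> component of \<open>L (D b)\<close> lies off the diagonal,
    so only the part \<open>\<kappa> *\<^sub>R M b\<close> counts.\<close>
  moreover have "representation ?E (L (D b)) (D b) = \<kappa> * representation B (M b) b" if b: "b \<in> B" for b
  proof -
    have bU: "b \<in> U" "M b \<in> U" using b B(2) span_base M(2) by auto
    have kU: "\<kappa> *\<^sub>R M b \<in> U" using bU U by (simp add: subspace_scale)
    have Lb: "L (D b) = D (\<kappa> *\<^sub>R M b) + snd (L (D b)) *\<^sub>R w" using LM[OF bU(1)] by (simp add: D_def)
    have sp: "D (\<kappa> *\<^sub>R M b) \<in> span ?E" "w \<in> span ?E"
      using kU UT w(1) spanE by (auto simp: D_def)
    have "representation ?E (L (D b)) (D b) =
        representation ?E (D (\<kappa> *\<^sub>R M b)) (D b) + snd (L (D b)) * representation ?E w (D b)"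
      using arg_cong[OF Lb, of "\<lambda>y. representation ?E y (D b)"]
      by (simp only: representation_add[OF E span_scale[OF sp(2)] sp(1)] representation_scale[OF E sp(2)])
    also have "representation ?E w (D b) = 0"
      using wD(2) b by (auto simp: representation_basis[OF E])
    also have "representation ?E (D (\<kappa> *\<^sub>R M b)) (D b) = representation B (\<kappa> *\<^sub>R M b) b"
      using rep[OF kU] representation_image[OF D B(1) _ b] kU B(2) by simp
    finally show ?thesis using bU B by (simp add: representation_scale)
  qed
  moreover have "trace_on T L = (\<Sum>e\<in>?E. representation ?E (L e) e)"
    by (rule trace_on_basis[OF T L E spanE])
  moreover have "\<dots> = representation ?E (L w) w + (\<Sum>b\<in>B. representation ?E (L (D b)) (D b))"
    using wD(2) independent_imp_finite[OF B(1)] D(2) by (simp add: sum.reindex inj_on_subset)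
  ultimately show ?thesis
    using trace_on_basis[OF U M B] by (simp add: sum_distrib_left)
qed

section \<open>The connection of the product\<close>

context
  fixes A :: "('m::{t2_space, second_countable_topology}, 'e::euclidean_space) atlas"
    and g :: "('m, 'e) metric"
  assumes A: "smooth_atlas A" and g: "riemannian_metric A g"
begin

lemma dgm_product: "dgm (product_atlas A) (product_metric g) z u v w = dgm A g (fst z) (fst u) (fst v) (fst w)"
proof -
  let ?x = "coord (product_atlas A z) z"
  have s: "smooth_at (fst ?x) (\<lambda>y. metric_in_chart A g (A (fst z)) y (fst v) (fst w))"
    using smooth_at_metric_in_chart[OF A g] by (simp add: product_atlas_eq)
  have "fd (\<lambda>y. metric_in_chart (product_atlas A) (product_metric g) (product_atlas A z) y v w) ?x u =
      fd (\<lambda>y. metric_in_chart A g (A (fst z)) (fst y) (fst v) (fst w) + snd v * snd w) ?x u"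
    by (rule fun_cong[OF fd_cong], rule eventually_mono[OF product_chart_eventually[OF A, of z]])
      (simp add: product_atlas_eq metric_in_product_chart[OF A admissible_atlas[OF A]])
  also have "\<dots> = fd (\<lambda>y. metric_in_chart A g (A (fst z)) (fst y) (fst v) (fst w)) ?x u"
    using fun_cong[OF fd_eq[OF has_derivative_add[OF smooth_at_has_derivative[OF smooth_at_compose_fst[OF s]]
          has_derivative_const]]] by simp
  also have "\<dots> = dgm A g (fst z) (fst u) (fst v) (fst w)"
    using fd_compose[of ?x fst, OF _ s] by (simp add: smooth_at_fst fd_fst product_atlas_eq)
  finally show ?thesis .
qed

text \<open>The coefficients of the product metric do not depend on the height and the vertical ones
  are constant, so every vertical term of the Koszul formula vanishes.\<close>

lemma christoffel_product:
  "christoffel_at (product_atlas A) (product_metric g) z u v = (christoffel_at A g (fst z) (fst u) (fst v), 0)"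
  by (rule christoffel_eqI[OF smooth_atlas_product[OF A] riemannian_metric_product[OF A g]])
    (simp add: dgm_product christoffel_koszul[OF A g] product_metric_def)

lemma has_covariant_derivative_product:
  assumes c: "curve_through (product_atlas A) S z v c"
    and V: "has_covariant_derivative A g (\<lambda>t. fst (c t)) V Z" and h: "(h has_real_derivative h') (at 0)"
  shows "has_covariant_derivative (product_atlas A) (product_metric g) c (\<lambda>t. (V t, h t)) (Z, h')"
proof -
  note P = smooth_atlas_product[OF A] and G = riemannian_metric_product[OF A g]
  have c1: "curve_through A UNIV (fst z) (fst v) (\<lambda>t. fst (c t))"
    using curve_through_map[OF P A c smooth_map_at_fst(1)[OF A]] by (simp add: smooth_map_at_fst(2)[OF A])
  have "((\<lambda>t. (to_chart A (A (fst z)) (fst (c t)) (V t), h t)) has_vector_derivative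
      (Z - christoffel_at A g (fst z) (fst v) (V 0), h')) (at 0)"
    using V h unfolding has_covariant_derivative_iff[OF A g c1] has_real_derivative_iff_has_vector_derivative
    by (intro has_vector_derivative_Pair)
  moreover have "\<forall>\<^sub>F t in nhds 0. (to_chart A (A (fst z)) (fst (c t)) (V t), h t) =
      to_chart (product_atlas A) (product_atlas A z) (c t) (V t, h t)"
    using curve_chart_eventually[OF A g c1]
    by eventually_elim (simp add: product_atlas_eq to_chart_product[OF A admissible_atlas[OF A]])
  ultimately have "((\<lambda>t. to_chart (product_atlas A) (product_atlas A z) (c t) (V t, h t)) has_vector_derivative
      (Z - christoffel_at A g (fst z) (fst v) (V 0), h')) (at 0)"
    by (rule has_vector_derivative_transfer)
  then show ?thesis
    unfolding has_covariant_derivative_iff[OF P G c] by (simp add: christoffel_product)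
qed

lemma vertical_parallel:
  assumes c: "curve_through (product_atlas A) S z v c"
  shows "has_covariant_derivative (product_atlas A) (product_metric g) c (\<lambda>_. vertical) 0"
proof -
  have c1: "curve_through A UNIV (fst z) (fst v) (\<lambda>t. fst (c t))"
    using curve_through_map[OF smooth_atlas_product[OF A] A c smooth_map_at_fst(1)[OF A]]
    by (simp add: smooth_map_at_fst(2)[OF A])
  from has_covariant_derivative_product[OF c has_covariant_derivative_zero[OF A g c1] DERIV_const[of 1]]
  show ?thesis by (simp add: vertical_def zero_prod_def)
qed

section \<open>Isometries\<close>

lemma isometry_diffeo: "isometry A g f \<Longrightarrow> diffeo A A UNIV UNIV f (inv f)"
  by (auto simp: isometry_def diffeo_def bij_def inv_f_f surj_f_inv_f)

context
  fixes f p \<phi>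
  assumes f: "isometry A g f"
  defines "\<phi> \<equiv> \<lambda>x. coord (A (f p)) (f (param (A p) x))"
begin

lemma isometry_smooth: "smooth_map_at A A q f"
  using diffeo_smooth(1)[OF A A isometry_diffeo[OF f]] by simp

lemma isometry_metric: "g (f q) (tangent_map A A f q v) (tangent_map A A f q w) = g q v w"
  using f by (simp add: isometry_def)

lemma isometry_coordinate:
  "smooth_at (coord (A p) p) \<phi>" "\<phi> (coord (A p) p) = coord (A (f p)) (f p)"
  "fd \<phi> (coord (A p) p) = tangent_map A A f p"
  using isometry_smooth[of p] param_coord[OF is_chart_atlas[OF A] in_atlas[OF A], of p]
  by (auto simp: smooth_map_at_def tangent_map_def o_def \<phi>_def)

lemma isometry_eventually:
  "\<forall>\<^sub>F q in nhds p. q \<in> cdom (A p) \<and> f q \<in> cdom (A (f p))"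
  using eventually_cdom[OF is_chart_atlas[OF A] in_atlas[OF A], of p]
    eventually_isCont[OF smooth_map_at_isCont[OF isometry_smooth[of p]]
      eventually_cdom[OF is_chart_atlas[OF A] in_atlas[OF A]]]
  by (rule eventually_conj)

lemma isometry_to_chart:
  assumes "q \<in> cdom (A p)" "f q \<in> cdom (A (f p))"
  shows "to_chart A (A (f p)) (f q) (tangent_map A A f q v) = fd \<phi> (coord (A p) q) (to_chart A (A p) q v)"
  unfolding \<phi>_def
  by (rule tangent_map_chart[OF A A admissible_atlas[OF A] assms(1) admissible_atlas[OF A] assms(2) isometry_smooth])

text \<open>Stated on a neighbourhood, not only at the base point, so that it can be
  differentiated.\<close>

lemma isometry_metric_in_chart:
  "\<forall>\<^sub>F y in nhds (coord (A p) p). metric_in_chart A g (A (f p)) (\<phi> y) (fd \<phi> y v) (fd \<phi> y w) =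
    metric_in_chart A g (A p) y v w"
proof -
  note cA = is_chart_atlas[OF A, of p] in_atlas[OF A, of p]
  show ?thesis
    using eventually_param[OF cA isometry_eventually] eventually_coord_image[OF cA]
  proof eventually_elim
    case (elim y)
    define q where "q = param (A p) y"
    have q: "q \<in> cdom (A p)" "f q \<in> cdom (A (f p))" "coord (A p) q = y"
      using elim by (auto simp: q_def coord_param)
    have "from_chart A (A (f p)) (f q) (fd \<phi> y u) = tangent_map A A f q (from_chart A (A p) q u)" for u
      using isometry_to_chart[OF q(1,2), of "from_chart A (A p) q u"]
        from_to_chart[OF A admissible_atlas[OF A] q(2)] q(3) to_from_chart[OF A admissible_atlas[OF A] q(1)]
      by metis
    moreover have "param (A (f p)) (\<phi> y) = f q"
      using q by (simp add: \<phi>_def q_def param_coord[OF is_chart_atlas[OF A]])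
    ultimately show ?case
      by (simp add: metric_in_chart_def isometry_metric q_def)
  qed
qed

text \<open>The pulled back metric coefficients are differentiated. Since
  \<open>fd \<phi> y v\<close> moves with \<open>y\<close>, second derivatives of \<phi> appear
  beside the derivative of the metric.\<close>

lemma dgm_isometry:
  "dgm A g p u v w =
    dgm A g (f p) (fd \<phi> (coord (A p) p) u) (fd \<phi> (coord (A p) p) v) (fd \<phi> (coord (A p) p) w) +
    g (f p) (fd (\<lambda>y. fd \<phi> y v) (coord (A p) p) u) (fd \<phi> (coord (A p) p) w) +
    g (f p) (fd \<phi> (coord (A p) p) v) (fd (\<lambda>y. fd \<phi> y w) (coord (A p) p) u)"
proof -
  note s = isometry_coordinate(1)
  have "fd (\<lambda>y. metric_in_chart A g (A p) y v w) (coord (A p) p) =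
      fd (\<lambda>y. metric_in_chart A g (A (f p)) (\<phi> y) (fd \<phi> y v) (fd \<phi> y w)) (coord (A p) p)"
    by (rule fd_cong[symmetric, OF isometry_metric_in_chart])
  also have "\<dots> = (\<lambda>u. dgm A g (f p) (fd \<phi> (coord (A p) p) u) (fd \<phi> (coord (A p) p) v) (fd \<phi> (coord (A p) p) w) +
    g (f p) (fd (\<lambda>y. fd \<phi> y v) (coord (A p) p) u) (fd \<phi> (coord (A p) p) w) +
    g (f p) (fd \<phi> (coord (A p) p) v) (fd (\<lambda>y. fd \<phi> y w) (coord (A p) p) u))"
    by (intro fd_eq has_derivative_metric_in_chart[OF A g] isometry_coordinate(2)
        smooth_at_has_derivative smooth_at_fd s)
  finally show ?thesis by simp
qed

lemma tangent_map_isometry: "linear (tangent_map A A f p)" "inj (tangent_map A A f p)" "surj (tangent_map A A f p)"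
proof -
  show l: "linear (tangent_map A A f p)" by (rule linear_tangent_map[OF isometry_smooth])
  show i: "inj (tangent_map A A f p)"
    by (rule inj_on_inverseI[of _ "tangent_map A A (inv f) (f p)"])
      (simp add: tangent_map_inverse[OF A A isometry_diffeo[OF f]])
  show "surj (tangent_map A A f p)" by (rule linear_inj_imp_surj[OF l i])
qed

text \<open>Transformation law of the Christoffel symbols. In the Koszul combination of three
  instances of \<open>dgm_isometry\<close> the second derivatives of \<phi> cancel by symmetry,
  except for twice the one in the directions \<open>u\<close> and \<open>v\<close>.\<close>

lemma christoffel_isometry:
  "tangent_map A A f p (christoffel_at A g p u v) = fd (\<lambda>y. fd \<phi> y v) (coord (A p) p) u +
    christoffel_at A g (f p) (tangent_map A A f p u) (tangent_map A A f p v)"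
proof -
  let ?D = "tangent_map A A f p" and ?H = "\<lambda>v u. fd (\<lambda>y. fd \<phi> y v) (coord (A p) p) u"
  have sym: "?H v u = ?H u v" for u v by (rule second_derivative_symmetric[OF isometry_coordinate(1)])
  have "christoffel_at A g (f p) (?D u) (?D v) = ?D (christoffel_at A g p u v) - ?H v u"
  proof (rule christoffel_eqI[OF A g])
    fix w'
    \<comment> \<open>The differential is onto, so testing against images of vectors at
      \<open>p\<close> suffices.\<close>
    obtain w where w: "w' = ?D w" using tangent_map_isometry(3) by (metis surjD)
    have 1: "2 * g (f p) (?D (christoffel_at A g p u v)) (?D w) = dgm A g p u v w + dgm A g p v u w - dgm A g p w u v"
      by (simp add: isometry_metric christoffel_koszul[OF A g])
    show "2 * g (f p) (?D (christoffel_at A g p u v) - ?H v u) w' =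
        dgm A g (f p) (?D u) (?D v) w' + dgm A g (f p) (?D v) (?D u) w' - dgm A g (f p) w' (?D u) (?D v)"
      unfolding w
      using 1 dgm_isometry[of v w u] dgm_isometry[of u w v] dgm_isometry[of u v w]
        sym[of u v] sym[of w u] sym[of w v]
        metric_commute[OF g, of "f p" "?D v" "?H w u"] metric_commute[OF g, of "f p" "?D u" "?H w v"]
      by (simp add: isometry_coordinate(3) metric_simps[OF g])
  qed
  then show ?thesis by simp
qed

text \<open>Along the curve the components of the pushed field are \<open>fd \<phi>\<close> at a
  moving point applied to moving components; the resulting second derivative term is exactly the one
  in \<open>christoffel_isometry\<close>.\<close>

lemma has_covariant_derivative_isometry:
  assumes c: "curve_through A S p v c" and V: "has_covariant_derivative A g c V Z"
  shows "has_covariant_derivative A g (\<lambda>t. f (c t)) (\<lambda>t. tangent_map A A f (c t) (V t)) (tangent_map A A f p Z)"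
proof -
  let ?D = "tangent_map A A f p" and ?x = "\<lambda>t. coord (A p) (c t)"
    and ?\<xi> = "\<lambda>t. to_chart A (A p) (c t) (V t)"
  have c0: "c 0 = p" and cd: "(?x has_derivative (\<lambda>t. t *\<^sub>R v)) (at 0)"
    using c by (auto simp: curve_through_def has_vector_derivative_def o_def)
  note fc = curve_through_map[OF A A c isometry_smooth order_refl]
  note s = isometry_coordinate(1)
  have \<xi>0: "?\<xi> 0 = V 0" by (simp add: c0 to_chart_self[OF A])
  define Y where "Y = Z - christoffel_at A g p v (V 0)"
  have \<xi>: "(?\<xi> has_derivative (\<lambda>t. t *\<^sub>R Y)) (at 0)"
    using V unfolding has_covariant_derivative_iff[OF A g c] has_vector_derivative_def Y_def .
  have d: "((\<lambda>t. fd \<phi> (?x t) b) has_derivative (\<lambda>t. fd (\<lambda>y. fd \<phi> y b) (coord (A p) p) (t *\<^sub>R v))) (at 0)" for b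
    using diff_chain_at[OF cd, of "\<lambda>y. fd \<phi> y b"] smooth_at_has_derivative[OF smooth_at_fd[OF s, of b]]
    by (simp add: c0 o_def)
  have "((\<lambda>t. \<Sum>b\<in>Basis. (?\<xi> t \<bullet> b) *\<^sub>R fd \<phi> (?x t) b) has_derivative
      (\<lambda>t. \<Sum>b\<in>Basis. (?\<xi> 0 \<bullet> b) *\<^sub>R fd (\<lambda>y. fd \<phi> y b) (coord (A p) p) (t *\<^sub>R v) +
        ((t *\<^sub>R Y) \<bullet> b) *\<^sub>R fd \<phi> (?x 0) b)) (at 0)"
    by (intro has_derivative_sum has_derivative_scaleR has_derivative_inner_left \<xi> d)
  also have "(\<lambda>t. \<Sum>b\<in>Basis. (?\<xi> 0 \<bullet> b) *\<^sub>R fd (\<lambda>y. fd \<phi> y b) (coord (A p) p) (t *\<^sub>R v) +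
        ((t *\<^sub>R Y) \<bullet> b) *\<^sub>R fd \<phi> (?x 0) b) = (\<lambda>t. t *\<^sub>R (fd (\<lambda>y. fd \<phi> y (V 0)) (coord (A p) p) v + ?D Y))"
  proof
    fix t
    \<comment> \<open>A derivative is linear in its outer direction; exchanging the two
      differentiations gives linearity in the inner direction \<open>b\<close>.\<close>
    have lin: "linear (\<lambda>b. fd (\<lambda>y. fd \<phi> y b) (coord (A p) p) v)"
      using second_derivative_symmetric[OF s, of _ v] smooth_at_linear_fd[OF smooth_at_fd[OF s, of v]]
      by simp
    have "fd (\<lambda>y. fd \<phi> y b) (coord (A p) p) (t *\<^sub>R v) = t *\<^sub>R fd (\<lambda>y. fd \<phi> y b) (coord (A p) p) v" for b
      by (rule linear_scale[OF smooth_at_linear_fd[OF smooth_at_fd[OF s]]])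
    then show "(\<Sum>b\<in>Basis. (?\<xi> 0 \<bullet> b) *\<^sub>R fd (\<lambda>y. fd \<phi> y b) (coord (A p) p) (t *\<^sub>R v) +
        ((t *\<^sub>R Y) \<bullet> b) *\<^sub>R fd \<phi> (?x 0) b) = t *\<^sub>R (fd (\<lambda>y. fd \<phi> y (V 0)) (coord (A p) p) v + ?D Y)"
      unfolding linear_basis_expansion[OF lin, of "V 0"]
        linear_basis_expansion[OF tangent_map_isometry(1), of Y]
      by (simp add: c0 \<xi>0 to_chart_self[OF A] isometry_coordinate(3) sum.distrib scaleR_add_right scaleR_sum_right mult.commute)
  qed
  finally have "((\<lambda>t. \<Sum>b\<in>Basis. (?\<xi> t \<bullet> b) *\<^sub>R fd \<phi> (?x t) b) has_vector_derivative
      fd (\<lambda>y. fd \<phi> y (V 0)) (coord (A p) p) v + ?D Y) (at 0)"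
    by (simp add: has_vector_derivative_def)
  moreover have "\<forall>\<^sub>F t in nhds 0. (\<Sum>b\<in>Basis. (?\<xi> t \<bullet> b) *\<^sub>R fd \<phi> (?x t) b) =
      to_chart A (A (f p)) (f (c t)) (tangent_map A A f (c t) (V t))"
  proof -
    have "\<forall>\<^sub>F t in nhds 0. smooth_at (?x t) \<phi>"
      using eventually_isCont[OF has_derivative_continuous[OF cd]] smooth_at_eventually[OF s] by (simp add: c0)
    with curve_eventually[OF c isometry_eventually] show ?thesis
      by eventually_elim (simp add: isometry_to_chart linear_basis_expansion[OF smooth_at_linear_fd, symmetric])
  qed
  ultimately have "((\<lambda>t. to_chart A (A (f p)) (f (c t)) (tangent_map A A f (c t) (V t)))
      has_vector_derivative fd (\<lambda>y. fd \<phi> y (V 0)) (coord (A p) p) v + ?D Y) (at 0)"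
    by (rule has_vector_derivative_transfer)
  moreover have "fd (\<lambda>y. fd \<phi> y (V 0)) (coord (A p) p) v + ?D Y =
      ?D Z - christoffel_at A g (f p) (?D v) (?D (V 0))"
    using christoffel_isometry[of v "V 0"]
    by (simp add: Y_def linear_diff[OF tangent_map_isometry(1)])
  ultimately show ?thesis
    unfolding has_covariant_derivative_iff[OF A g fc] by (simp add: c0)
qed

end

lemma subspace_normal_complement: "subspace {v. g p u v = 0}"
  by (auto simp: subspace_def metric_simps[OF g])

lemma unit_normal_field_isometry:
  assumes f: "isometry A g f" and N: "unit_normal_field A g S N"
  shows "unit_normal_field A g (f ` S) (push_field A A f (inv f) N)"
  unfolding unit_normal_field_def
proof (intro conjI ballI)
  note d = isometry_diffeo[OF f]
  show "smooth_field_along A (f ` S) (push_field A A f (inv f) N)"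
    using smooth_field_along_push[OF A A d, of S N] N by (simp add: unit_normal_field_def)
  fix q assume "q \<in> f ` S"
  then obtain p where p: "p \<in> S" "q = f p" by blast
  have push: "push_field A A f (inv f) N q = tangent_map A A f p (N p)"
    using diffeo_simps(3)[OF A A d, of p] by (simp add: push_field_def p(2))
  show "g q (push_field A A f (inv f) N q) (push_field A A f (inv f) N q) = 1"
    using N p(1) unfolding push by (simp add: p(2) isometry_metric[OF f] unit_normal_field_def)
  fix v assume "v \<in> tangent_space A (f ` S) q"
  then obtain u where "u \<in> tangent_space A S p" "v = tangent_map A A f p u"
    using tangent_space_image[OF A A d _ p(1)] p(2) by auto
  then show "g q (push_field A A f (inv f) N q) v = 0"
    using N p(1) unfolding push by (simp add: p(2) isometry_metric[OF f] unit_normal_field_def)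
qed

lemma minimal_hypersurface_isometry:
  assumes f: "isometry A g f" and S: "minimal_hypersurface A g S N"
  shows "minimal_hypersurface A g (f ` S) (push_field A A f (inv f) N)"
  unfolding minimal_hypersurface_def
proof (intro conjI ballI)
  let ?M = "push_field A A f (inv f) N"
  note d = isometry_diffeo[OF f]
  have hS: "hypersurface A S" and N: "unit_normal_field A g S N" using S by (auto simp: minimal_hypersurface_def)
  show hfS: "hypersurface A (f ` S)" using hypersurface_image[OF A A d hS] by simp
  show M: "unit_normal_field A g (f ` S) ?M" by (rule unit_normal_field_isometry[OF f N])
  fix q assume "q \<in> f ` S"
  then obtain p where p: "p \<in> S" "q = f p" by blast
  let ?D = "tangent_map A A f p"
  note D = tangent_map_isometry[OF f, of p]
  obtain L where L: "linear L" "covariant_differential A g S N p L"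
    using smooth_field_covariant_differential[OF A g p(1)] N unfolding unit_normal_field_def by metis
  have qS: "q \<in> f ` S" using p by blast
  obtain L' where L': "linear L'" "covariant_differential A g (f ` S) ?M q L'"
    using smooth_field_covariant_differential[OF A g qS] M unfolding unit_normal_field_def by metis
  note T = tangent_space_eq_normal_complement[OF A g hS N p(1)]
  have TT: "tangent_space A (f ` S) q = ?D ` tangent_space A S p"
    using tangent_space_image[OF A A d _ p(1)] p(2) by simp
  have sub: "subspace (tangent_space A S p)" unfolding T by (rule subspace_normal_complement)
  have subq: "subspace (tangent_space A (f ` S) q)" unfolding TT by (rule linear_subspace_image[OF D(1) sub])
  \<comment> \<open>The shape operators of \<open>S\<close> and of its image are conjugate by the
    differential of \<open>f\<close>: the image of one curve computes both sides, and covariant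
    derivatives are unique.\<close>
  have eq: "L' (?D v) = ?D (L v)" if v: "v \<in> tangent_space A S p" for v
  proof -
    obtain c where c: "curve_through A S p v c" using v by (auto simp: tangent_space_def)
    note fc = curve_through_map[OF A A c isometry_smooth[OF f] order_refl]
    have "has_covariant_derivative A g (\<lambda>t. f (c t)) (\<lambda>t. tangent_map A A f (c t) (N (c t))) (?D (L v))"
      using has_covariant_derivative_isometry[OF f c, of "N \<circ> c"] L(2) c
      by (simp add: covariant_differential_def o_def)
    moreover have "has_covariant_derivative A g (\<lambda>t. f (c t)) (?M \<circ> (\<lambda>t. f (c t))) (L' (?D v))"
      using L'(2) fc unfolding covariant_differential_def p(2) by blast
    moreover have "?M \<circ> (\<lambda>t. f (c t)) = (\<lambda>t. tangent_map A A f (c t) (N (c t)))"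
      using diffeo_simps(3)[OF A A d] by (simp add: push_field_def fun_eq_iff)
    ultimately show ?thesis using covariant_derivative_unique[OF A g fc] by metis
  qed
  have LT: "(\<lambda>v. - L v) ` tangent_space A S p \<subseteq> tangent_space A S p"
  proof safe
    fix v assume "v \<in> tangent_space A S p"
    from covariant_differential_normal[OF A g N p(1) L(2) this]
    show "- L v \<in> tangent_space A S p" unfolding T by (simp add: metric_simps[OF g])
  qed
  have "mean_curvature A g (f ` S) ?M q = trace_on (?D ` tangent_space A S p) (\<lambda>v. - L' v)"
    unfolding mean_curvature_def
    by (subst trace_on_cong[OF subq shape_operator_eq[OF A g L'(2)]]) (simp_all add: TT)
  also have "\<dots> = trace_on (tangent_space A S p) (\<lambda>v. - L v)"
    using L(1) L'(1) by (intro trace_on_image D sub LT)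
      (auto simp: eq linear_neg[OF D(1)] linear_compose_neg)
  also have "\<dots> = mean_curvature A g S N p"
    unfolding mean_curvature_def
    by (rule trace_on_cong[OF sub, symmetric]) (rule shape_operator_eq[OF A g L(2)])
  finally show "mean_curvature A g (f ` S) ?M q = 0"
    using S p(1) by (simp add: minimal_hypersurface_def)
qed

end

section \<open>Gradients on hypersurfaces\<close>

lemma grad_works:
  assumes A: "smooth_atlas A" and g: "riemannian_metric A g" and S: "hypersurface A S"
    and N: "unit_normal_field A g S N" and h: "smooth_fun_along A S h" and p: "p \<in> S"
  shows "grad A g S h p \<in> tangent_space A S p \<and>
    (\<forall>w c. curve_through A S p w c \<longrightarrow> ((h \<circ> c) has_real_derivative g p (grad A g S h p) w) (at 0))"
  unfolding grad_def
proof (rule theI')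
  note T = tangent_space_eq_normal_complement[OF A g S N p] and m = metric_simps[OF g]
  obtain l where l: "linear l"
    "\<And>c v. curve_through A S p v c \<Longrightarrow> ((\<lambda>t. h (c t)) has_real_derivative l v) (at 0)"
    using smooth_fun_along_curve[OF A p h] by metis
  obtain r where r: "\<And>w. g p r w = l w"
    using bilinear_form_represents[of "g p", OF _ metric_pos[OF g] l(1)] g
    by (auto simp: riemannian_metric_def)
  \<comment> \<open>The vector representing the extended differential need not be tangent. Removing
    its normal component does not change its products with tangent vectors.\<close>
  define r' where "r' = r - g p (N p) r *\<^sub>R N p"
  have "g p (N p) (N p) = 1" using N p by (simp add: unit_normal_field_def)
  then have r'T: "r' \<in> tangent_space A S p" unfolding T by (simp add: r'_def m)
  have r'l: "g p r' w = l w" if "w \<in> tangent_space A S p" for w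
    using that unfolding T by (simp add: r'_def m r)
  show "\<exists>!v. v \<in> tangent_space A S p \<and>
      (\<forall>w c. curve_through A S p w c \<longrightarrow> ((h \<circ> c) has_real_derivative g p v w) (at 0))"
  proof (rule ex1I[of _ r'])
    show "r' \<in> tangent_space A S p \<and>
        (\<forall>w c. curve_through A S p w c \<longrightarrow> ((h \<circ> c) has_real_derivative g p r' w) (at 0))"
      using r'T r'l l(2) by (fastforce simp: tangent_space_def o_def)
  next
    fix v assume v: "v \<in> tangent_space A S p \<and>
        (\<forall>w c. curve_through A S p w c \<longrightarrow> ((h \<circ> c) has_real_derivative g p v w) (at 0))"
    \<comment> \<open>The difference of two candidates is itself tangent, so a curve with this
      velocity tests them against each other.\<close>
    have vT: "v - r' \<in> tangent_space A S p" using v r'T unfolding T by (simp add: m)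
    then obtain c where c: "curve_through A S p (v - r') c" by (auto simp: tangent_space_def)
    have "((h \<circ> c) has_real_derivative g p v (v - r')) (at 0)" using v c by blast
    from DERIV_unique[OF this[unfolded o_def] l(2)[OF c]] have "g p v (v - r') = l (v - r')" .
    then have "g p (v - r') (v - r') = 0" using r'l[OF vT] by (simp add: m)
    then show "v = r'" by (simp add: metric_eq_0_iff[OF g])
  qed
qed

section \<open>Twistings\<close>

lemma smooth_field_along_cong:
  assumes X: "smooth_field_along A S X" and eq: "\<And>q. q \<in> S \<Longrightarrow> X q = Y q"
  shows "smooth_field_along A S Y"
  unfolding smooth_field_along_def
proof
  fix p assume "p \<in> S"
  then obtain W Z where "p \<in> W" "smooth_vector_field_on A W Z" "\<forall>q\<in>S \<inter> W. X q = Z q"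
    using X unfolding smooth_field_along_def by meson
  then show "\<exists>W Z. p \<in> W \<and> smooth_vector_field_on A W Z \<and> (\<forall>q\<in>S \<inter> W. Y q = Z q)"
    using eq by (intro exI[of _ W] exI[of _ Z]) (metis IntD1)
qed

lemma smooth_map_at_const: "smooth_map_at D A p (\<lambda>_. q)" "tangent_map D A (\<lambda>_. q) p v = 0"
  by (simp_all add: smooth_map_at_def tangent_map_def o_def)

lemma velocity_eq_tangent_map:
  assumes "smooth_map_at real_atlas A s c"
  shows "velocity A c s = tangent_map real_atlas A c s 1"
proof -
  have s: "smooth_at s (\<lambda>t. coord (A (c s)) (c t))"
    using assms by (simp add: smooth_map_at_def real_atlas_def)
  have "fd (\<lambda>t. coord (A (c s)) (c t)) s = (\<lambda>r. r *\<^sub>R fd (\<lambda>t. coord (A (c s)) (c t)) s 1)"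
  proof
    show "fd (\<lambda>t. coord (A (c s)) (c t)) s r = r *\<^sub>R fd (\<lambda>t. coord (A (c s)) (c t)) s 1" for r
      using linear_scale[OF smooth_at_linear_fd[OF s], of r 1] by (simp only: real_scaleR_def mult_1_right)
  qed
  then have "((\<lambda>t. coord (A (c s)) (c t)) has_vector_derivative fd (\<lambda>t. coord (A (c s)) (c t)) s 1) (at s)"
    unfolding has_vector_derivative_def using smooth_at_has_derivative[OF s] by simp
  from vector_derivative_at[OF this] show ?thesis
    by (simp add: velocity_def tangent_map_def real_atlas_def o_def)
qed

section \<open>The diffeomorphism underlying a twisting\<close>

definition twist :: "real \<Rightarrow> (real \<Rightarrow> 'm \<Rightarrow> 'm) \<Rightarrow> 'm \<times> real \<Rightarrow> 'm \<times> real" where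
  "twist a \<Gamma> z = (\<Gamma> (snd z) (fst z), a * snd z)"

definition untwist :: "real \<Rightarrow> (real \<Rightarrow> 'm \<Rightarrow> 'm) \<Rightarrow> 'm \<times> real \<Rightarrow> 'm \<times> real" where
  "untwist a \<Gamma> z = (inv (\<Gamma> (snd z / a)) (fst z), snd z / a)"

context
  fixes A :: "('m::{t2_space, second_countable_topology}, 'e::euclidean_space) atlas"
    and g :: "('m, 'e) metric"
    and S0 :: "'m set" and \<eta> :: "'m \<Rightarrow> 'e"
    and I :: "real set" and \<Gamma> :: "real \<Rightarrow> 'm \<Rightarrow> 'm" and a :: real
    and P G \<Sigma> \<nu>
  assumes A: "smooth_atlas A" and g: "riemannian_metric A g"
    and S0: "hypersurface A S0" and \<eta>: "unit_normal_field A g S0 \<eta>"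
    and \<Gamma>: "one_parameter_isometry_group A g I \<Gamma>" and a: "a > 0"
  defines "P \<equiv> product_atlas A" and "G \<equiv> product_metric g"
    and "\<Sigma> \<equiv> twisting a I \<Gamma> S0" and "\<nu> \<equiv> twisting_nu A g a \<Gamma> \<eta>"
begin

lemma smooth_atlas_P: "smooth_atlas P" unfolding P_def by (rule smooth_atlas_product[OF A])

lemma riemannian_metric_G: "riemannian_metric P G" unfolding P_def G_def by (rule riemannian_metric_product[OF A g])

lemma G_eq: "G z u v = g (fst z) (fst u) (fst v) + snd u * snd v"
  by (simp add: G_def product_metric_def)

lemma group_isometry: "s \<in> I \<Longrightarrow> isometry A g (\<Gamma> s)"
  and group_open: "open I" and group_0: "0 \<in> I" "\<Gamma> 0 = id"
  and group_add: "s \<in> I \<Longrightarrow> t \<in> I \<Longrightarrow> s + t \<in> I \<Longrightarrow> \<Gamma> (s + t) = \<Gamma> s \<circ> \<Gamma> t"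
  using \<Gamma> by (auto simp: one_parameter_isometry_group_def)

lemma group_bij: "s \<in> I \<Longrightarrow> bij (\<Gamma> s)"
  using group_isometry by (simp add: isometry_def)

lemma inv_group: "s \<in> I \<Longrightarrow> inv (\<Gamma> s) (\<Gamma> s x) = x" "s \<in> I \<Longrightarrow> \<Gamma> s (inv (\<Gamma> s) x) = x"
  using group_bij[of s] by (simp_all add: bij_def surj_f_inv_f)

lemma group_smooth: "snd z \<in> I \<Longrightarrow> smooth_map_at P A z (\<lambda>z. \<Gamma> (snd z) (fst z))"
proof -
  have "smooth_map_on P A (UNIV \<times> I) (\<lambda>(p, s). \<Gamma> s p)"
    using \<Gamma> by (simp add: one_parameter_isometry_group_def P_def)
  moreover have "(\<lambda>(p, s). \<Gamma> s p) = (\<lambda>z. \<Gamma> (snd z) (fst z))" by auto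
  ultimately show "snd z \<in> I \<Longrightarrow> smooth_map_at P A z (\<lambda>z. \<Gamma> (snd z) (fst z))"
    by (cases z) (auto simp: smooth_map_on_iff[OF smooth_atlas_P A])
qed

text \<open>By linearity the differential splits into partial ones, found by composing with the
  inclusions of the slice at height \<open>snd z\<close> and of the vertical line through
  \<open>fst z\<close>.\<close>

lemma group_tangent_map:
  assumes s: "snd z \<in> I"
  shows "tangent_map P A (\<lambda>z. \<Gamma> (snd z) (fst z)) z v =
    tangent_map A A (\<Gamma> (snd z)) (fst z) (fst v) + snd v *\<^sub>R velocity A (\<lambda>\<sigma>. \<Gamma> \<sigma> (fst z)) (snd z)"
proof -
  let ?D = "tangent_map P A (\<lambda>z. \<Gamma> (snd z) (fst z)) z"
  have lin: "linear ?D" by (rule linear_tangent_map[OF group_smooth[OF s]])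
  have "v = (fst v, 0) + snd v *\<^sub>R (0, 1)" by (simp add: prod_eq_iff)
  then have "?D v = ?D (fst v, 0) + snd v *\<^sub>R ?D (0, 1)"
    using linear_add[OF lin, of "(fst v, 0)" "snd v *\<^sub>R (0, 1)"] linear_scale[OF lin, of "snd v" "(0, 1)"]
    by metis
  moreover have "?D (fst v, 0) = tangent_map A A (\<Gamma> (snd z)) (fst z) (fst v)"
  proof -
    have 1: "smooth_map_at A P (fst z) (\<lambda>q. (q, snd z))"
      "tangent_map A P (\<lambda>q. (q, snd z)) (fst z) (fst v) = (fst v, 0)"
      using smooth_map_at_Pair[OF smooth_map_at_ident[OF A] smooth_map_at_const_real[OF A]]
      by (simp_all add: P_def tangent_map_ident[OF A] tangent_map_const_real)
    show ?thesis
      using smooth_map_at_compose(2)[OF A smooth_atlas_P A 1(1), of "\<lambda>z. \<Gamma> (snd z) (fst z)" "fst v"] group_smooth s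
      by (simp add: 1(2))
  qed
  moreover have "?D (0, 1) = velocity A (\<lambda>\<sigma>. \<Gamma> \<sigma> (fst z)) (snd z)"
  proof -
    have id: "smooth_map_at real_atlas real_atlas (snd z) (\<lambda>\<sigma>. \<sigma>)"
      "tangent_map real_atlas real_atlas (\<lambda>\<sigma>. \<sigma>) (snd z) 1 = 1"
      using smooth_map_at_ident[OF smooth_atlas_real] tangent_map_ident[OF smooth_atlas_real] by auto
    have 1: "smooth_map_at real_atlas P (snd z) (\<lambda>\<sigma>. (fst z, \<sigma>))"
      "tangent_map real_atlas P (\<lambda>\<sigma>. (fst z, \<sigma>)) (snd z) 1 = (0, 1)"
      using smooth_map_at_Pair[OF smooth_map_at_const(1)[of real_atlas A "snd z" "fst z"] id(1)]
      by (simp_all add: P_def id(2) smooth_map_at_const(2))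
    show ?thesis
      using smooth_map_at_compose[OF smooth_atlas_real smooth_atlas_P A 1(1), of "\<lambda>z. \<Gamma> (snd z) (fst z)"] group_smooth s
      by (simp add: 1(2) velocity_eq_tangent_map)
  qed
  ultimately show ?thesis by simp
qed

lemma twist_smooth:
  assumes "snd z \<in> I"
  shows "smooth_map_at P P z (twist a \<Gamma>)"
    "tangent_map P P (twist a \<Gamma>) z v = (tangent_map A A (\<Gamma> (snd z)) (fst z) (fst v) +
      snd v *\<^sub>R velocity A (\<lambda>\<sigma>. \<Gamma> \<sigma> (fst z)) (snd z), a * snd v)"
proof -
  have h: "smooth_map_at P real_atlas z (\<lambda>z. a * snd z)"
    "tangent_map P real_atlas (\<lambda>z. a * snd z) z v = a * snd v"
    using smooth_map_at_affine[OF smooth_atlas_P, of z snd a 0] smooth_map_at_snd[OF A]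
    by (simp_all add: P_def)
  have "twist a \<Gamma> = (\<lambda>z. (\<Gamma> (snd z) (fst z), a * snd z))" by (simp add: twist_def fun_eq_iff)
  then show "smooth_map_at P P z (twist a \<Gamma>)"
    "tangent_map P P (twist a \<Gamma>) z v = (tangent_map A A (\<Gamma> (snd z)) (fst z) (fst v) +
      snd v *\<^sub>R velocity A (\<lambda>\<sigma>. \<Gamma> \<sigma> (fst z)) (snd z), a * snd v)"
    using smooth_map_at_Pair[OF group_smooth[OF assms] h(1)] h(2) group_tangent_map[OF assms, of v]
    by (simp_all add: P_def)
qed

text \<open>
  As \<open>I\<close> need not be symmetric, \<open>\<Gamma> (- s)\<close> may be junk; the inverse of \<open>\<Gamma> s\<close> is therefore written
  near \<open>s\<^sub>0\<close> as \<open>inv (\<Gamma> s\<^sub>0) \<circ> \<Gamma> (s\<^sub>0 - s)\<close>.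
\<close>

lemma untwist_smooth:
  assumes s0: "snd z / a \<in> I"
  shows "smooth_map_at P P z (untwist a \<Gamma>)"
proof -
  define s0 where "s0 = snd z / a"
  have s0I: "s0 \<in> I" using s0 by (simp add: s0_def)
  have r: "smooth_map_at P real_atlas z (\<lambda>y. snd y / a)"
    using smooth_map_at_affine(1)[OF smooth_atlas_P, of z snd "1 / a" 0] smooth_map_at_snd(1)[OF A]
    by (simp add: P_def)
  have r': "smooth_map_at P real_atlas z (\<lambda>y. s0 - snd y / a)"
    using smooth_map_at_affine(1)[OF smooth_atlas_P r, of "- 1" s0] by simp
  have 1: "smooth_map_at P P z (\<lambda>y. (fst y, s0 - snd y / a))"
    using smooth_map_at_Pair(1)[OF smooth_map_at_fst(1)[OF A], of z] r' by (simp add: P_def)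
  have 2: "smooth_map_at P A z (\<lambda>y. \<Gamma> (s0 - snd y / a) (fst y))"
    using smooth_map_at_compose(1)[OF smooth_atlas_P smooth_atlas_P A 1, of "\<lambda>z. \<Gamma> (snd z) (fst z)"] group_smooth group_0
    by (simp add: s0_def)
  have "smooth_map_at A A q (inv (\<Gamma> s0))" for q
    using diffeo_smooth(2)[OF A A isometry_diffeo[OF A g group_isometry[OF s0I]]] by simp
  then have 3: "smooth_map_at P A z (\<lambda>y. inv (\<Gamma> s0) (\<Gamma> (s0 - snd y / a) (fst y)))"
    using smooth_map_at_compose(1)[OF smooth_atlas_P A A 2] by blast
  have cont: "isCont (\<lambda>y::'m \<times> real. snd y / a) z" "isCont (\<lambda>y::'m \<times> real. snd y / a - s0) z"
    "isCont (\<lambda>y::'m \<times> real. s0 - snd y / a) z"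
    using a by (auto intro!: continuous_intros)
  \<comment> \<open>The group law is only available for parameters in \<open>I\<close>. Near
    \<open>z\<close> this holds for \<open>snd y / a\<close> and for its difference from
    \<open>s0\<close> with either sign, because \<open>I\<close> is open and contains
    \<open>s0\<close> and 0.\<close>
  have "\<forall>\<^sub>F y in nhds z. snd y / a \<in> I" "\<forall>\<^sub>F y in nhds z. snd y / a - s0 \<in> I" "\<forall>\<^sub>F y in nhds z. s0 - snd y / a \<in> I"
    using eventually_isCont[OF cont(1), of "\<lambda>r. r \<in> I"] eventually_isCont[OF cont(2), of "\<lambda>r. r \<in> I"]
      eventually_isCont[OF cont(3), of "\<lambda>r. r \<in> I"] eventually_nhds_in_open[OF group_open] s0I group_0(1)
    by (simp_all add: s0_def)
  then have "\<forall>\<^sub>F y in nhds z. inv (\<Gamma> s0) (\<Gamma> (s0 - snd y / a) (fst y)) = inv (\<Gamma> (snd y / a)) (fst y)"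
  proof eventually_elim
    case (elim y)
    define u where "u = snd y / a - s0"
    have u: "u \<in> I" "- u \<in> I" "u + s0 \<in> I" "snd y / a = u + s0" "s0 - snd y / a = - u"
      using elim by (simp_all add: u_def)
    have "\<Gamma> u (\<Gamma> (- u) x) = x" "\<Gamma> (- u) (\<Gamma> u x) = x" for x
      using group_add[of u "- u"] group_add[of "- u" u] u group_0 by (auto simp: fun_eq_iff)
    then have "\<Gamma> (u + s0) (inv (\<Gamma> s0) (\<Gamma> (- u) (fst y))) = fst y"
      using group_add[OF u(1) s0I u(3)] by (simp add: inv_group[OF s0I])
    then have "inv (\<Gamma> s0) (\<Gamma> (- u) (fst y)) = inv (\<Gamma> (u + s0)) (fst y)"
      using inv_group(1)[OF u(3)] by metis
    then show ?case by (simp add: u(4,5))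
  qed
  then have 4: "smooth_map_at P A z (\<lambda>y. inv (\<Gamma> (snd y / a)) (fst y))"
    by (rule smooth_map_at_cong(1)[OF smooth_atlas_P 3])
  have "untwist a \<Gamma> = (\<lambda>y. (inv (\<Gamma> (snd y / a)) (fst y), snd y / a))" by (simp add: untwist_def fun_eq_iff)
  then show ?thesis using smooth_map_at_Pair(1)[OF 4 r] by (simp add: P_def)
qed

text \<open>The parametrization is extended from \<open>S0 \<times> I\<close> to
  \<open>UNIV \<times> I\<close>, because slice charts and vector fields of the cylinder over
  \<open>S0\<close> are carried over by a diffeomorphism of open sets.\<close>

lemma twist_diffeo: "diffeo P P (UNIV \<times> I) (UNIV \<times> {t. t / a \<in> I}) (twist a \<Gamma>) (untwist a \<Gamma>)"
proof -
  have "{t. t / a \<in> I} = (\<lambda>t. t / a) -` I" by auto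
  moreover have "open ((\<lambda>t. t / a) -` I)"
    by (rule open_vimage[OF group_open]) (use a in \<open>auto intro!: continuous_intros\<close>)
  ultimately have "open {t. t / a \<in> I}" by simp
  then show ?thesis
    unfolding diffeo_def smooth_map_on_iff[OF smooth_atlas_P smooth_atlas_P] using a
    by (auto simp: twist_smooth untwist_smooth open_Times group_open twist_def untwist_def inv_group)
qed

lemma twisting_eq: "\<Sigma> = twist a \<Gamma> ` ((S0 \<times> UNIV) \<inter> (UNIV \<times> I))"
  by (force simp: \<Sigma>_def twisting_def twist_def)

lemma in_twisting: "z \<in> \<Sigma> \<longleftrightarrow> snd z / a \<in> I \<and> inv (\<Gamma> (snd z / a)) (fst z) \<in> S0"
proof
  assume "z \<in> \<Sigma>"
  then show "snd z / a \<in> I \<and> inv (\<Gamma> (snd z / a)) (fst z) \<in> S0"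
    using a by (auto simp: \<Sigma>_def twisting_def inv_group)
next
  assume *: "snd z / a \<in> I \<and> inv (\<Gamma> (snd z / a)) (fst z) \<in> S0"
  then have "z = (\<Gamma> (snd z / a) (inv (\<Gamma> (snd z / a)) (fst z)), a * (snd z / a))"
    using a by (simp add: inv_group)
  then show "z \<in> \<Sigma>" unfolding \<Sigma>_def twisting_def using * by blast
qed

section \<open>Normal and tangent vectors of the twisting\<close>

lemma hypersurface_twisting: "hypersurface P \<Sigma>"
  unfolding twisting_eq
  by (rule hypersurface_image[OF smooth_atlas_P smooth_atlas_P twist_diffeo]) (simp add: P_def hypersurface_times_UNIV[OF A S0])

lemma unit_normal_field_times: "unit_normal_field P G (S0 \<times> UNIV) (\<lambda>y. (\<eta> (fst y), 0))"
  using \<eta> smooth_field_along_Pair[OF A, of S0 \<eta> 0]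
  by (auto simp: unit_normal_field_def P_def tangent_space_times_UNIV[OF A] G_eq)

definition lift_normal :: "'m \<times> real \<Rightarrow> 'e" where
  "lift_normal z = pushed_normal A \<Gamma> \<eta> (snd z / a) (fst z)"

definition orbit_velocity :: "'m \<times> real \<Rightarrow> 'e" where
  "orbit_velocity z = velocity A (\<lambda>\<sigma>. \<Gamma> \<sigma> (inv (\<Gamma> (snd z / a)) (fst z))) (snd z / a)"

lemma nu_eq: "\<nu> z = g (fst z) (lift_normal z) (orbit_velocity z)"
  by (simp add: \<nu>_def twisting_nu_def Let_def lift_normal_def orbit_velocity_def metric_commute[OF g])

text \<open>Both fields on the twisting are pushforwards under \<open>twist\<close>, of the normal
  of the cylinder and of the vertical field; their smoothness, and then that of \<nu>, is obtained
  from this.\<close>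

lemma push_twist:
  assumes "z \<in> \<Sigma>"
  shows "push_field P P (twist a \<Gamma>) (untwist a \<Gamma>) (\<lambda>y. (\<eta> (fst y), 0)) z = (lift_normal z, 0)"
    and "push_field P P (twist a \<Gamma>) (untwist a \<Gamma>) (\<lambda>y. vertical) z = (orbit_velocity z, a)"
proof -
  let ?y = "untwist a \<Gamma> z"
  have "snd ?y \<in> I" using assms by (simp add: in_twisting untwist_def)
  note t = twist_smooth(2)[OF this] linear_0[OF linear_tangent_map[OF isometry_smooth[OF A g group_isometry[OF this]]]]
  show "push_field P P (twist a \<Gamma>) (untwist a \<Gamma>) (\<lambda>y. (\<eta> (fst y), 0)) z = (lift_normal z, 0)"
    by (simp add: push_field_def t) (simp add: untwist_def lift_normal_def pushed_normal_def Let_def)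
  show "push_field P P (twist a \<Gamma>) (untwist a \<Gamma>) (\<lambda>y. vertical) z = (orbit_velocity z, a)"
    by (simp add: push_field_def t vertical_def) (simp add: untwist_def orbit_velocity_def)
qed

lemma smooth_lift_normal: "smooth_field_along P \<Sigma> (\<lambda>z. (lift_normal z, 0))"
proof -
  have "smooth_field_along P \<Sigma> (push_field P P (twist a \<Gamma>) (untwist a \<Gamma>) (\<lambda>y. (\<eta> (fst y), 0)))"
    unfolding twisting_eq using unit_normal_field_times
    by (intro smooth_field_along_push[OF smooth_atlas_P smooth_atlas_P twist_diffeo]) (simp add: unit_normal_field_def)
  then show ?thesis by (rule smooth_field_along_cong) (simp add: push_twist)
qed

lemma smooth_orbit_velocity: "smooth_field_along P \<Sigma> (\<lambda>z. (orbit_velocity z, a))"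
proof -
  have "smooth_field_along P \<Sigma> (push_field P P (twist a \<Gamma>) (untwist a \<Gamma>) (\<lambda>y. vertical))"
    unfolding twisting_eq
    by (intro smooth_field_along_push[OF smooth_atlas_P smooth_atlas_P twist_diffeo]) (simp add: P_def smooth_field_along_vertical[OF A])
  then show ?thesis by (rule smooth_field_along_cong) (simp add: push_twist)
qed

lemma smooth_nu: "smooth_fun_along P \<Sigma> \<nu>"
proof -
  have "\<nu> = (\<lambda>z. G z (lift_normal z, 0) (orbit_velocity z, a))" by (simp add: fun_eq_iff G_eq nu_eq)
  then show ?thesis using smooth_fun_along_metric[OF smooth_atlas_P riemannian_metric_G smooth_lift_normal smooth_orbit_velocity] by simp
qed

text \<open>The tangent space of the cylinder is the complement of \<open>\<eta> p\<close> times the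
  line, and the differential of \<open>twist\<close> sends its vertical direction to
  \<open>(orbit_velocity z, a)\<close>.\<close>

lemma tangent_space_twisting:
  assumes z: "z \<in> \<Sigma>"
  defines "p \<equiv> inv (\<Gamma> (snd z / a)) (fst z)"
  shows "tangent_space P \<Sigma> z = {(tangent_map A A (\<Gamma> (snd z / a)) p u + r *\<^sub>R orbit_velocity z, a * r) | u r.
    g p (\<eta> p) u = 0}"
proof -
  let ?y = "(p, snd z / a)"
  have zI: "snd z / a \<in> I" and p: "p \<in> S0" using z by (auto simp: in_twisting p_def)
  let ?X = "(S0 \<times> UNIV) \<inter> (UNIV \<times> I)"
  have X: "hypersurface P ?X"
    using hypersurface_Int_open[OF smooth_atlas_P, of "S0 \<times> UNIV" "UNIV \<times> I"] hypersurface_times_UNIV[OF A S0]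
    by (simp add: P_def open_Times group_open)
  have yX: "?y \<in> ?X" using p zI by simp
  have zy: "z = twist a \<Gamma> ?y" using a zI by (simp add: twist_def p_def inv_group prod_eq_iff)
  have "unit_normal_field P G ?X (\<lambda>y. (\<eta> (fst y), 0))"
    by (rule unit_normal_field_subset[OF unit_normal_field_times]) auto
  from tangent_space_eq_normal_complement[OF smooth_atlas_P riemannian_metric_G X this yX]
  have TX: "tangent_space P ?X ?y = {v. g p (\<eta> p) (fst v) = 0}" by (simp add: G_eq)
  have "tangent_space P \<Sigma> (twist a \<Gamma> ?y) = tangent_map P P (twist a \<Gamma>) ?y ` tangent_space P ?X ?y"
    unfolding twisting_eq by (rule tangent_space_image[OF smooth_atlas_P smooth_atlas_P twist_diffeo _ yX]) auto
  then have "tangent_space P \<Sigma> z = tangent_map P P (twist a \<Gamma>) ?y ` {v. g p (\<eta> p) (fst v) = 0}"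
    by (simp only: zy[symmetric] TX)
  also have "\<dots> = {(tangent_map A A (\<Gamma> (snd z / a)) p u + r *\<^sub>R orbit_velocity z, a * r) | u r.
    g p (\<eta> p) u = 0}"
    using zI by (auto simp: twist_smooth(2)[of ?y] orbit_velocity_def p_def[symmetric] image_iff) blast
  finally show ?thesis .
qed

lemma lift_normal_metric:
  assumes z: "z \<in> \<Sigma>"
  defines "p \<equiv> inv (\<Gamma> (snd z / a)) (fst z)"
  shows "g (fst z) (lift_normal z) (tangent_map A A (\<Gamma> (snd z / a)) p u) = g p (\<eta> p) u"
    and "g (fst z) (lift_normal z) (lift_normal z) = 1"
proof -
  have zI: "snd z / a \<in> I" and p: "p \<in> S0" using z by (auto simp: in_twisting p_def)
  have x: "\<Gamma> (snd z / a) p = fst z" using zI by (simp add: p_def inv_group)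
  have e: "lift_normal z = tangent_map A A (\<Gamma> (snd z / a)) p (\<eta> p)"
    by (simp add: lift_normal_def pushed_normal_def p_def Let_def)
  show "g (fst z) (lift_normal z) (tangent_map A A (\<Gamma> (snd z / a)) p u) = g p (\<eta> p) u" for u
    using isometry_metric[OF A g group_isometry[OF zI], of p "\<eta> p" u] by (simp add: e x)
  from this[of "\<eta> p"] show "g (fst z) (lift_normal z) (lift_normal z) = 1"
    using \<eta> p by (simp add: e[symmetric] unit_normal_field_def)
qed

text \<open>The differential of the isometry is onto, so \<open>u\<close> is the image of some
  \<open>u0\<close>, which must be orthogonal to \<eta> because products are preserved.\<close>

lemma horizontal_tangent:
  assumes z: "z \<in> \<Sigma>" and u: "g (fst z) (lift_normal z) u = 0"
  shows "(u, 0) \<in> tangent_space P \<Sigma> z"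
proof -
  have zI: "snd z / a \<in> I" using z by (simp add: in_twisting)
  obtain u0 where "u = tangent_map A A (\<Gamma> (snd z / a)) (inv (\<Gamma> (snd z / a)) (fst z)) u0"
    using tangent_map_isometry(3)[OF A g group_isometry[OF zI]] by (metis surjD)
  then show ?thesis
    using u lift_normal_metric(1)[OF z, of u0] unfolding tangent_space_twisting[OF z]
    by (intro CollectI exI[of _ u0] exI[of _ 0]) simp
qed

lemma orbit_tangent:
  assumes z: "z \<in> \<Sigma>"
  shows "(orbit_velocity z, a) \<in> tangent_space P \<Sigma> z"
proof -
  have zI: "snd z / a \<in> I" using z by (simp add: in_twisting)
  then show ?thesis
    using linear_0[OF linear_tangent_map[OF isometry_smooth[OF A g group_isometry[OF zI]]]]
    unfolding tangent_space_twisting[OF z] by (force intro!: exI[of _ 0] exI[of _ 1] simp: metric_simps[OF g])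
qed

text \<open>The shape that \<open>normal_form\<close> later shows to be necessary is taken as a
  definition, with the positive root \<open>k\<close> for its factor; positivity of \<open>k\<close>
  is the orientation.\<close>

lemma exists_unit_normal:
  "\<exists>N. unit_normal_field P G \<Sigma> N \<and> induced_orientation A g a \<Gamma> \<eta> \<Sigma> N"
proof -
  define k where "k z = 1 / sqrt (1 + (\<nu> z / a)\<^sup>2)" for z
  define N where "N z = k z *\<^sub>R ((lift_normal z, 0) + (- (\<nu> z / a)) *\<^sub>R vertical)" for z
  have k: "k z > 0" "(k z)\<^sup>2 * (1 + (\<nu> z / a)\<^sup>2) = 1" for z
  proof -
    have "1 + (\<nu> z / a)\<^sup>2 > 0" by (simp add: add_pos_nonneg)
    then show "k z > 0" "(k z)\<^sup>2 * (1 + (\<nu> z / a)\<^sup>2) = 1"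
      by (simp_all add: k_def power_divide)
  qed
  have s1: "smooth_fun_along P \<Sigma> (\<lambda>z. - (\<nu> z / a))"
    by (rule smooth_fun_along_compose[OF smooth_atlas_P smooth_nu, of "\<lambda>r. - (r / a)"])
      (auto intro!: smooth_at_bounded_linear[of "\<lambda>r. - (r / a)"] smooth_at_ident bounded_linear_minus bounded_linear_divide)
  have s2: "smooth_fun_along P \<Sigma> k"
    unfolding k_def[abs_def]
    using smooth_fun_along_compose[OF smooth_atlas_P s1, of "\<lambda>r. 1 / sqrt (1 + r\<^sup>2)"] smooth_at_inverse_sqrt by simp
  have "smooth_field_along P \<Sigma> N"
    unfolding N_def[abs_def]
    by (intro smooth_field_along_scaleR smooth_field_along_add smooth_atlas_P s1 s2 smooth_lift_normal)
      (simp add: P_def smooth_field_along_vertical[OF A])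
  moreover have "G z (N z) (N z) = 1" if "z \<in> \<Sigma>" for z
    using k(2)[of z] lift_normal_metric(2)[OF that]
    by (simp add: G_eq N_def vertical_def metric_simps[OF g] power2_eq_square algebra_simps)
  moreover have "G z (N z) v = 0" if z: "z \<in> \<Sigma>" and v: "v \<in> tangent_space P \<Sigma> z" for z v
  proof -
    obtain u r where u: "g (inv (\<Gamma> (snd z / a)) (fst z)) (\<eta> (inv (\<Gamma> (snd z / a)) (fst z))) u = 0"
      "v = (tangent_map A A (\<Gamma> (snd z / a)) (inv (\<Gamma> (snd z / a)) (fst z)) u + r *\<^sub>R orbit_velocity z, a * r)"
      using v unfolding tangent_space_twisting[OF z] by auto
    show ?thesis
      using u(1) lift_normal_metric(1)[OF z, of u] a
      by (simp add: G_eq N_def u(2) vertical_def metric_simps[OF g] nu_eq[symmetric])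
  qed
  moreover have "induced_orientation A g a \<Gamma> \<eta> \<Sigma> N"
    unfolding induced_orientation_def
  proof
    fix z assume "z \<in> \<Sigma>"
    from lift_normal_metric(2)[OF this] k(1)[of z]
    show "product_metric g z (N z) (pushed_normal A \<Gamma> \<eta> (snd z / a) (fst z), 0) > 0"
      by (simp add: product_metric_def N_def vertical_def metric_simps[OF g] lift_normal_def)
  qed
  ultimately show ?thesis unfolding unit_normal_field_def by blast
qed

section \<open>Arbitrary unit normals: the angle function and the gradient of the height\<close>

context
  fixes N
  assumes N: "unit_normal_field P G \<Sigma> N"
begin

lemma tangent_space_eq: "z \<in> \<Sigma> \<Longrightarrow> tangent_space P \<Sigma> z = {v. G z (N z) v = 0}"
  by (rule tangent_space_eq_normal_complement[OF smooth_atlas_P riemannian_metric_G hypersurface_twisting N])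

text \<open>The factor \<open>c\<close> of the overview. It is computed from the given
  \<open>N\<close>, so its sign is free.\<close>

definition normal_part :: "'m \<times> real \<Rightarrow> real" where
  "normal_part z = G z (N z) (lift_normal z, 0)"

lemma angle_eq: "angle g N z = snd (N z)"
  by (simp add: angle_def product_metric_def vertical_def metric_simps[OF g])

lemma normal_form:
  assumes z: "z \<in> \<Sigma>"
  shows "fst (N z) = normal_part z *\<^sub>R lift_normal z"
    and "snd (N z) = - (normal_part z * \<nu> z / a)"
    and "(normal_part z)\<^sup>2 * (a\<^sup>2 + (\<nu> z)\<^sup>2) = a\<^sup>2"
    and "normal_part z \<noteq> 0"
    and "(normal_part z)\<^sup>2 + (snd (N z))\<^sup>2 = 1"
proof -
  note m = metric_simps[OF g] and e1 = lift_normal_metric(2)[OF z]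
  have np: "normal_part z = g (fst z) (lift_normal z) (fst (N z))"
    using metric_commute[OF g, of "fst z"] by (simp add: normal_part_def G_eq)
  \<comment> \<open>The part of \<open>fst (N z)\<close> orthogonal to \<open>lift_normal z\<close>.
    As a horizontal tangent direction it is orthogonal to \<open>N z\<close> too, and so has length
    zero.\<close>
  define u where "u = fst (N z) - normal_part z *\<^sub>R lift_normal z"
  have eu: "g (fst z) (lift_normal z) u = 0" by (simp add: u_def m np e1)
  then have "G z (N z) (u, 0) = 0" using horizontal_tangent[OF z] tangent_space_eq[OF z] by blast
  then have "g (fst z) (fst (N z)) u = 0" by (simp add: G_eq)
  moreover have "g (fst z) u u = g (fst z) (fst (N z)) u - normal_part z * g (fst z) (lift_normal z) u"
    using m(3)[of "fst z" "fst (N z)" "normal_part z *\<^sub>R lift_normal z" u]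
    by (simp add: u_def[symmetric] m(5))
  ultimately have "g (fst z) u u = 0" using eu by simp
  then have "u = 0" by (simp add: metric_eq_0_iff[OF g])
  then show f: "fst (N z) = normal_part z *\<^sub>R lift_normal z" by (simp add: u_def)
  have "G z (N z) (orbit_velocity z, a) = 0" using orbit_tangent[OF z] tangent_space_eq[OF z] by blast
  then show s: "snd (N z) = - (normal_part z * \<nu> z / a)"
    using a by (simp add: G_eq f m nu_eq field_simps)
  have "G z (N z) (N z) = 1" using N z by (simp add: unit_normal_field_def)
  then show 1: "(normal_part z)\<^sup>2 + (snd (N z))\<^sup>2 = 1"
    by (simp add: G_eq f m e1 power2_eq_square)
  then show 2: "(normal_part z)\<^sup>2 * (a\<^sup>2 + (\<nu> z)\<^sup>2) = a\<^sup>2"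
    using a by (simp add: s power_divide power_mult_distrib field_simps)
  show "normal_part z \<noteq> 0" using 2 a by auto
qed

lemma smooth_normal_part: "smooth_fun_along P \<Sigma> normal_part"
  unfolding normal_part_def[abs_def]
  using N by (intro smooth_fun_along_metric[OF smooth_atlas_P riemannian_metric_G] smooth_lift_normal) (simp add: unit_normal_field_def)

text \<open>Orthogonality to \<open>N\<close>, divided by the nonzero \<open>normal_part\<close>.
  Tangency is thus expressed by \<nu> alone, and the vertical component fixes the
  \<open>lift_normal\<close> component.\<close>

lemma tangent_form:
  assumes z: "z \<in> \<Sigma>" and v: "v \<in> tangent_space P \<Sigma> z"
  shows "g (fst z) (lift_normal z) (fst v) = \<nu> z / a * snd v"
proof -
  have "G z (N z) v = 0" using v tangent_space_eq[OF z] by blast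
  then have "normal_part z * (g (fst z) (lift_normal z) (fst v) - \<nu> z / a * snd v) = 0"
    by (simp add: G_eq normal_form[OF z] metric_simps[OF g] algebra_simps)
  then show ?thesis using normal_form(4)[OF z] by simp
qed

lemma normal_derivatives:
  assumes z: "z \<in> \<Sigma>" and L: "covariant_differential P G \<Sigma> N z L"
    and c: "curve_through P \<Sigma> z v c"
    and d\<nu>: "((\<lambda>t. \<nu> (c t)) has_real_derivative d\<nu>) (at 0)"
  shows "((\<lambda>t. snd (N (c t))) has_real_derivative snd (L v)) (at 0)"
    and "snd (L v) = - ((normal_part z)^3 / a * d\<nu>)"
proof -
  note c\<Sigma> = curve_in[OF c]
  have c0: "c 0 = z" using c by (simp add: curve_through_def)
  have cov: "has_covariant_derivative P G c (N \<circ> c) (L v)"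
    using L c unfolding covariant_differential_def by blast
  have par: "has_covariant_derivative P G c (\<lambda>_. vertical) 0"
    using c unfolding P_def G_def by (rule vertical_parallel[OF A g])
  show 1: "((\<lambda>t. snd (N (c t))) has_real_derivative snd (L v)) (at 0)"
    using metric_along_curve_derivative[OF smooth_atlas_P riemannian_metric_G c cov par]
    by (simp add: G_eq vertical_def metric_simps[OF g])
  obtain dc where dc: "((\<lambda>t. normal_part (c t)) has_real_derivative dc) (at 0)"
    using smooth_fun_along_curve[OF smooth_atlas_P z smooth_normal_part] c by metis
  let ?n = "normal_part z"
  \<comment> \<open>The relation between squares is differentiated, so that no root and no sign of
    \<open>normal_part\<close> has to be chosen.\<close>
  have "((\<lambda>t. (normal_part (c t))\<^sup>2 * (a\<^sup>2 + (\<nu> (c t))\<^sup>2)) has_real_derivative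
      2 * ?n * dc * (a\<^sup>2 + (\<nu> z)\<^sup>2) + ?n\<^sup>2 * (2 * \<nu> z * d\<nu>)) (at 0)"
    by (auto intro!: derivative_eq_intros dc d\<nu> simp: c0)
  moreover have "(\<lambda>t. (normal_part (c t))\<^sup>2 * (a\<^sup>2 + (\<nu> (c t))\<^sup>2)) = (\<lambda>_. a\<^sup>2)"
    using normal_form(3)[OF c\<Sigma>] by (rule ext)
  ultimately have "2 * ?n * dc * (a\<^sup>2 + (\<nu> z)\<^sup>2) + ?n\<^sup>2 * (2 * \<nu> z * d\<nu>) = 0"
    using DERIV_unique[OF _ DERIV_const[of "a\<^sup>2"]] by simp
  then have "2 * ?n * (dc * (a\<^sup>2 + (\<nu> z)\<^sup>2) + ?n * \<nu> z * d\<nu>) = 0"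
    by (simp add: algebra_simps power2_eq_square)
  then have rel: "dc * (a\<^sup>2 + (\<nu> z)\<^sup>2) = - ?n * \<nu> z * d\<nu>"
    using normal_form(4)[OF z] by simp
  have "((\<lambda>t. - (normal_part (c t) * \<nu> (c t) / a)) has_real_derivative - ((dc * \<nu> z + ?n * d\<nu>) / a)) (at 0)"
    using a by (auto intro!: derivative_eq_intros dc d\<nu> simp: c0 add_divide_distrib)
  moreover have "(\<lambda>t. snd (N (c t))) = (\<lambda>t. - (normal_part (c t) * \<nu> (c t) / a))"
    using normal_form(2)[OF c\<Sigma>] by (rule ext)
  ultimately have 2: "snd (L v) = - ((dc * \<nu> z + ?n * d\<nu>) / a)" using 1 DERIV_unique by metis
  have pos: "a\<^sup>2 + (\<nu> z)\<^sup>2 > 0" using a by (simp add: add_pos_nonneg)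
  \<comment> \<open>Multiplying by \<open>a\<^sup>2 + (\<nu> z)\<^sup>2\<close> eliminates
    \<open>dc\<close> through \<open>rel\<close>; rewriting the remaining \<open>a\<^sup>2\<close>
    by \<open>normal_form\<close> produces the cube.\<close>
  have "(dc * \<nu> z + ?n * d\<nu>) * (a\<^sup>2 + (\<nu> z)\<^sup>2) = dc * (a\<^sup>2 + (\<nu> z)\<^sup>2) * \<nu> z + ?n * d\<nu> * (a\<^sup>2 + (\<nu> z)\<^sup>2)"
    by (simp add: algebra_simps)
  also have "\<dots> = ?n * d\<nu> * a\<^sup>2" unfolding rel by (simp add: algebra_simps power2_eq_square)
  also have "\<dots> = ?n * d\<nu> * (?n\<^sup>2 * (a\<^sup>2 + (\<nu> z)\<^sup>2))" by (simp only: normal_form(3)[OF z])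
  also have "\<dots> = (?n^3 * d\<nu>) * (a\<^sup>2 + (\<nu> z)\<^sup>2)" by (simp add: power2_eq_square power3_eq_cube)
  finally have "dc * \<nu> z + ?n * d\<nu> = ?n^3 * d\<nu>" using pos by (metis mult_right_cancel less_irrefl)
  then show "snd (L v) = - (?n^3 / a * d\<nu>)" using 2 by simp
qed

lemma smooth_height: "smooth_fun_along P \<Sigma> snd"
  unfolding smooth_fun_along_def P_def using smooth_map_at_snd(1)[OF A] by (auto intro!: exI[of _ snd])

lemma height_derivative:
  assumes c: "curve_through P \<Sigma> z v c"
  shows "((\<lambda>t. snd (c t)) has_real_derivative snd v) (at 0)"
  using curve_real_derivative[OF smooth_atlas_P c, of snd] by (simp add: P_def smooth_map_at_snd[OF A])

text \<open>Both sides are tangent and pair with a tangent vector to its vertical component, so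
  their difference has length zero.\<close>

lemma grad_height_eq:
  assumes z: "z \<in> \<Sigma>"
  shows "grad_height A g \<Sigma> z = vertical - snd (N z) *\<^sub>R N z"
proof -
  note m = metric_simps[OF riemannian_metric_G]
  let ?H = "grad_height A g \<Sigma> z" and ?W = "vertical - snd (N z) *\<^sub>R N z"
  have H: "?H \<in> tangent_space P \<Sigma> z"
    "\<And>w c. curve_through P \<Sigma> z w c \<Longrightarrow> ((\<lambda>t. snd (c t)) has_real_derivative G z ?H w) (at 0)"
    using grad_works[OF smooth_atlas_P riemannian_metric_G hypersurface_twisting N smooth_height z]
    by (auto simp: grad_height_def P_def G_def o_def)
  have Gv: "G z u vertical = snd u" for u
    by (simp add: G_eq vertical_def metric_simps[OF g])
  have NN: "G z (N z) (N z) = 1" using N z by (simp add: unit_normal_field_def)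
  have W: "?W \<in> tangent_space P \<Sigma> z" by (simp add: tangent_space_eq[OF z] m Gv NN)
  have HW: "?H - ?W \<in> tangent_space P \<Sigma> z" using H(1) W by (simp add: tangent_space_eq[OF z] m)
  then obtain c where c: "curve_through P \<Sigma> z (?H - ?W) c" by (auto simp: tangent_space_def)
  have "G z ?H (?H - ?W) = snd (?H - ?W)"
    by (rule DERIV_unique[OF H(2)[OF c] height_derivative[OF c]])
  moreover have "G z ?W (?H - ?W) = snd (?H - ?W)"
    using HW metric_commute[OF riemannian_metric_G, of z vertical "?H - ?W"] unfolding tangent_space_eq[OF z] mem_Collect_eq
    by (subst m(3)) (simp only: m(5) Gv)
  ultimately have "G z (?H - ?W) (?H - ?W) = 0" by (subst m(3)) simp
  then show ?thesis by (simp add: metric_eq_0_iff[OF riemannian_metric_G])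
qed

text \<open>The vertical component is \<open>1 - \<Theta>\<^sup>2 = c\<^sup>2\<close>, which never
  vanishes; geometrically, the orbits climb with speed \<open>a > 0\<close>.\<close>

lemma grad_height_nonzero:
  assumes z: "z \<in> \<Sigma>"
  shows "grad_height A g \<Sigma> z \<noteq> 0"
proof -
  have "snd (grad_height A g \<Sigma> z) = (normal_part z)\<^sup>2"
    using normal_form(5)[OF z] by (simp add: grad_height_eq[OF z] vertical_def power2_eq_square)
  then show ?thesis using normal_form(4)[OF z] by auto
qed

text \<open>\<open>\<partial>\<^sub>t\<close> is parallel, so \<open>\<langle>A\<nabla>\<xi>, \<nabla>\<xi>\<rangle>\<close> is minus the derivative of the angle along \<open>\<nabla>\<xi>\<close>.\<close>

lemma shape_grad_height:
  assumes z: "z \<in> \<Sigma>" and L: "covariant_differential P G \<Sigma> N z L"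
  shows "G z (shape_operator P G \<Sigma> N z (grad_height A g \<Sigma> z)) (grad_height A g \<Sigma> z) =
    - snd (L (grad_height A g \<Sigma> z))"
    and "- snd (L (grad_height A g \<Sigma> z)) =
      (normal_part z)^3 / a * G z (grad P G \<Sigma> \<nu> z) vertical"
proof -
  note m = metric_simps[OF riemannian_metric_G]
  let ?H = "grad_height A g \<Sigma> z" and ?K = "grad P G \<Sigma> \<nu> z"
  have H: "?H \<in> tangent_space P \<Sigma> z"
    using grad_works[OF smooth_atlas_P riemannian_metric_G hypersurface_twisting N smooth_height z]
    by (auto simp: grad_height_def P_def G_def)
  have K: "?K \<in> tangent_space P \<Sigma> z"
    "\<And>w c. curve_through P \<Sigma> z w c \<Longrightarrow> ((\<lambda>t. \<nu> (c t)) has_real_derivative G z ?K w) (at 0)"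
    using grad_works[OF smooth_atlas_P riemannian_metric_G hypersurface_twisting N smooth_nu z] by (auto simp: o_def)
  have Gv: "G z u vertical = snd u" for u
    by (simp add: G_eq vertical_def metric_simps[OF g])
  have LN: "G z (N z) (L ?H) = 0" by (rule covariant_differential_normal[OF smooth_atlas_P riemannian_metric_G N z L H])
  have "G z (L ?H) ?H = snd (L ?H)"
    using LN metric_commute[OF riemannian_metric_G, of z "L ?H" "N z"]
    by (subst (2) grad_height_eq[OF z]) (simp add: m Gv)
  then show "G z (shape_operator P G \<Sigma> N z ?H) ?H = - snd (L ?H)"
    by (simp add: shape_operator_eq[OF smooth_atlas_P riemannian_metric_G L H] m)
  obtain c where c: "curve_through P \<Sigma> z ?H c" using H by (auto simp: tangent_space_def)
  have "G z (N z) ?K = 0" using K(1) by (simp add: tangent_space_eq[OF z])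
  \<comment> \<open>The gradient of \<nu> is tangent, so the normal term of \<nabla>\<xi> drops and
    only the vertical field is left.\<close>
  then have "G z ?K ?H = G z ?K vertical"
    using metric_commute[OF riemannian_metric_G, of z ?K "N z"] by (simp add: grad_height_eq[OF z] m)
  then show "- snd (L ?H) = (normal_part z)^3 / a * G z ?K vertical"
    using normal_derivatives(2)[OF z L c K(2)[OF c]] by simp
qed

lemma covariant_differential_exists:
  assumes "z \<in> \<Sigma>"
  obtains L where "linear L" "covariant_differential P G \<Sigma> N z L"
  using smooth_field_covariant_differential[OF smooth_atlas_P riemannian_metric_G assms] N unfolding unit_normal_field_def by metis

text \<open>At each point the two quantities differ by the factor \<open>c\<^sup>3 / a\<close>,
  which is nonzero.\<close>

lemma asymptotic_iff:
  "asymptotic_height A g \<Sigma> N \<longleftrightarrow> horizontal_on g \<Sigma> (grad P G \<Sigma> \<nu>)"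
proof -
  have "G z (shape_operator P G \<Sigma> N z (grad_height A g \<Sigma> z)) (grad_height A g \<Sigma> z) = 0 \<longleftrightarrow>
      G z (grad P G \<Sigma> \<nu> z) vertical = 0" if z: "z \<in> \<Sigma>" for z
  proof -
    obtain L where "covariant_differential P G \<Sigma> N z L" using covariant_differential_exists[OF z] .
    from shape_grad_height[OF z this] show ?thesis using normal_form(4)[OF z] a by simp
  qed
  then show ?thesis
    by (simp add: asymptotic_height_def horizontal_on_def P_def G_def)
qed

section \<open>Horizontal sections and the trace of the shape operator\<close>

lemma horizontal_section_twisting:
  "horizontal_section \<Sigma> t = (if t / a \<in> I then \<Gamma> (t / a) ` S0 else {})"
proof (cases "t / a \<in> I")
  case True
  then have "(x, t) \<in> \<Sigma> \<longleftrightarrow> x \<in> \<Gamma> (t / a) ` S0" for x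
    using inv_group[OF True] by (auto simp: in_twisting image_iff) metis
  with True show ?thesis by (auto simp: horizontal_section_def)
qed (auto simp: horizontal_section_def in_twisting)

lemma lift_normal_eq_push:
  "lift_normal z = push_field A A (\<Gamma> (snd z / a)) (inv (\<Gamma> (snd z / a))) \<eta> (fst z)"
  by (simp add: lift_normal_def pushed_normal_def push_field_def Let_def)

text \<open>
  The tangent space of \<open>\<Sigma>\<close> is spanned by the horizontal vectors \<open>U\<close> and \<open>w\<close>, a multiple of \<open>\<nabla>\<xi>\<close>; along
  \<open>U\<close> the derivative of the normal is, up to normal components, a multiple of that of the section.
\<close>

lemma weingarten_data:
  assumes asymp: "asymptotic_height A g \<Sigma> N" and min: "minimal_hypersurface A g S0 \<eta>" and z: "z \<in> \<Sigma>"
  defines "U \<equiv> {u. g (fst z) (lift_normal z) u = 0}" and "w \<equiv> ((\<nu> z / a) *\<^sub>R lift_normal z, 1)"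
  obtains L M where "linear L" "covariant_differential P G \<Sigma> N z L" "linear M" "M ` U \<subseteq> U" "trace_on U M = 0"
    "\<And>u. u \<in> U \<Longrightarrow> \<exists>r. fst (L (u, 0)) = - (normal_part z *\<^sub>R M u) + r *\<^sub>R lift_normal z"
    "snd (L w) = 0"
proof -
  note m = metric_simps[OF g]
  define s where "s = snd z / a"
  define e where "e = push_field A A (\<Gamma> s) (inv (\<Gamma> s)) \<eta>"
  have s: "s \<in> I" and zs: "z = (fst z, a * s)" using z a by (auto simp: in_twisting s_def prod_eq_iff)
  have x: "fst z \<in> \<Gamma> s ` S0"
    using z inv_group(2)[OF s, of "fst z"] by (auto simp: in_twisting s_def image_iff) metis
  have ez: "lift_normal z = e (fst z)" by (simp add: e_def s_def lift_normal_eq_push)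
  have Ss: "minimal_hypersurface A g (\<Gamma> s ` S0) e"
    unfolding e_def by (rule minimal_hypersurface_isometry[OF A g group_isometry[OF s] min])
  then have hyp: "hypersurface A (\<Gamma> s ` S0)" and e: "unit_normal_field A g (\<Gamma> s ` S0) e"
    by (auto simp: minimal_hypersurface_def)
  have TU: "tangent_space A (\<Gamma> s ` S0) (fst z) = U"
    using tangent_space_eq_normal_complement[OF A g hyp e x] by (simp add: U_def ez)
  obtain M where M: "linear M" "covariant_differential A g (\<Gamma> s ` S0) e (fst z) M"
    using smooth_field_covariant_differential[OF A g x] e unfolding unit_normal_field_def by metis
  obtain L where L: "linear L" "covariant_differential P G \<Sigma> N z L"
    using covariant_differential_exists[OF z] .
  have MU: "(\<lambda>u. - M u) ` U \<subseteq> U"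
  proof safe
    fix u assume "u \<in> U"
    from covariant_differential_normal[OF A g e x M(2), of u] this
    show "- M u \<in> U" unfolding TU by (simp add: U_def ez m)
  qed
  have subU: "subspace U" unfolding U_def by (rule subspace_normal_complement[OF A g])
  have "trace_on U (\<lambda>u. - M u) = mean_curvature A g (\<Gamma> s ` S0) e (fst z)"
    unfolding mean_curvature_def TU
    by (rule trace_on_cong[OF subU]) (simp add: shape_operator_eq[OF A g M(2)] TU)
  also have "\<dots> = 0" using Ss x unfolding minimal_hypersurface_def by blast
  finally have tr: "trace_on U (\<lambda>u. - M u) = 0" .
  have LM: "\<exists>r. fst (L (u, 0)) = - (normal_part z *\<^sub>R (- M u)) + r *\<^sub>R lift_normal z" if u: "u \<in> U" for u
  proof -
    obtain c where c: "curve_through A (\<Gamma> s ` S0) (fst z) u c"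
      using u TU unfolding tangent_space_def by blast
    \<comment> \<open>A curve in the section is lifted at constant height, so that its velocity in
      the product is \<open>(u, 0)\<close>.\<close>
    let ?c = "\<lambda>t. (c t, a * s)"
    have c0: "c 0 = fst z" using c by (simp add: curve_through_def)
    have p: "smooth_map_at A P (fst z) (\<lambda>x. (x, a * s))"
      "tangent_map A P (\<lambda>x. (x, a * s)) (fst z) u = (u, 0)"
      using smooth_map_at_Pair[OF smooth_map_at_ident[OF A] smooth_map_at_const_real[OF A]]
      by (simp_all add: P_def tangent_map_ident[OF A] tangent_map_const_real)
    have "(\<lambda>x. (x, a * s)) ` \<Gamma> s ` S0 \<subseteq> \<Sigma>" using s by (auto simp: \<Sigma>_def twisting_def)
    from curve_through_map[OF A smooth_atlas_P c p(1) this] have c': "curve_through P \<Sigma> z (u, 0) ?c"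
      by (simp add: p(2) zs[symmetric])
    obtain l where l: "\<And>c v. curve_through P \<Sigma> z v c \<Longrightarrow> ((\<lambda>t. normal_part (c t)) has_real_derivative l v) (at 0)"
      using smooth_fun_along_curve[OF smooth_atlas_P z smooth_normal_part] by metis
    obtain d\<nu> where "((\<lambda>t. \<nu> (?c t)) has_real_derivative d\<nu>) (at 0)"
      using smooth_fun_along_curve[OF smooth_atlas_P z smooth_nu] c' by metis
    note d = normal_derivatives(1)[OF z L(2) c' this]
    have cov: "has_covariant_derivative A g c (e \<circ> c) (M u)"
      using M(2) c unfolding covariant_differential_def by blast
    have "has_covariant_derivative A g c (\<lambda>t. normal_part (?c t) *\<^sub>R (e \<circ> c) t)
        (l (u, 0) *\<^sub>R (e \<circ> c) 0 + normal_part (?c 0) *\<^sub>R M u)"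
      by (rule has_covariant_derivative_scaleR[OF A g c cov l[OF c']])
    then have "has_covariant_derivative A g (\<lambda>t. fst (?c t)) (\<lambda>t. normal_part (?c t) *\<^sub>R e (c t))
        (l (u, 0) *\<^sub>R lift_normal z + normal_part z *\<^sub>R M u)"
      by (simp add: c0 ez zs[symmetric])
    from has_covariant_derivative_product[OF A g c'[unfolded P_def] this d]
    have "has_covariant_derivative P G ?c (\<lambda>t. (normal_part (?c t) *\<^sub>R e (c t), snd (N (?c t))))
        (l (u, 0) *\<^sub>R lift_normal z + normal_part z *\<^sub>R M u, snd (L (u, 0)))"
      by (simp add: P_def G_def)
    \<comment> \<open>At this height the normal \<open>e\<close> of the section is
      \<open>lift_normal\<close>, so \<open>normal_form\<close> splits \<open>N\<close> along the
      curve. Uniqueness of covariant derivatives then compares the two computations of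
      \<open>L (u, 0)\<close>.\<close>
    moreover have "(\<lambda>t. (normal_part (?c t) *\<^sub>R e (c t), snd (N (?c t)))) = N \<circ> ?c"
    proof
      show "(normal_part (?c t) *\<^sub>R e (c t), snd (N (?c t))) = (N \<circ> ?c) t" for t
        using normal_form(1)[OF curve_in[OF c', of t]] a
        by (simp add: prod_eq_iff lift_normal_eq_push e_def)
    qed
    moreover have "has_covariant_derivative P G ?c (N \<circ> ?c) (L (u, 0))"
      using L(2) c' unfolding covariant_differential_def by blast
    ultimately have "(l (u, 0) *\<^sub>R lift_normal z + normal_part z *\<^sub>R M u, snd (L (u, 0))) = L (u, 0)"
      by (intro covariant_derivative_unique[OF smooth_atlas_P riemannian_metric_G c']) simp_all
    then have "fst (L (u, 0)) = l (u, 0) *\<^sub>R lift_normal z + normal_part z *\<^sub>R M u"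
      by (metis fst_conv)
    then show ?thesis by (intro exI[of _ "l (u, 0)"]) simp
  qed
  \<comment> \<open>\<open>w\<close> is \<nabla>\<xi> rescaled to vertical component 1, so the
    asymptotic condition says that \<open>L w\<close> is horizontal.\<close>
  have "snd (L (grad_height A g \<Sigma> z)) = 0"
    using asymp z shape_grad_height(1)[OF z L(2)] by (simp add: asymptotic_height_def P_def G_def)
  moreover have "grad_height A g \<Sigma> z = (normal_part z)\<^sup>2 *\<^sub>R w"
    using normal_form(5)[OF z] normal_form(1,2)[OF z]
    by (simp add: grad_height_eq[OF z] vertical_def w_def prod_eq_iff power2_eq_square)
  ultimately have "snd (L w) = 0"
    using normal_form(4)[OF z] by (simp add: linear_scale[OF L(1)])
  \<comment> \<open>The operator handed over is minus the covariant differential of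
    \<open>e\<close>, that is, the shape operator of the section.\<close>
  then show thesis
    using that[OF L linear_compose_neg[OF M(1)] MU tr] LM by blast
qed

text \<open>Stated for an arbitrary operator \<open>K\<close>, so that it applies to the shape
  operator of \<open>N\<close> and to that of the Lorentzian normal, with different
  \<kappa>.\<close>

lemma trace_on_tangent_space_zero:
  assumes z: "z \<in> \<Sigma>"
  defines "U \<equiv> {u. g (fst z) (lift_normal z) u = 0}" and "w \<equiv> ((\<nu> z / a) *\<^sub>R lift_normal z, 1)"
  assumes M: "linear M" "M ` U \<subseteq> U" "trace_on U M = 0"
    and K: "linear K" "K ` tangent_space P \<Sigma> z \<subseteq> tangent_space P \<Sigma> z" "snd (K w) = 0"
    and KM: "\<And>u. u \<in> U \<Longrightarrow> \<exists>r. fst (K (u, 0)) = \<kappa> *\<^sub>R M u + r *\<^sub>R lift_normal z"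
  shows "trace_on (tangent_space P \<Sigma> z) K = 0"
proof -
  note m = metric_simps[OF g] and e1 = lift_normal_metric(2)[OF z]
  have T: "subspace (tangent_space P \<Sigma> z)"
    unfolding tangent_space_eq[OF z] by (rule subspace_normal_complement[OF smooth_atlas_P riemannian_metric_G])
  have U: "subspace U" unfolding U_def by (rule subspace_normal_complement[OF A g])
  have TU: "fst v - snd v *\<^sub>R fst w \<in> U" if "v \<in> tangent_space P \<Sigma> z" for v
    using tangent_form[OF z that] by (simp add: U_def w_def m e1)
  have UT: "(u, 0) \<in> tangent_space P \<Sigma> z" if "u \<in> U" for u
    using horizontal_tangent[OF z] that by (simp add: U_def)
  have w: "w \<in> tangent_space P \<Sigma> z"
    using a by (simp add: tangent_space_eq[OF z] G_eq normal_form[OF z] w_def m e1)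
  have "K (u, 0) = (\<kappa> *\<^sub>R M u, 0) + snd (K (u, 0)) *\<^sub>R w" if u: "u \<in> U" for u
  proof -
    obtain r where r: "fst (K (u, 0)) = \<kappa> *\<^sub>R M u + r *\<^sub>R lift_normal z" using KM[OF u] by blast
    have "g (fst z) (lift_normal z) (M u) = 0" using M(2) u by (auto simp: U_def)
    moreover have "K (u, 0) \<in> tangent_space P \<Sigma> z" using K(2) UT[OF u] by blast
    from tangent_form[OF z this]
    have "g (fst z) (lift_normal z) (fst (K (u, 0))) = \<nu> z / a * snd (K (u, 0))" .
    \<comment> \<open>Tangency of \<open>K (u, 0)\<close> leaves no freedom: its
      \<open>lift_normal\<close> component is tied to the vertical one exactly as for multiples of
      \<open>w\<close>.\<close>
    ultimately have "r = \<nu> z / a * snd (K (u, 0))" by (simp add: r m e1)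
    then show ?thesis using r by (simp add: prod_eq_iff w_def mult.commute)
  qed
  from trace_on_splitting[OF T U w _ TU UT K(1,2) M(1,2) this K(3)] M(3)
  show ?thesis by (simp add: w_def)
qed

lemma mean_curvature_twisting:
  assumes asymp: "asymptotic_height A g \<Sigma> N" and min: "minimal_hypersurface A g S0 \<eta>" and z: "z \<in> \<Sigma>"
  shows "mean_curvature P G \<Sigma> N z = 0"
proof -
  obtain L M where L: "linear L" "covariant_differential P G \<Sigma> N z L"
    and M: "linear M" "M ` {u. g (fst z) (lift_normal z) u = 0} \<subseteq> {u. g (fst z) (lift_normal z) u = 0}"
      "trace_on {u. g (fst z) (lift_normal z) u = 0} M = 0"
    and LM: "\<And>u. u \<in> {u. g (fst z) (lift_normal z) u = 0} \<Longrightarrow>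
      \<exists>r. fst (L (u, 0)) = - (normal_part z *\<^sub>R M u) + r *\<^sub>R lift_normal z"
    and Lw: "snd (L ((\<nu> z / a) *\<^sub>R lift_normal z, 1)) = 0"
    using weingarten_data[OF asymp min z] by blast
  have T: "subspace (tangent_space P \<Sigma> z)"
    unfolding tangent_space_eq[OF z] by (rule subspace_normal_complement[OF smooth_atlas_P riemannian_metric_G])
  have "trace_on (tangent_space P \<Sigma> z) (\<lambda>v. - L v) = 0"
  proof (rule trace_on_tangent_space_zero[OF z M linear_compose_neg[OF L(1)]])
    show "(\<lambda>v. - L v) ` tangent_space P \<Sigma> z \<subseteq> tangent_space P \<Sigma> z"
      using covariant_differential_normal[OF smooth_atlas_P riemannian_metric_G N z L(2)] by (auto simp: tangent_space_eq[OF z] metric_simps[OF riemannian_metric_G])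
    show "\<exists>r. fst (- L (u, 0)) = normal_part z *\<^sub>R M u + r *\<^sub>R lift_normal z"
      if u: "u \<in> {u. g (fst z) (lift_normal z) u = 0}" for u
    proof -
      obtain r where "fst (L (u, 0)) = - (normal_part z *\<^sub>R M u) + r *\<^sub>R lift_normal z" using LM[OF u] by blast
      then show ?thesis by (intro exI[of _ "- r"]) simp
    qed
  qed (simp add: Lw)
  moreover have "mean_curvature P G \<Sigma> N z = trace_on (tangent_space P \<Sigma> z) (\<lambda>v. - L v)"
    unfolding mean_curvature_def by (rule trace_on_cong[OF T]) (rule shape_operator_eq[OF smooth_atlas_P riemannian_metric_G L(2)])
  ultimately show ?thesis by simp
qed

section \<open>Orientation and the vertical helicoid\<close>

lemma nu_eq_normal:
  "z \<in> \<Sigma> \<Longrightarrow> \<nu> z = - a * snd (N z) / normal_part z"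
  using normal_form(2,4) a by simp

text \<open>With a fixed sign, \<open>c\<close> is determined by \<Theta> through
  \<open>c\<^sup>2 = 1 - \<Theta>\<^sup>2\<close>, and \<nu> equals \<open>- a \<Theta> / c\<close>.
  A sign that changed between components of the twisting would break this.\<close>

lemma angle_constant_imp_nu_constant:
  assumes sign: "(\<forall>z\<in>\<Sigma>. normal_part z > 0) \<or> (\<forall>z\<in>\<Sigma>. normal_part z < 0)"
    and const: "angle g N constant_on \<Sigma>"
  shows "\<nu> constant_on \<Sigma>"
proof -
  obtain \<theta> where \<theta>: "\<And>z. z \<in> \<Sigma> \<Longrightarrow> snd (N z) = \<theta>"
    using const unfolding constant_on_def angle_eq by auto
  define \<sigma> where "\<sigma> = (if \<forall>z\<in>\<Sigma>. normal_part z > 0 then 1 else - 1 :: real)"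
  have "normal_part z = \<sigma> * sqrt (1 - \<theta>\<^sup>2)" if z: "z \<in> \<Sigma>" for z
  proof -
    have "(normal_part z)\<^sup>2 = 1 - \<theta>\<^sup>2" using normal_form(5)[OF z] \<theta>[OF z] by simp
    then have "\<bar>normal_part z\<bar> = sqrt (1 - \<theta>\<^sup>2)" by (metis real_sqrt_abs)
    then show ?thesis using sign z by (auto simp: \<sigma>_def split: if_splits)
  qed
  then show ?thesis
    unfolding constant_on_def using nu_eq_normal \<theta>
    by (intro exI[of _ "- a * \<theta> / (\<sigma> * sqrt (1 - \<theta>\<^sup>2))"]) simp
qed

text \<open>For connected \<open>S0\<close> the twisting is a continuous image of
  \<open>S0 \<times> I\<close>, and a continuous function without zeros keeps its sign there; an
  induced orientation makes \<open>normal_part\<close> positive outright.\<close>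

lemma normal_part_sign:
  assumes "connected S0 \<or> induced_orientation A g a \<Gamma> \<eta> \<Sigma> N"
  shows "(\<forall>z\<in>\<Sigma>. normal_part z > 0) \<or> (\<forall>z\<in>\<Sigma>. normal_part z < 0)"
  using assms
proof
  assume "induced_orientation A g a \<Gamma> \<eta> \<Sigma> N"
  then show ?thesis
    by (auto simp: induced_orientation_def normal_part_def lift_normal_def G_def)
next
  assume conn: "connected S0"
  have "is_interval I" using \<Gamma> by (simp add: one_parameter_isometry_group_def)
  then have "connected (S0 \<times> I)" using conn by (simp add: connected_Times is_interval_connected)
  moreover have "continuous_on (S0 \<times> I) (twist a \<Gamma>)"
    using smooth_map_at_isCont[OF twist_smooth(1)]
    by (intro continuous_at_imp_continuous_on) (auto simp: mem_Times_iff)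
  moreover have "\<Sigma> = twist a \<Gamma> ` (S0 \<times> I)"
    unfolding twisting_eq by (rule arg_cong[where f = "image (twist a \<Gamma>)"]) auto
  ultimately have "connected \<Sigma>" using connected_continuous_image by metis
  then have c: "connected (normal_part ` \<Sigma>)"
    using connected_continuous_image smooth_fun_along_continuous_on[OF smooth_normal_part] by blast
  show ?thesis
  proof (rule ccontr)
    assume "\<not> ?thesis"
    then obtain y z where yz: "y \<in> \<Sigma>" "normal_part y \<le> 0" "z \<in> \<Sigma>" "normal_part z \<ge> 0"
      by (auto simp: not_less)
    then have "0 \<in> normal_part ` \<Sigma>"
      using connected_contains_Icc[OF c, of "normal_part y" "normal_part z"] by auto
    then show False using normal_form(4) by auto
  qed
qed

lemma vertical_helicoid_twisting:
  assumes asymp: "asymptotic_height A g \<Sigma> N" and min: "minimal_hypersurface A g S0 \<eta>"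
    and nonconst: "\<not> \<nu> constant_on \<Sigma>"
    and or: "connected S0 \<or> induced_orientation A g a \<Gamma> \<eta> \<Sigma> N"
  shows "vertical_helicoid A g \<Sigma> N"
  unfolding vertical_helicoid_def
proof (intro conjI ballI allI)
  show "hypersurface (product_atlas A) \<Sigma>" using hypersurface_twisting by (simp add: P_def)
  show "unit_normal_field (product_atlas A) (product_metric g) \<Sigma> N" using N by (simp add: P_def G_def)
  show "(angle g N z)\<^sup>2 \<noteq> 1" if "z \<in> \<Sigma>" for z
    using normal_form(4,5)[OF that] by (auto simp: angle_eq)
  show "\<not> angle g N constant_on \<Sigma>"
    using angle_constant_imp_nu_constant[OF normal_part_sign[OF or]] nonconst by blast
  show "asymptotic_height A g \<Sigma> N" by (rule asymp)
  show "\<exists>\<eta>. minimal_hypersurface A g (horizontal_section \<Sigma> t) \<eta>" for t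
  proof (cases "t / a \<in> I")
    case True
    from minimal_hypersurface_isometry[OF A g group_isometry[OF this] min] True
    show ?thesis by (auto simp: horizontal_section_twisting)
  next
    \<comment> \<open>Heights that the twisting does not reach have an empty section, which is
      vacuously minimal.\<close>
    case False
    then show ?thesis
      by (simp add: horizontal_section_twisting minimal_hypersurface_def hypersurface_def
          unit_normal_field_def smooth_field_along_def)
  qed
qed

section \<open>The spacelike part\<close>

context
  fixes \<Sigma>'
  defines "\<Sigma>' \<equiv> {z \<in> \<Sigma>. \<bar>\<nu> z\<bar> > a}"
begin

lemma spacelike_part_open: "openin (top_of_set \<Sigma>) \<Sigma>'"
proof -
  have "open {r::real. \<bar>r\<bar> > a}" by (intro open_Collect_less continuous_intros)
  from continuous_openin_preimage_gen[OF smooth_fun_along_continuous_on[OF smooth_nu] this]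
  show ?thesis by (simp add: \<Sigma>'_def vimage_def Int_def)
qed

lemma hypersurface_spacelike_part: "hypersurface P \<Sigma>'"
  using spacelike_part_open hypersurface_Int_open[OF smooth_atlas_P hypersurface_twisting]
  by (auto simp: openin_open)

lemma spacelike_part_subset: "\<Sigma>' \<subseteq> \<Sigma>"
  by (auto simp: \<Sigma>'_def)

lemma unit_normal_field_spacelike_part: "unit_normal_field P G \<Sigma>' N"
  by (rule unit_normal_field_subset[OF N spacelike_part_subset])

text \<open>Both spaces are the complement of the same vector \<open>N z\<close>.\<close>

lemma tangent_space_spacelike_part: "z \<in> \<Sigma>' \<Longrightarrow> tangent_space P \<Sigma>' z = tangent_space P \<Sigma> z"
  using tangent_space_eq_normal_complement[OF smooth_atlas_P riemannian_metric_G hypersurface_spacelike_part unit_normal_field_spacelike_part, of z] tangent_space_eq[of z]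
    spacelike_part_subset by blast

text \<open>\<open>\<nu>\<^sup>2 > a\<^sup>2\<close> in
  \<open>c\<^sup>2 (a\<^sup>2 + \<nu>\<^sup>2) = a\<^sup>2\<close> gives
  \<open>2 c\<^sup>2 < 1\<close>, and \<open>\<Theta>\<^sup>2 = 1 - c\<^sup>2\<close>. This makes
  the radicand in \<open>lorentz_normal\<close> positive.\<close>

lemma angle_bound: "z \<in> \<Sigma>' \<Longrightarrow> 2 * (snd (N z))\<^sup>2 > 1"
proof -
  assume "z \<in> \<Sigma>'"
  then have z: "z \<in> \<Sigma>" "\<bar>\<nu> z\<bar> > a" by (auto simp: \<Sigma>'_def)
  then have "a\<^sup>2 < (\<nu> z)\<^sup>2" using a power_strict_mono[of a "\<bar>\<nu> z\<bar>" 2] by simp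
  then have "a\<^sup>2 + a\<^sup>2 < a\<^sup>2 + (\<nu> z)\<^sup>2" by simp
  then have "(normal_part z)\<^sup>2 * (a\<^sup>2 + a\<^sup>2) < (normal_part z)\<^sup>2 * (a\<^sup>2 + (\<nu> z)\<^sup>2)"
    using normal_form(4)[OF z(1)] by (intro mult_strict_left_mono) auto
  then have "(2 * (normal_part z)\<^sup>2) * a\<^sup>2 < 1 * a\<^sup>2"
    unfolding normal_form(3)[OF z(1)] by (simp add: algebra_simps)
  then have "2 * (normal_part z)\<^sup>2 < 1" by (rule mult_right_less_imp_less) simp
  then show ?thesis using normal_form(5)[OF z(1)] by simp
qed

lemma spacelike_part_spacelike: "spacelike A g \<Sigma>'"
  unfolding spacelike_def
proof (intro ballI impI)
  fix z v assume z': "z \<in> \<Sigma>'" and v': "v \<in> tangent_space (product_atlas A) \<Sigma>' z" and v0: "v \<noteq> 0"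
  note m = metric_simps[OF g]
  have z: "z \<in> \<Sigma>" and big: "\<bar>\<nu> z\<bar> > a" using z' by (auto simp: \<Sigma>'_def)
  note e1 = lift_normal_metric(2)[OF z]
  have tf: "g (fst z) (lift_normal z) (fst v) = \<nu> z / a * snd v"
    using tangent_form[OF z, of v] v' tangent_space_spacelike_part[OF z'] by (simp add: P_def)
  \<comment> \<open>\<open>tangent_form\<close> ties the \<open>lift_normal\<close> component to the
    vertical one. By orthogonality the horizontal part of \<open>v\<close> has length at least
    \<open>\<bar>\<nu> z / a\<bar> * \<bar>snd v\<bar>\<close>, and the first factor exceeds 1
    here.\<close>
  define u where "u = fst v - (\<nu> z / a * snd v) *\<^sub>R lift_normal z"
  have eu: "g (fst z) (lift_normal z) u = 0" by (simp add: u_def m e1 tf)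
  have "fst v = u + (\<nu> z / a * snd v) *\<^sub>R lift_normal z" by (simp add: u_def)
  then have sq: "g (fst z) (fst v) (fst v) = g (fst z) u u + (\<nu> z / a * snd v)\<^sup>2"
    using eu metric_commute[OF g, of "fst z" u "lift_normal z"]
    by (simp add: m e1 power2_eq_square)
  have u0: "g (fst z) u u \<ge> 0" using metric_pos[OF g, of u "fst z"] by (cases "u = 0") (auto simp: m)
  show "lorentz_metric g z v v > 0"
  proof (cases "snd v = 0")
    case True
    then have "fst v \<noteq> 0" using v0 by (auto simp: prod_eq_iff)
    then show ?thesis using True metric_pos[OF g] by (simp add: lorentz_metric_def)
  next
    case False
    have "\<bar>\<nu> z / a\<bar> > 1" using big a by (simp add: abs_divide)
    then have "(\<nu> z / a)\<^sup>2 > 1" by (metis abs_square_le_1 not_less)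
    then have "(\<nu> z / a)\<^sup>2 * (snd v)\<^sup>2 > 1 * (snd v)\<^sup>2" using False by (intro mult_strict_right_mono) auto
    then have "snd v * snd v < (\<nu> z / a * snd v)\<^sup>2" by (simp add: power_mult_distrib power2_eq_square ac_simps)
    then show ?thesis using u0 sq by (simp add: lorentz_metric_def)
  qed
qed

text \<open>The product rule for \<open>lorentz_normal\<close> only adds multiples of
  \<open>N\<close> and of the vertical field to a multiple of \<open>L\<close>. On horizontal
  vectors the operator is therefore again a multiple of the one of the section, up to
  \<open>lift_normal\<close> and vertical terms.\<close>

lemma lorentz_mean_curvature_twisting:
  assumes asymp: "asymptotic_height A g \<Sigma> N" and min: "minimal_hypersurface A g S0 \<eta>" and z': "z \<in> \<Sigma>'"
  shows "lorentz_mean_curvature A g \<Sigma>' N z = 0"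
proof -
  note m = metric_simps[OF riemannian_metric_G]
  have z: "z \<in> \<Sigma>" using z' spacelike_part_subset by blast
  obtain L M where L: "linear L" "covariant_differential P G \<Sigma> N z L"
    and M: "linear M" "M ` {u. g (fst z) (lift_normal z) u = 0} \<subseteq> {u. g (fst z) (lift_normal z) u = 0}"
      "trace_on {u. g (fst z) (lift_normal z) u = 0} M = 0"
    and LM: "\<And>u. u \<in> {u. g (fst z) (lift_normal z) u = 0} \<Longrightarrow>
      \<exists>r. fst (L (u, 0)) = - (normal_part z *\<^sub>R M u) + r *\<^sub>R lift_normal z"
    and Lw: "snd (L ((\<nu> z / a) *\<^sub>R lift_normal z, 1)) = 0"
    using weingarten_data[OF asymp min z] by blast
  define \<theta> where "\<theta> = snd (N z)"
  define q where "q = 2 * \<theta>\<^sup>2 - 1"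
  have q: "q > 0" using angle_bound[OF z'] by (simp add: q_def \<theta>_def)
  define \<mu> where "\<mu> = - 1 / sqrt q"
  \<comment> \<open>The derivative of \<open>- 1 / sqrt (2 * x\<^sup>2 - 1)\<close> at \<theta>.
    With \<open>snd (L v)\<close> as the derivative of the angle along \<open>v\<close>, the map
    \<open>K\<close> is then the product rule for \<open>lorentz_normal\<close>.\<close>
  define \<mu>' where "\<mu>' = 2 * \<theta> / (q * sqrt q)"
  define K where "K v = (\<mu>' * snd (L v)) *\<^sub>R (N z - (2 * \<theta>) *\<^sub>R vertical) +
    \<mu> *\<^sub>R (L v - (2 * snd (L v)) *\<^sub>R vertical)" for v
  \<comment> \<open>This identity makes the normal components of the two summands of
    \<open>K v\<close> cancel, so that \<open>K\<close> preserves the tangent space.\<close>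
  have rel: "\<mu>' * (1 - 2 * \<theta>\<^sup>2) = 2 * \<theta> * \<mu>"
  proof -
    have "\<mu>' * (1 - 2 * \<theta>\<^sup>2) = - (\<mu>' * q)" by (simp add: q_def algebra_simps)
    also have "\<dots> = 2 * \<theta> * \<mu>" using q by (simp add: \<mu>_def \<mu>'_def)
    finally show ?thesis .
  qed
  have "linear K"
    unfolding K_def by (rule linearI)
      (simp_all add: linear_add[OF L(1)] linear_scale[OF L(1)] algebra_simps)
  have K: "covariant_differential P G \<Sigma>' (lorentz_normal g N) z K"
    unfolding covariant_differential_def
  proof (intro allI impI)
    fix v c assume c': "curve_through P \<Sigma>' z v c"
    have c: "curve_through P \<Sigma> z v c" by (rule curve_through_subset[OF c' spacelike_part_subset])
    have c0: "c 0 = z" using c by (simp add: curve_through_def)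
    have cov: "has_covariant_derivative P G c (N \<circ> c) (L v)"
      using L(2) c unfolding covariant_differential_def by blast
    have par: "has_covariant_derivative P G c (\<lambda>_. vertical) 0"
      using c unfolding P_def G_def by (rule vertical_parallel[OF A g])
    obtain d\<nu> where "((\<lambda>t. \<nu> (c t)) has_real_derivative d\<nu>) (at 0)"
      using smooth_fun_along_curve[OF smooth_atlas_P z smooth_nu] c by metis
    note d\<theta> = normal_derivatives(1)[OF z L(2) c this]
    have d2: "((\<lambda>t. - (2 * snd (N (c t)))) has_real_derivative - (2 * snd (L v))) (at 0)"
      by (auto intro!: derivative_eq_intros d\<theta>)
    have d\<mu>: "((\<lambda>t. - 1 / sqrt (2 * (snd (N (c t)))\<^sup>2 - 1)) has_real_derivative \<mu>' * snd (L v)) (at 0)"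
    proof -
      have "((\<lambda>x. - 1 / sqrt (2 * x\<^sup>2 - 1)) has_real_derivative \<mu>') (at \<theta>)"
      proof -
        have alg: "(inverse r / 2 * (4 * \<theta>)) / (r * r) = 2 * \<theta> / (r * r * r)" if "r > 0" for r :: real
          using that by (simp add: field_simps)
        have "((\<lambda>x. - 1 / sqrt (2 * x\<^sup>2 - 1)) has_real_derivative
            (inverse (sqrt q) / 2 * (4 * \<theta>)) / (sqrt q * sqrt q)) (at \<theta>)"
          using q unfolding q_def by (auto intro!: derivative_eq_intros)
        also have "(inverse (sqrt q) / 2 * (4 * \<theta>)) / (sqrt q * sqrt q) = \<mu>'"
          using alg[of "sqrt q"] q by (simp add: \<mu>'_def)
        finally show ?thesis .
      qed
      from DERIV_chain2[of _ _ "\<lambda>t. snd (N (c t))" 0, OF _ d\<theta>] this show ?thesis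
        by (simp add: c0 \<theta>_def)
    qed
    have 1: "has_covariant_derivative P G c (\<lambda>t. (N \<circ> c) t + (- (2 * snd (N (c t)))) *\<^sub>R vertical)
        (L v + ((- (2 * snd (L v))) *\<^sub>R vertical + (- (2 * snd (N (c 0)))) *\<^sub>R 0))"
      by (intro has_covariant_derivative_add[OF smooth_atlas_P riemannian_metric_G c] cov has_covariant_derivative_scaleR[OF smooth_atlas_P riemannian_metric_G c par d2])
    have "lorentz_normal g N \<circ> c = (\<lambda>t. (- 1 / sqrt (2 * (snd (N (c t)))\<^sup>2 - 1)) *\<^sub>R
        ((N \<circ> c) t + (- (2 * snd (N (c t)))) *\<^sub>R vertical))"
      by (simp add: fun_eq_iff lorentz_normal_def angle_eq)
    with has_covariant_derivative_scaleR[OF smooth_atlas_P riemannian_metric_G c 1 d\<mu>]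
    show "has_covariant_derivative P G c (lorentz_normal g N \<circ> c) (K v)"
      by (simp add: K_def c0 \<theta>_def[symmetric] \<mu>_def q_def)
  qed
  have Gv: "G z u vertical = snd u" "G z vertical u = snd u" for u
    by (simp_all add: G_eq vertical_def metric_simps[OF g])
  have NN: "G z (N z) (N z) = 1" using N z by (simp add: unit_normal_field_def)
  have KT: "G z (N z) (K v) = 0" if v: "v \<in> tangent_space P \<Sigma> z" for v
  proof -
    have "G z (N z) (L v) = 0" by (rule covariant_differential_normal[OF smooth_atlas_P riemannian_metric_G N z L(2) v])
    then have "G z (N z) (K v) = (\<mu>' * (1 - 2 * \<theta>\<^sup>2) - 2 * \<theta> * \<mu>) * snd (L v)"
      by (simp add: K_def m Gv NN \<theta>_def[symmetric] algebra_simps power2_eq_square)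
    then show ?thesis using rel by simp
  qed
  have T: "subspace (tangent_space P \<Sigma> z)"
    unfolding tangent_space_eq[OF z] by (rule subspace_normal_complement[OF smooth_atlas_P riemannian_metric_G])
  have "trace_on (tangent_space P \<Sigma> z) (\<lambda>v. - K v) = 0"
  proof (rule trace_on_tangent_space_zero[OF z M linear_compose_neg[OF \<open>linear K\<close>]])
    show "(\<lambda>v. - K v) ` tangent_space P \<Sigma> z \<subseteq> tangent_space P \<Sigma> z"
      using KT by (auto simp: tangent_space_eq[OF z] m)
    \<comment> \<open>Every term of this vertical component carries the factor
      \<open>snd (L w)\<close>, with \<open>w\<close> the multiple of \<nabla>\<xi>.\<close>
    show "snd (- K ((\<nu> z / a) *\<^sub>R lift_normal z, 1)) = 0" by (simp add: K_def Lw)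
    show "\<exists>r. fst (- K (u, 0)) = (\<mu> * normal_part z) *\<^sub>R M u + r *\<^sub>R lift_normal z"
      if u: "u \<in> {u. g (fst z) (lift_normal z) u = 0}" for u
    proof -
      obtain r where r: "fst (L (u, 0)) = - (normal_part z *\<^sub>R M u) + r *\<^sub>R lift_normal z" using LM[OF u] by blast
      show ?thesis
        \<comment> \<open>One part of the coefficient comes from the derivative of the scalar factor
          times \<open>N z\<close>, the other from \<open>L\<close>; the vertical field contributes
          nothing to the first component.\<close>
        by (intro exI[of _ "- (\<mu>' * snd (L (u, 0)) * normal_part z) - \<mu> * r"])
          (simp add: K_def vertical_def r normal_form(1)[OF z] algebra_simps)
    qed
  qed
  moreover have "trace_on (tangent_space P \<Sigma>' z) (shape_operator P G \<Sigma>' (lorentz_normal g N) z) =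
      trace_on (tangent_space P \<Sigma> z) (\<lambda>v. - K v)"
    unfolding tangent_space_spacelike_part[OF z']
    by (rule trace_on_cong[OF T]) (rule shape_operator_eq[OF smooth_atlas_P riemannian_metric_G K], simp add: tangent_space_spacelike_part[OF z'])
  ultimately show ?thesis by (simp add: lorentz_mean_curvature_def P_def G_def)
qed

lemma zero_mean_isocurved_twisting:
  assumes asymp: "asymptotic_height A g \<Sigma> N" and min: "minimal_hypersurface A g S0 \<eta>"
  shows "zero_mean_isocurved A g \<Sigma>' N"
proof -
  have "mean_curvature P G \<Sigma>' N z = 0" if z': "z \<in> \<Sigma>'" for z
  proof -
    have z: "z \<in> \<Sigma>" using z' spacelike_part_subset by blast
    obtain L where L: "covariant_differential P G \<Sigma> N z L" using covariant_differential_exists[OF z] .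
    \<comment> \<open>Curves in the open part are curves in the twisting, so the same
      \<open>L\<close> computes both shape operators.\<close>
    then have L': "covariant_differential P G \<Sigma>' N z L"
      using curve_through_subset[OF _ spacelike_part_subset] unfolding covariant_differential_def by blast
    have T: "subspace (tangent_space P \<Sigma> z)"
      unfolding tangent_space_eq[OF z] by (rule subspace_normal_complement[OF smooth_atlas_P riemannian_metric_G])
    have "mean_curvature P G \<Sigma>' N z = mean_curvature P G \<Sigma> N z"
      unfolding mean_curvature_def tangent_space_spacelike_part[OF z']
      by (rule trace_on_cong[OF T])
        (simp add: shape_operator_eq[OF smooth_atlas_P riemannian_metric_G L] shape_operator_eq[OF smooth_atlas_P riemannian_metric_G L'] tangent_space_spacelike_part[OF z'])
    then show ?thesis using mean_curvature_twisting[OF asymp min z] by simp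
  qed
  then show ?thesis
    using hypersurface_spacelike_part unit_normal_field_spacelike_part spacelike_part_spacelike lorentz_mean_curvature_twisting[OF asymp min]
    by (simp add: zero_mean_isocurved_def P_def G_def)
qed

end

end

end

theorem lemma4:
  fixes A :: "('m::{t2_space, second_countable_topology}, 'e::euclidean_space) atlas"
    and g :: "('m, 'e) metric"
    and S0 :: "'m set" and \<eta> :: "'m \<Rightarrow> 'e"
    and I :: "real set" and \<Gamma> :: "real \<Rightarrow> 'm \<Rightarrow> 'm" and a :: real
    and \<Sigma> \<Sigma>' :: "('m \<times> real) set" and \<nu> :: "'m \<times> real \<Rightarrow> real"
  assumes "smooth_atlas A" and "riemannian_metric A g" and "DIM('e) \<ge> 2"
    and "hypersurface A S0" and "unit_normal_field A g S0 \<eta>"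
    and "one_parameter_isometry_group A g I \<Gamma>"
    and "a > 0"
    and "\<Sigma> = twisting a I \<Gamma> S0"
    and "\<nu> = twisting_nu A g a \<Gamma> \<eta>"
    and "\<Sigma>' = {z \<in> \<Sigma>. \<bar>\<nu> z\<bar> > a}"
  shows "hypersurface (product_atlas A) \<Sigma> \<and>
    (\<exists>N. unit_normal_field (product_atlas A) (product_metric g) \<Sigma> N \<and>
         induced_orientation A g a \<Gamma> \<eta> \<Sigma> N) \<and>
    (\<forall>z\<in>\<Sigma>. grad_height A g \<Sigma> z \<noteq> 0) \<and>
    (\<forall>N. unit_normal_field (product_atlas A) (product_metric g) \<Sigma> N \<longrightarrow>
      (asymptotic_height A g \<Sigma> N \<longleftrightarrow>
         horizontal_on g \<Sigma> (grad (product_atlas A) (product_metric g) \<Sigma> \<nu>)) \<and>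
      (asymptotic_height A g \<Sigma> N \<and> minimal_hypersurface A g S0 \<eta> \<and> \<not> \<nu> constant_on \<Sigma> \<longrightarrow>
         minimal_hypersurface (product_atlas A) (product_metric g) \<Sigma> N \<and>
         (connected S0 \<or> induced_orientation A g a \<Gamma> \<eta> \<Sigma> N \<longrightarrow> vertical_helicoid A g \<Sigma> N) \<and>
         openin (top_of_set \<Sigma>) \<Sigma>' \<and>
         (\<Sigma>' \<noteq> {} \<longrightarrow> spacelike A g \<Sigma>' \<and> zero_mean_isocurved A g \<Sigma>' N)))"
proof -
  note * = assms(1,2,4-7)
  note [simp] = assms(8-10)
  obtain N0 where "unit_normal_field (product_atlas A) (product_metric g) \<Sigma> N0"
    using exists_unit_normal[OF *] by auto
  then have "\<forall>z\<in>\<Sigma>. grad_height A g \<Sigma> z \<noteq> 0"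
    using grad_height_nonzero[OF *] by auto
  moreover have "hypersurface (product_atlas A) \<Sigma>" using hypersurface_twisting[OF *] by simp
  ultimately show ?thesis
    using exists_unit_normal[OF *] asymptotic_iff[OF *] mean_curvature_twisting[OF *]
      vertical_helicoid_twisting[OF *] spacelike_part_open[OF *] spacelike_part_spacelike[OF *]
      zero_mean_isocurved_twisting[OF *]
    by (auto simp: minimal_hypersurface_def)
qed

end
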